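(* Let $R$ be a topological ring. Then $R$ is a semisimple, weakly locally finite profinite ring if and only if $R$ is isomorphic, as a topological ring, to a direct product (with the product topology, each factor being finite and discrete) of complete matrix rings over finite fields with only finitely many pairwise non-isomorphic rings occurring as factors in this product.
   Context: Rings are associative, not necessarily commutative and not necessarily unital. A topological ring is a ring with a Hausdorff topology for which addition, additive inversion and multiplication are continuous. A profinite ring is the limit of an inverse system of finite rings, viewed as a topological ring with the limit topology. A ring is weakly locally finite if each of its subrings generated by one element is finite (subrings need not contain a unit). The Jacobson radical is $J(R)=\{x\in R : \forall y\in R\ \exists z\in R\ (yx+z+zyx=0)\}$; $R$ is semisimple if $J(R)=\{0\}$. A complete matrix ring over a field $F$ is $M_k(F)$, the ring of all $k\times k$ matrices over $F$, for some integer $k\ge 1$. The index set of the product may be arbitrary (possibly infinite or empty). *)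

theory Defs
  imports "HOL-Analysis.Analysis" "HOL-Algebra.Algebra"
begin

text \<open>
  The ring under consideration is a type of class \<open>topological_ring\<close>.  The rings occurring in
  inverse systems and products vary with an index, so they are records of type \<open>'a ring\<close> with
  explicit carriers.
\<close>

class topological_ring = ring + t2_space + topological_ab_group_add + topological_semigroup_mult

definition jacobson_radical :: "'a::ring set" where
  "jacobson_radical = {x. \<forall>y. \<exists>z. y * x + z + z * y * x = 0}"

definition semisimple :: "'a::ring itself \<Rightarrow> bool" where
  "semisimple T \<longleftrightarrow> (jacobson_radical :: 'a set) = {0}"

definition is_subring :: "'a::ring set \<Rightarrow> bool" where
  "is_subring S \<longleftrightarrow>
     0 \<in> S \<and> (\<forall>x\<in>S. - x \<in> S) \<and> (\<forall>x\<in>S. \<forall>y\<in>S. x + y \<in> S \<and> x * y \<in> S)"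

definition weakly_locally_finite :: "'a::ring itself \<Rightarrow> bool" where
  "weakly_locally_finite T \<longleftrightarrow> (\<forall>x::'a. finite (\<Inter>{S. is_subring S \<and> x \<in> S}))"

text \<open>
  Not necessarily unital rings on a carrier.  The record field \<open>one\<close> is unconstrained here, and
  it is not required to be preserved by homomorphisms.
\<close>

locale rng = abelian_group R for R (structure) +
  assumes m_closed: "\<lbrakk>x \<in> carrier R; y \<in> carrier R\<rbrakk> \<Longrightarrow> x \<otimes> y \<in> carrier R"
    and m_assoc: "\<lbrakk>x \<in> carrier R; y \<in> carrier R; z \<in> carrier R\<rbrakk> \<Longrightarrow>
      (x \<otimes> y) \<otimes> z = x \<otimes> (y \<otimes> z)"
    and l_distr: "\<lbrakk>x \<in> carrier R; y \<in> carrier R; z \<in> carrier R\<rbrakk> \<Longrightarrow>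
      (x \<oplus> y) \<otimes> z = x \<otimes> z \<oplus> y \<otimes> z"
    and r_distr: "\<lbrakk>x \<in> carrier R; y \<in> carrier R; z \<in> carrier R\<rbrakk> \<Longrightarrow>
      z \<otimes> (x \<oplus> y) = z \<otimes> x \<oplus> z \<otimes> y"

definition rng_hom :: "('a, 'm) ring_scheme \<Rightarrow> ('b, 'n) ring_scheme \<Rightarrow> ('a \<Rightarrow> 'b) set" where
  "rng_hom R S = {h \<in> carrier R \<rightarrow> carrier S.
     \<forall>x\<in>carrier R. \<forall>y\<in>carrier R.
       h (x \<oplus>\<^bsub>R\<^esub> y) = h x \<oplus>\<^bsub>S\<^esub> h y \<and> h (x \<otimes>\<^bsub>R\<^esub> y) = h x \<otimes>\<^bsub>S\<^esub> h y}"

definition product_ring :: "'i set \<Rightarrow> ('i \<Rightarrow> 'b ring) \<Rightarrow> ('i \<Rightarrow> 'b) ring" where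
  "product_ring I A =
     \<lparr>carrier = (\<Pi>\<^sub>E i\<in>I. carrier (A i)),
      monoid.mult = (\<lambda>x y. \<lambda>i\<in>I. x i \<otimes>\<^bsub>A i\<^esub> y i),
      one = (\<lambda>i\<in>I. \<one>\<^bsub>A i\<^esub>),
      ring.zero = (\<lambda>i\<in>I. \<zero>\<^bsub>A i\<^esub>),
      ring.add = (\<lambda>x y. \<lambda>i\<in>I. x i \<oplus>\<^bsub>A i\<^esub> y i)\<rparr>"

definition discrete_product_topology :: "'i set \<Rightarrow> ('i \<Rightarrow> 'b ring) \<Rightarrow> ('i \<Rightarrow> 'b) topology" where
  "discrete_product_topology I A = product_topology (\<lambda>i. discrete_topology (carrier (A i))) I"

definition topological_ring_iso ::
    "('a::topological_ring \<Rightarrow> 'b) \<Rightarrow> 'b ring \<Rightarrow> 'b topology \<Rightarrow> bool" where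
  "topological_ring_iso \<phi> S T \<longleftrightarrow>
     bij_betw \<phi> UNIV (carrier S) \<and>
     (\<forall>x y. \<phi> (x + y) = \<phi> x \<oplus>\<^bsub>S\<^esub> \<phi> y \<and> \<phi> (x * y) = \<phi> x \<otimes>\<^bsub>S\<^esub> \<phi> y) \<and>
     homeomorphic_map euclidean T \<phi>"

text \<open>
  An inverse system over a directed partially ordered set \<open>D\<close>, where \<open>(i, j) \<in> r\<close> means
  \<open>i \<le> j\<close> and \<open>f i j\<close> is the transition map from \<open>A j\<close> to \<open>A i\<close>.
\<close>

definition inverse_system ::
    "'j set \<Rightarrow> ('j \<times> 'j) set \<Rightarrow> ('j \<Rightarrow> 'b ring) \<Rightarrow> ('j \<Rightarrow> 'j \<Rightarrow> 'b \<Rightarrow> 'b) \<Rightarrow> bool" where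
  "inverse_system D r A f \<longleftrightarrow>
     D \<noteq> {} \<and> partial_order_on D r \<and>
     (\<forall>i\<in>D. \<forall>j\<in>D. \<exists>l\<in>D. (i, l) \<in> r \<and> (j, l) \<in> r) \<and>
     (\<forall>i\<in>D. rng (A i)) \<and>
     (\<forall>(i, j)\<in>r. f i j \<in> rng_hom (A j) (A i)) \<and>
     (\<forall>i\<in>D. \<forall>x\<in>carrier (A i). f i i x = x) \<and>
     (\<forall>i j l. (i, j) \<in> r \<and> (j, l) \<in> r \<longrightarrow> (\<forall>x\<in>carrier (A l). f i j (f j l x) = f i l x))"

definition inverse_limit ::
    "'j set \<Rightarrow> ('j \<times> 'j) set \<Rightarrow> ('j \<Rightarrow> 'b ring) \<Rightarrow> ('j \<Rightarrow> 'j \<Rightarrow> 'b \<Rightarrow> 'b) \<Rightarrow> ('j \<Rightarrow> 'b) ring" where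
  "inverse_limit D r A f =
     (product_ring D A)\<lparr>carrier :=
       {x \<in> \<Pi>\<^sub>E i\<in>D. carrier (A i). \<forall>(i, j)\<in>r. f i j (x j) = x i}\<rparr>"

definition inverse_limit_topology ::
    "'j set \<Rightarrow> ('j \<times> 'j) set \<Rightarrow> ('j \<Rightarrow> 'b ring) \<Rightarrow> ('j \<Rightarrow> 'j \<Rightarrow> 'b \<Rightarrow> 'b) \<Rightarrow> ('j \<Rightarrow> 'b) topology"
  where "inverse_limit_topology D r A f =
     subtopology (discrete_product_topology D A) (carrier (inverse_limit D r A f))"

text \<open>
  Existential quantification over types is not available, so the index set consists of subsets of
  the ring and the carriers of the finite rings consist of natural numbers.  This is no restriction:
  see \<open>profinite_ringI\<close> below, which accepts inverse systems over arbitrary types.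
\<close>

definition profinite_ring :: "'a::topological_ring itself \<Rightarrow> bool" where
  "profinite_ring T \<longleftrightarrow>
     (\<exists>(D :: 'a set set) r (A :: 'a set \<Rightarrow> nat ring) f (\<phi> :: 'a \<Rightarrow> 'a set \<Rightarrow> nat).
        inverse_system D r A f \<and> (\<forall>i\<in>D. finite (carrier (A i))) \<and>
        topological_ring_iso \<phi> (inverse_limit D r A f) (inverse_limit_topology D r A f))"

definition matrix_ring :: "nat \<Rightarrow> 'f ring \<Rightarrow> (nat \<times> nat \<Rightarrow> 'f) ring" where
  "matrix_ring k F =
     \<lparr>carrier = ({..<k} \<times> {..<k}) \<rightarrow>\<^sub>E carrier F,
      monoid.mult = (\<lambda>A B. \<lambda>(i, j)\<in>{..<k} \<times> {..<k}. \<Oplus>\<^bsub>F\<^esub>l\<in>{..<k}. A (i, l) \<otimes>\<^bsub>F\<^esub> B (l, j)),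
      one = (\<lambda>(i, j)\<in>{..<k} \<times> {..<k}. if i = j then \<one>\<^bsub>F\<^esub> else \<zero>\<^bsub>F\<^esub>),
      ring.zero = (\<lambda>(i, j)\<in>{..<k} \<times> {..<k}. \<zero>\<^bsub>F\<^esub>),
      ring.add = (\<lambda>A B. \<lambda>(i, j)\<in>{..<k} \<times> {..<k}. A (i, j) \<oplus>\<^bsub>F\<^esub> B (i, j))\<rparr>"

text \<open>
  \<open>\<phi>\<close> is an isomorphism of topological rings onto the product of the rings of \<open>k i \<times> k i\<close>
  matrices over the finite fields \<open>F i\<close>, and the factors fall into finitely many isomorphism
  classes.  (The library's \<open>\<simeq>\<close> preserves \<open>\<one>\<close>, which is automatic for isomorphisms between
  unital rings.)
\<close>

definition finite_type_matrix_product ::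
    "'i set \<Rightarrow> ('i \<Rightarrow> 'f ring) \<Rightarrow> ('i \<Rightarrow> nat) \<Rightarrow>
     ('a::topological_ring \<Rightarrow> 'i \<Rightarrow> nat \<times> nat \<Rightarrow> 'f) \<Rightarrow> bool" where
  "finite_type_matrix_product I F k \<phi> \<longleftrightarrow>
     (let M = (\<lambda>i. matrix_ring (k i) (F i)) in
       (\<forall>i\<in>I. field (F i) \<and> finite (carrier (F i)) \<and> k i \<ge> 1) \<and>
       finite (I // {(i, j). i \<in> I \<and> j \<in> I \<and> M i \<simeq> M j}) \<and>
       topological_ring_iso \<phi> (product_ring I M) (discrete_product_topology I M))"

lemma topspace_discrete_product_topology [simp]:
  "topspace (discrete_product_topology I A) = (\<Pi>\<^sub>E i\<in>I. carrier (A i))"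
  by (simp add: discrete_product_topology_def)

lemma topspace_inverse_limit_topology [simp]:
  "topspace (inverse_limit_topology D r A f) = carrier (inverse_limit D r A f)"
  by (auto simp: inverse_limit_topology_def inverse_limit_def)

lemma compact_space_discrete_product:
  assumes "\<And>i. i \<in> I \<Longrightarrow> finite (carrier (A i))"
  shows "compact_space (discrete_product_topology I A)"
  using assms
  by (auto simp: discrete_product_topology_def compact_space_product_topology compact_space_discrete_topology)

lemma Hausdorff_space_discrete_product: "Hausdorff_space (discrete_product_topology I A)"
  by (auto simp: discrete_product_topology_def Hausdorff_space_product_topology)

lemma continuous_map_discrete_product_coordinate:
  "i \<in> I \<Longrightarrow> continuous_map (discrete_product_topology I A) (discrete_topology (carrier (A i))) (\<lambda>x. x i)"
  unfolding discrete_product_topology_def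
  by (rule continuous_map_product_projection)

lemma compact_space_inverse_limit:
  assumes sys: "inverse_system D r A f" and fin: "\<And>i. i \<in> D \<Longrightarrow> finite (carrier (A i))"
  shows "compact_space (inverse_limit_topology D r A f)"
proof -
  let ?P = "discrete_product_topology D A"
  have rD: "r \<subseteq> D \<times> D"
    using sys by (auto simp: inverse_system_def partial_order_on_def preorder_on_def)
  have ne: "D \<noteq> {}" using sys by (auto simp: inverse_system_def)
  then obtain d where d: "d \<in> D" by blast
  have dd: "(d, d) \<in> r"
    using sys d by (auto simp: inverse_system_def partial_order_on_def preorder_on_def refl_on_def)
  have eq: "closedin ?P {x \<in> topspace ?P. f i j (x j) = x i}" if "(i, j) \<in> r" for i j
  proof (rule closedin_continuous_maps_eq)
    have ij: "i \<in> D" "j \<in> D" using rD that by auto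
    show "Hausdorff_space (discrete_topology (carrier (A i)))" by simp
    show "continuous_map ?P (discrete_topology (carrier (A i))) (\<lambda>x. x i)"
      by (rule continuous_map_discrete_product_coordinate[OF ij(1)])
    have "f i j \<in> carrier (A j) \<rightarrow> carrier (A i)"
      using sys that by (auto simp: inverse_system_def rng_hom_def)
    then have "continuous_map (discrete_topology (carrier (A j))) (discrete_topology (carrier (A i))) (f i j)"
      by auto
    from continuous_map_compose[OF continuous_map_discrete_product_coordinate[where A=A, OF ij(2)] this]
    show "continuous_map ?P (discrete_topology (carrier (A i))) (\<lambda>x. f i j (x j))"
      by (simp add: o_def)
  qed
  have "carrier (inverse_limit D r A f) = (\<Inter>(i,j)\<in>r. {x \<in> topspace ?P. f i j (x j) = x i})"
    using dd by (auto simp: inverse_limit_def)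
  moreover have "closedin ?P \<dots>"
    using dd eq by (intro closedin_INT) auto
  ultimately have "closedin ?P (carrier (inverse_limit D r A f))" by simp
  then show ?thesis
    unfolding inverse_limit_topology_def
    using closedin_compact_space[OF compact_space_discrete_product[where I = D and A = A, OF fin]]
    by (simp add: compact_space_subtopology)
qed

lemma profinite_ring_open_idealsI:
  fixes \<U> :: "'a::topological_ring set set"
  assumes cpt: "compact (UNIV :: 'a set)" and ne: "\<U> \<noteq> {}"
    and opn: "\<And>U. U \<in> \<U> \<Longrightarrow> open U"
    and ideal0: "\<And>U. U \<in> \<U> \<Longrightarrow> 0 \<in> U"
    and idealm: "\<And>U x y. U \<in> \<U> \<Longrightarrow> x \<in> U \<Longrightarrow> y \<in> U \<Longrightarrow> x - y \<in> U"
    and ideall: "\<And>U x y. U \<in> \<U> \<Longrightarrow> x \<in> U \<Longrightarrow> y * x \<in> U"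
    and idealr: "\<And>U x y. U \<in> \<U> \<Longrightarrow> x \<in> U \<Longrightarrow> x * y \<in> U"
    and fin: "\<And>U. U \<in> \<U> \<Longrightarrow> finite (range (\<lambda>x. {y. y - x \<in> U}))"
    and dir: "\<And>U V. U \<in> \<U> \<Longrightarrow> V \<in> \<U> \<Longrightarrow> \<exists>W\<in>\<U>. W \<subseteq> U \<inter> V"
    and sep: "\<Inter>\<U> = {0}"
  shows "profinite_ring TYPE('a)"
proof -
  have ideala: "x + y \<in> U" if "U \<in> \<U>" "x \<in> U" "y \<in> U" for U x y
    using idealm[OF that(1,2) idealm[OF that(1) ideal0[OF that(1)] that(3)]] by simp
  define q where "q U x = to_nat_on (range (\<lambda>x. {y. y - x \<in> U})) {y. y - x \<in> U}" for U and x :: 'a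
  have q: "q U x = q U y \<longleftrightarrow> x - y \<in> U" if U: "U \<in> \<U>" for U x y
  proof -
    have "q U x = q U y \<longleftrightarrow> {z. z - x \<in> U} = {z. z - y \<in> U}"
      unfolding q_def
      by (rule inj_on_eq_iff[OF inj_on_to_nat_on[OF countable_finite[OF fin[OF U]]]]) auto
    also have "\<dots> \<longleftrightarrow> x - y \<in> U"
    proof
      assume "{z. z - x \<in> U} = {z. z - y \<in> U}"
      then have "x \<in> {z. z - y \<in> U}" using ideal0[OF U] by auto
      then show "x - y \<in> U" by simp
    next
      assume *: "x - y \<in> U"
      have "z - y \<in> U" if "z - x \<in> U" for z
        using ideala[OF U that *] by (simp add: algebra_simps)
      moreover have "z - x \<in> U" if "z - y \<in> U" for z
        using idealm[OF U that *] by (simp add: algebra_simps)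
      ultimately show "{z. z - x \<in> U} = {z. z - y \<in> U}" by blast
    qed
    finally show ?thesis .
  qed
  define g where "g U n = (SOME x. q U x = n)" for U n
  have g: "g U (q U x) - x \<in> U" if "U \<in> \<U>" for U x
  proof -
    have "q U (g U (q U x)) = q U x" unfolding g_def by (rule someI) simp
    then show ?thesis using q[OF that] by blast
  qed
  define A where "A U = \<lparr>carrier = range (q U), monoid.mult = (\<lambda>m n. q U (g U m * g U n)),
      one = undefined, ring.zero = q U 0, ring.add = (\<lambda>m n. q U (g U m + g U n))\<rparr>" for U
  have carA: "carrier (A U) = range (q U)" and zA: "\<zero>\<^bsub>A U\<^esub> = q U 0" for U
    by (simp_all add: A_def)
  have addA: "q U x \<oplus>\<^bsub>A U\<^esub> q U y = q U (x + y)" if U: "U \<in> \<U>" for U x y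
  proof -
    have "(g U (q U x) - x) + (g U (q U y) - y) \<in> U" using ideala[OF U g[OF U] g[OF U]] .
    then have "(g U (q U x) + g U (q U y)) - (x + y) \<in> U" by (simp add: algebra_simps)
    then show ?thesis using q[OF U] by (simp add: A_def)
  qed
  have multA: "q U x \<otimes>\<^bsub>A U\<^esub> q U y = q U (x * y)" if U: "U \<in> \<U>" for U x y
  proof -
    have "(g U (q U x) - x) * g U (q U y) + x * (g U (q U y) - y) \<in> U"
      using ideala[OF U idealr[OF U g[OF U]] ideall[OF U g[OF U]]] .
    then have "(g U (q U x) * g U (q U y)) - (x * y) \<in> U" by (simp add: algebra_simps)
    then show ?thesis using q[OF U] by (simp add: A_def)
  qed
  have rngA: "rng (A U)" if U: "U \<in> \<U>" for U
  proof -
    have "abelian_group (A U)"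
    proof (rule abelian_groupI)
      fix x assume "x \<in> carrier (A U)"
      then obtain a where "x = q U a" by (auto simp: carA)
      then have "q U (- a) \<oplus>\<^bsub>A U\<^esub> x = \<zero>\<^bsub>A U\<^esub>" by (simp add: addA[OF U] zA)
      then show "\<exists>y\<in>carrier (A U). y \<oplus>\<^bsub>A U\<^esub> x = \<zero>\<^bsub>A U\<^esub>" by (auto simp: carA)
    qed (auto simp: carA zA addA[OF U] algebra_simps)
    then show ?thesis
      by (intro rng.intro rng_axioms.intro) (auto simp: carA addA[OF U] multA[OF U] algebra_simps)
  qed
  define f where "f U V n = q U (g V n)" for U V n
  have f: "f U V (q V x) = q U x" if "U \<in> \<U>" "V \<in> \<U>" "V \<subseteq> U" for U V x
    using g[OF that(2), of x] that q[OF that(1)] by (auto simp: f_def)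
  define r where "r = {(U, V). U \<in> \<U> \<and> V \<in> \<U> \<and> V \<subseteq> U}"
  have sys: "inverse_system \<U> r A f"
    unfolding inverse_system_def
  proof (intro conjI)
    show "partial_order_on \<U> r"
      by (auto simp: r_def partial_order_on_def preorder_on_def refl_on_def trans_def antisym_def)
    show "\<forall>U\<in>\<U>. \<forall>V\<in>\<U>. \<exists>W\<in>\<U>. (U, W) \<in> r \<and> (V, W) \<in> r"
      using dir by (fastforce simp: r_def)
    show "\<forall>(U, V)\<in>r. f U V \<in> rng_hom (A V) (A U)"
      by (auto simp: r_def rng_hom_def carA f addA multA)
  qed (use ne rngA in \<open>auto simp: r_def carA f\<close>)
  define \<phi> where "\<phi> x = (\<lambda>U\<in>\<U>. q U x)" for x
  have \<phi>_in: "\<phi> x \<in> carrier (inverse_limit \<U> r A f)" for x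
    by (auto simp: inverse_limit_def \<phi>_def carA r_def f)
  have inj: "inj \<phi>"
  proof (rule injI)
    fix x y assume "\<phi> x = \<phi> y"
    then have "q U x = q U y" if "U \<in> \<U>" for U
      using that by (auto simp: \<phi>_def fun_eq_iff restrict_def split: if_splits)
    then have "x - y \<in> \<Inter>\<U>" using q by blast
    then show "x = y" using sep by simp
  qed
  have coset_open: "open {y. y - x \<in> U}" if "U \<in> \<U>" for U x
  proof -
    have "open ((\<lambda>y. y - x) -` U)"
      by (intro continuous_open_vimage opn that continuous_intros)
    then show ?thesis by (simp add: vimage_def)
  qed
  have coset_closed: "closed {y. y - x \<in> U}" if U: "U \<in> \<U>" for U x
  proof -
    have "- {y. y - x \<in> U} = (\<Union>z\<in>- {y. y - x \<in> U}. {y. y - z \<in> U})"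
    proof (intro equalityI subsetI)
      fix y assume "y \<in> (\<Union>z\<in>- {y. y - x \<in> U}. {y. y - z \<in> U})"
      then obtain z where z: "z - x \<notin> U" "y - z \<in> U" by auto
      then have "y - x \<notin> U"
        using idealm[OF U _ z(2), of "y - x"] by (auto simp: algebra_simps)
      then show "y \<in> - {y. y - x \<in> U}" by simp
    qed (use ideal0[OF U] in force)
    moreover have "open \<dots>" using coset_open[OF U] by blast
    ultimately show ?thesis by (simp add: closed_def)
  qed
  have surj: "\<exists>x. \<phi> x = z" if z: "z \<in> carrier (inverse_limit \<U> r A f)" for z
  proof -
    have zext: "z \<in> extensional \<U>" and zc: "\<And>U. U \<in> \<U> \<Longrightarrow> z U \<in> range (q U)"
      and zr: "\<And>U V. (U, V) \<in> r \<Longrightarrow> f U V (z V) = z U"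
      using z by (auto simp: inverse_limit_def PiE_iff carA)
    have "\<forall>U\<in>\<U>. \<exists>a. z U = q U a" using zc by blast
    then obtain a where a: "\<And>U. U \<in> \<U> \<Longrightarrow> z U = q U (a U)" by metis
    have "UNIV \<inter> (\<Inter>U\<in>\<U>. {y. y - a U \<in> U}) \<noteq> {}"
    proof (rule compact_imp_fip_image[OF cpt])
      show "closed {y. y - a U \<in> U}" if "U \<in> \<U>" for U using coset_closed[OF that] .
      fix S assume S: "finite S" "S \<subseteq> \<U>"
      have "\<exists>W\<in>\<U>. \<forall>U\<in>S. W \<subseteq> U" using S
      proof (induction S)
        case empty then show ?case using ne by auto
      next
        case (insert V S)
        then obtain W where W: "W \<in> \<U>" "\<forall>U\<in>S. W \<subseteq> U" by auto
        obtain W' where "W' \<in> \<U>" "W' \<subseteq> V \<inter> W" using dir[of V W] insert.prems W by auto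
        then show ?case using W by (intro bexI[of _ W']) auto
      qed
      then obtain W where W: "W \<in> \<U>" "\<forall>U\<in>S. W \<subseteq> U" by auto
      have "a W - a U \<in> U" if "U \<in> S" for U
      proof -
        have U: "U \<in> \<U>" "W \<subseteq> U" using S that W by auto
        have "q U (a U) = f U W (z W)" using zr[of U W] U W a by (auto simp: r_def)
        also have "\<dots> = q U (a W)" using a[OF W(1)] f[OF U(1) W(1) U(2)] by simp
        finally show ?thesis using q[OF U(1)] by metis
      qed
      then show "UNIV \<inter> (\<Inter>U\<in>S. {y. y - a U \<in> U}) \<noteq> {}" by blast
    qed
    then obtain x where x: "\<And>U. U \<in> \<U> \<Longrightarrow> x - a U \<in> U" by blast
    have "\<phi> x = z"
    proof (rule extensionalityI[OF _ zext])
      show "\<phi> x \<in> extensional \<U>" by (simp add: \<phi>_def)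
      show "\<phi> x U = z U" if "U \<in> \<U>" for U using x[OF that] a[OF that] q[OF that] that by (simp add: \<phi>_def)
    qed
    then show ?thesis by blast
  qed
  have bij: "bij_betw \<phi> UNIV (carrier (inverse_limit \<U> r A f))"
    using inj \<phi>_in surj unfolding bij_betw_def by blast
  have "continuous_map euclidean (discrete_topology (carrier (A U))) (q U)" if U: "U \<in> \<U>" for U
    unfolding continuous_map
  proof (intro conjI allI impI)
    fix W assume "openin (discrete_topology (carrier (A U))) W"
    have "{x. q U x \<in> W} = (\<Union>x\<in>{x. q U x \<in> W}. {y. y - x \<in> U})"
      using q[OF U] ideal0[OF U] by (auto; metis)
    moreover have "open \<dots>" using coset_open[OF U] by blast
    ultimately show "openin euclidean {x \<in> topspace euclidean. q U x \<in> W}" by simp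
  qed (auto simp: carA)
  then have "continuous_map euclidean (discrete_product_topology \<U> A) \<phi>"
    unfolding discrete_product_topology_def
    by (auto simp: continuous_map_componentwise \<phi>_def)
  then have cont: "continuous_map euclidean (inverse_limit_topology \<U> r A f) \<phi>"
    using \<phi>_in by (auto simp: inverse_limit_topology_def continuous_map_in_subtopology)
  have "homeomorphic_map euclidean (inverse_limit_topology \<U> r A f) \<phi>"
  proof (rule continuous_imp_homeomorphic_map)
    show "compact_space (euclidean :: 'a topology)" using cpt by (simp add: compact_space_def)
    show "Hausdorff_space (inverse_limit_topology \<U> r A f)"
      unfolding inverse_limit_topology_def
      by (intro Hausdorff_space_subtopology Hausdorff_space_discrete_product)
  qed (use cont bij in \<open>auto simp: bij_betw_def\<close>)
  moreover have "\<phi> (x + y) = \<phi> x \<oplus>\<^bsub>inverse_limit \<U> r A f\<^esub> \<phi> y"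
    "\<phi> (x * y) = \<phi> x \<otimes>\<^bsub>inverse_limit \<U> r A f\<^esub> \<phi> y" for x y
    by (auto simp: inverse_limit_def product_ring_def \<phi>_def addA multA fun_eq_iff)
  ultimately have iso: "topological_ring_iso \<phi> (inverse_limit \<U> r A f) (inverse_limit_topology \<U> r A f)"
    using bij by (auto simp: topological_ring_iso_def)
  have "finite (carrier (A U))" if "U \<in> \<U>" for U
  proof -
    have "range (q U) = to_nat_on (range (\<lambda>x. {y. y - x \<in> U})) ` range (\<lambda>x. {y. y - x \<in> U})"
      by (auto simp: q_def)
    then show ?thesis using fin[OF that] by (simp add: carA)
  qed
  with sys iso show ?thesis unfolding profinite_ring_def by blast
qed

lemma profinite_ringI:
  fixes D :: "'j set" and A :: "'j \<Rightarrow> 'b ring" and \<phi> :: "'a::topological_ring \<Rightarrow> 'j \<Rightarrow> 'b"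
  assumes sys: "inverse_system D r A f" and fin: "\<And>i. i \<in> D \<Longrightarrow> finite (carrier (A i))"
    and iso: "topological_ring_iso \<phi> (inverse_limit D r A f) (inverse_limit_topology D r A f)"
  shows "profinite_ring TYPE('a)"
proof -
  let ?L = "inverse_limit D r A f" and ?T = "inverse_limit_topology D r A f"
  have hm: "homeomorphic_map euclidean ?T \<phi>" and bij: "bij_betw \<phi> UNIV (carrier ?L)"
    using iso by (auto simp: topological_ring_iso_def)
  have rD: "r \<subseteq> D \<times> D"
    using sys by (auto simp: inverse_system_def partial_order_on_def preorder_on_def)
  have ne: "D \<noteq> {}" using sys by (auto simp: inverse_system_def)
  have in_car: "\<phi> x i \<in> carrier (A i)" if "i \<in> D" for x i
  proof -
    have "\<phi> x \<in> carrier ?L" using bij by (auto simp: bij_betw_def)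
    then show ?thesis using that by (auto simp: inverse_limit_def)
  qed
  have comp: "f i j (\<phi> x j) = \<phi> x i" if "(i, j) \<in> r" for x i j
  proof -
    have "\<phi> x \<in> carrier ?L" using bij by (auto simp: bij_betw_def)
    then show ?thesis using that by (auto simp: inverse_limit_def)
  qed
  have ext: "\<phi> x \<in> extensional D" for x
  proof -
    have "\<phi> x \<in> carrier ?L" using bij by (auto simp: bij_betw_def)
    then show ?thesis by (auto simp: inverse_limit_def PiE_iff)
  qed
  have addp: "\<phi> (x + y) i = \<phi> x i \<oplus>\<^bsub>A i\<^esub> \<phi> y i" if "i \<in> D" for x y i
    using iso that by (simp add: topological_ring_iso_def inverse_limit_def product_ring_def)
  have multp: "\<phi> (x * y) i = \<phi> x i \<otimes>\<^bsub>A i\<^esub> \<phi> y i" if "i \<in> D" for x y i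
    using iso that by (simp add: topological_ring_iso_def inverse_limit_def product_ring_def)
  have rngA: "rng (A i)" if "i \<in> D" for i using sys that by (auto simp: inverse_system_def)
  have zerop: "\<phi> 0 i = \<zero>\<^bsub>A i\<^esub>" if i: "i \<in> D" for i
  proof -
    interpret rng "A i" using rngA[OF i] .
    have "\<phi> 0 i \<oplus>\<^bsub>A i\<^esub> \<phi> 0 i = \<phi> 0 i" using addp[OF i, of 0 0] by simp
    then show ?thesis using in_car[OF i, of 0] by (metis a_comm r_neg r_neg1 a_inv_closed)
  qed
  have diffp: "\<phi> (x - y) i = \<zero>\<^bsub>A i\<^esub> \<longleftrightarrow> \<phi> x i = \<phi> y i" if i: "i \<in> D" for x y i
  proof -
    interpret rng "A i" using rngA[OF i] .
    have "\<phi> (x - y) i \<oplus>\<^bsub>A i\<^esub> \<phi> y i = \<phi> x i" using addp[OF i, of "x - y" y] by simp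
    then show ?thesis using in_car[OF i]
      by (metis l_zero add.l_cancel a_comm zero_closed)
  qed
  define K where "K i = {x. \<phi> x i = \<zero>\<^bsub>A i\<^esub>}" for i
  have cont: "continuous_map euclidean (discrete_topology (carrier (A i))) (\<lambda>x. \<phi> x i)" if i: "i \<in> D" for i
  proof -
    have "continuous_map euclidean (discrete_product_topology D A) \<phi>"
      using homeomorphic_imp_continuous_map[OF hm]
      by (auto simp: inverse_limit_topology_def continuous_map_in_subtopology)
    from continuous_map_compose[OF this continuous_map_discrete_product_coordinate[where A=A, OF i]]
    show ?thesis by (simp add: o_def)
  qed
  show ?thesis
  proof (rule profinite_ring_open_idealsI[where \<U> = "K ` D"])
    have "compact_space (euclidean :: 'a topology)"
      using homeomorphic_compact_space[OF homeomorphic_map_imp_homeomorphic_space[OF hm]]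
        compact_space_inverse_limit[OF sys fin] by blast
    then show "compact (UNIV :: 'a set)" by (simp add: compact_space_def)
    show "K ` D \<noteq> {}" using ne by simp
    fix U assume "U \<in> K ` D"
    then obtain i where i: "i \<in> D" "U = K i" by auto
    interpret rng "A i" using rngA[OF i(1)] .
    have sz: "a \<otimes>\<^bsub>A i\<^esub> \<zero>\<^bsub>A i\<^esub> = \<zero>\<^bsub>A i\<^esub> \<and> \<zero>\<^bsub>A i\<^esub> \<otimes>\<^bsub>A i\<^esub> a = \<zero>\<^bsub>A i\<^esub>" if a: "a \<in> carrier (A i)" for a
    proof -
      have "a \<otimes>\<^bsub>A i\<^esub> \<zero>\<^bsub>A i\<^esub> \<oplus>\<^bsub>A i\<^esub> a \<otimes>\<^bsub>A i\<^esub> \<zero>\<^bsub>A i\<^esub> = a \<otimes>\<^bsub>A i\<^esub> \<zero>\<^bsub>A i\<^esub> \<oplus>\<^bsub>A i\<^esub> \<zero>\<^bsub>A i\<^esub>"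
        using r_distr[of "\<zero>\<^bsub>A i\<^esub>" "\<zero>\<^bsub>A i\<^esub>" a] a m_closed by simp
      moreover have "\<zero>\<^bsub>A i\<^esub> \<otimes>\<^bsub>A i\<^esub> a \<oplus>\<^bsub>A i\<^esub> \<zero>\<^bsub>A i\<^esub> \<otimes>\<^bsub>A i\<^esub> a = \<zero>\<^bsub>A i\<^esub> \<otimes>\<^bsub>A i\<^esub> a \<oplus>\<^bsub>A i\<^esub> \<zero>\<^bsub>A i\<^esub>"
        using l_distr[of "\<zero>\<^bsub>A i\<^esub>" "\<zero>\<^bsub>A i\<^esub>" a] a m_closed by simp
      ultimately show ?thesis using a m_closed zero_closed by (metis add.l_cancel)
    qed
    have "openin euclidean {x \<in> topspace euclidean. \<phi> x i \<in> {\<zero>\<^bsub>A i\<^esub>}}"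
      by (rule openin_continuous_map_preimage[OF cont[OF i(1)]]) auto
    then show "open U" by (simp add: i K_def)
    show "0 \<in> U" by (simp add: i K_def zerop)
    show "x - y \<in> U" if "x \<in> U" "y \<in> U" for x y using that by (simp add: i K_def diffp)
    show "y * x \<in> U" "x * y \<in> U" if "x \<in> U" for x y
      using that sz[OF in_car[OF i(1)]] by (simp_all add: i K_def multp)
    have "finite ((\<lambda>a. {y. \<phi> y i = a}) ` carrier (A i))" using fin[OF i(1)] by simp
    then show "finite (range (\<lambda>x. {y. y - x \<in> U}))"
      by (rule finite_subset[rotated]) (use in_car i in \<open>auto simp: K_def diffp\<close>)
  next
    fix U V assume "U \<in> K ` D" "V \<in> K ` D"
    then obtain i j where ij: "i \<in> D" "U = K i" "j \<in> D" "V = K j" by auto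
    moreover have "\<forall>i\<in>D. \<forall>j\<in>D. \<exists>l\<in>D. (i, l) \<in> r \<and> (j, l) \<in> r"
      using sys unfolding inverse_system_def by blast
    ultimately obtain l where l: "l \<in> D" "(i, l) \<in> r" "(j, l) \<in> r" by blast
    have "K l \<subseteq> K m" if "m \<in> D" "(m, l) \<in> r" for m
    proof
      fix x assume "x \<in> K l"
      then have "\<phi> x l = \<phi> 0 l" using zerop[OF l(1)] by (simp add: K_def)
      then have "\<phi> x m = \<phi> 0 m" using comp[OF that(2)] by metis
      then show "x \<in> K m" using zerop[OF that(1)] by (simp add: K_def)
    qed
    then show "\<exists>W\<in>K ` D. W \<subseteq> U \<inter> V" using ij l by blast
  next
    show "\<Inter>(K ` D) = {0}"
    proof (intro equalityI subsetI)
      fix x assume "x \<in> \<Inter>(K ` D)"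
      then have "\<phi> x i = \<phi> 0 i" if "i \<in> D" for i using that by (auto simp: K_def zerop)
      then have "\<phi> x = \<phi> 0" using ext extensionalityI by blast
      then show "x \<in> {0}" using bij by (auto simp: bij_betw_def dest: injD)
    qed (auto simp: K_def zerop)
  qed
qed

lemma matrix_ring_iso:
  assumes F: "cring F" and F': "cring F'" and h: "h \<in> ring_iso F F'"
  shows "(\<lambda>A. \<lambda>p\<in>{..<k} \<times> {..<k}. h (A p)) \<in> ring_iso (matrix_ring k F) (matrix_ring k F')"
    (is "?H \<in> _")
proof -
  interpret F: cring F using F .
  interpret F': cring F' using F' .
  interpret h: ring_hom_cring F F' h
    by (intro ring_hom_cring.intro ring_hom_cring_axioms.intro)
      (use F F' h in \<open>auto simp: ring_iso_def\<close>)
  let ?S = "{..<k} \<times> {..<k}"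
  have bij: "bij_betw h (carrier F) (carrier F')" using h by (simp add: ring_iso_def)
  have car: "A p \<in> carrier F" if "A \<in> carrier (matrix_ring k F)" "p \<in> ?S" for A p
    using that by (auto simp: matrix_ring_def)
  have hom: "?H A \<in> carrier (matrix_ring k F')" if "A \<in> carrier (matrix_ring k F)" for A
    using car[OF that] by (auto simp: matrix_ring_def)
  have inj: "inj_on ?H (carrier (matrix_ring k F))"
  proof (rule inj_onI)
    fix A B assume A: "A \<in> carrier (matrix_ring k F)" and B: "B \<in> carrier (matrix_ring k F)"
      and eq: "?H A = ?H B"
    have "A p = B p" if p: "p \<in> ?S" for p
    proof -
      have "h (A p) = h (B p)" using fun_cong[OF eq, of p] p by simp
      then show ?thesis using bij car[OF A p] car[OF B p] by (auto simp: bij_betw_def dest: inj_onD)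
    qed
    then show "A = B"
      using A B by (intro extensionalityI[of A ?S B]) (auto simp: matrix_ring_def PiE_iff)
  qed
  have surj: "\<exists>A\<in>carrier (matrix_ring k F). ?H A = B" if B: "B \<in> carrier (matrix_ring k F')" for B
  proof (rule bexI)
    let ?A = "\<lambda>p\<in>?S. inv_into (carrier F) h (B p)"
    have Bc: "B p \<in> h ` carrier F" if "p \<in> ?S" for p
      using bij B that by (auto simp: matrix_ring_def bij_betw_def)
    show "?A \<in> carrier (matrix_ring k F)"
      using inv_into_into[OF Bc] by (auto simp: matrix_ring_def)
    show "?H ?A = B"
      using B f_inv_into_f[OF Bc]
      by (intro extensionalityI[of _ ?S B]) (auto simp: matrix_ring_def PiE_iff)
  qed
  show ?thesis
  proof (rule ring_iso_memI)
    show "bij_betw ?H (carrier (matrix_ring k F)) (carrier (matrix_ring k F'))"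
      unfolding bij_betw_def using inj hom surj by blast
    fix A B assume A: "A \<in> carrier (matrix_ring k F)" and B: "B \<in> carrier (matrix_ring k F)"
    show "?H A \<in> carrier (matrix_ring k F')" using hom[OF A] .
    show "?H (A \<oplus>\<^bsub>matrix_ring k F\<^esub> B) = ?H A \<oplus>\<^bsub>matrix_ring k F'\<^esub> ?H B"
      using car[OF A] car[OF B] by (auto simp: matrix_ring_def fun_eq_iff)
    have "h (\<Oplus>\<^bsub>F\<^esub>l\<in>{..<k}. A (i, l) \<otimes>\<^bsub>F\<^esub> B (l, j)) =
        (\<Oplus>\<^bsub>F'\<^esub>l\<in>{..<k}. ?H A (i, l) \<otimes>\<^bsub>F'\<^esub> ?H B (l, j))" if ij: "i < k" "j < k" for i j
    proof -
      have "h (\<Oplus>\<^bsub>F\<^esub>l\<in>{..<k}. A (i, l) \<otimes>\<^bsub>F\<^esub> B (l, j)) =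
          (\<Oplus>\<^bsub>F'\<^esub>l\<in>{..<k}. (h \<circ> (\<lambda>l. A (i, l) \<otimes>\<^bsub>F\<^esub> B (l, j))) l)"
        using car[OF A] car[OF B] ij by (intro h.hom_finsum) auto
      also have "\<dots> = (\<Oplus>\<^bsub>F'\<^esub>l\<in>{..<k}. ?H A (i, l) \<otimes>\<^bsub>F'\<^esub> ?H B (l, j))"
        using car[OF A] car[OF B] ij by (intro F'.finsum_cong') auto
      finally show ?thesis .
    qed
    then show "?H (A \<otimes>\<^bsub>matrix_ring k F\<^esub> B) = ?H A \<otimes>\<^bsub>matrix_ring k F'\<^esub> ?H B"
      by (auto simp: matrix_ring_def fun_eq_iff)
  next
    show "?H \<one>\<^bsub>matrix_ring k F\<^esub> = \<one>\<^bsub>matrix_ring k F'\<^esub>"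
      by (auto simp: matrix_ring_def fun_eq_iff)
  qed
qed

text \<open>
  Arbitrary index types and arbitrary types of field elements reduce to those used in the theorem.
\<close>

lemma finite_type_matrix_product_canonical_types:
  fixes I :: "'i set" and F :: "'i \<Rightarrow> 'f ring"
    and \<phi> :: "'a::topological_ring \<Rightarrow> 'i \<Rightarrow> nat \<times> nat \<Rightarrow> 'f"
  assumes prod: "finite_type_matrix_product I F k \<phi>"
  shows "\<exists>(I' :: 'a set) (F' :: 'a \<Rightarrow> nat ring) k' (\<phi>' :: 'a \<Rightarrow> 'a \<Rightarrow> nat \<times> nat \<Rightarrow> nat).
    finite_type_matrix_product I' F' k' \<phi>'"
proof -
  define M where "M = (\<lambda>i. matrix_ring (k i) (F i))"
  have fld: "field (F i)" and fin: "finite (carrier (F i))" and k: "k i \<ge> 1" if "i \<in> I" for i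
    using prod that by (auto simp: finite_type_matrix_product_def Let_def)
  have fq: "finite (I // {(i, j). i \<in> I \<and> j \<in> I \<and> M i \<simeq> M j})"
    and iso: "topological_ring_iso \<phi> (product_ring I M) (discrete_product_topology I M)"
    using prod by (auto simp: finite_type_matrix_product_def Let_def M_def)
  have bij: "bij_betw \<phi> UNIV (\<Pi>\<^sub>E i\<in>I. carrier (M i))"
    and hm: "homeomorphic_map euclidean (discrete_product_topology I M) \<phi>"
    using iso by (auto simp: topological_ring_iso_def product_ring_def)
  have \<phi>_in: "\<phi> x \<in> (\<Pi>\<^sub>E i\<in>I. carrier (M i))" for x using bij by (auto simp: bij_betw_def)
  have addp: "\<phi> (x + y) i = \<phi> x i \<oplus>\<^bsub>M i\<^esub> \<phi> y i"
    and multp: "\<phi> (x * y) i = \<phi> x i \<otimes>\<^bsub>M i\<^esub> \<phi> y i" if "i \<in> I" for x y i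
    using iso that by (auto simp: topological_ring_iso_def product_ring_def)
  have ring: "cring (F i)" if "i \<in> I" for i
    using fld[OF that] by (simp add: field_def domain_def)
  have zo: "\<one>\<^bsub>M i\<^esub> \<noteq> \<zero>\<^bsub>M i\<^esub>" "\<one>\<^bsub>M i\<^esub> \<in> carrier (M i)" "\<zero>\<^bsub>M i\<^esub> \<in> carrier (M i)"
    if i: "i \<in> I" for i
  proof -
    interpret field "F i" using fld[OF i] .
    have "\<one>\<^bsub>M i\<^esub> (0, 0) \<noteq> \<zero>\<^bsub>M i\<^esub> (0, 0)" using k[OF i] by (auto simp: M_def matrix_ring_def)
    then show "\<one>\<^bsub>M i\<^esub> \<noteq> \<zero>\<^bsub>M i\<^esub>" by metis
    show "\<one>\<^bsub>M i\<^esub> \<in> carrier (M i)" "\<zero>\<^bsub>M i\<^esub> \<in> carrier (M i)"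
      by (auto simp: M_def matrix_ring_def)
  qed
  define e where "e i = (\<lambda>j\<in>I. if j = i then \<one>\<^bsub>M j\<^esub> else \<zero>\<^bsub>M j\<^esub>)" for i
  have e_in: "e i \<in> (\<Pi>\<^sub>E i\<in>I. carrier (M i))" for i using zo by (auto simp: e_def)
  define u where "u i = inv_into UNIV \<phi> (e i)" for i
  have \<phi>u: "\<phi> (u i) = e i" for i
    unfolding u_def using bij e_in by (metis bij_betw_imp_surj_on f_inv_into_f)
  have inju: "inj_on u I"
  proof (rule inj_onI)
    fix i j assume ij: "i \<in> I" "j \<in> I" "u i = u j"
    then have "e i i = e j i" using \<phi>u by metis
    then show "i = j" using ij zo by (auto simp: e_def split: if_splits)
  qed
  define v where "v = inv_into I u"
  have vu: "v (u i) = i" if "i \<in> I" for i using inju that by (simp add: v_def)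
  have uv: "u (v a) = a" "v a \<in> I" if "a \<in> u ` I" for a
    using that by (auto simp: v_def f_inv_into_f inv_into_into)
  define h where "h i = to_nat_on (carrier (F i))" for i
  have injh: "inj_on (h i) (carrier (F i))" if "i \<in> I" for i
    unfolding h_def using fin[OF that] by (intro inj_on_to_nat_on countable_finite)
  define G where "G i = image_ring (h i) (F i)" for i
  have hiso: "h i \<in> ring_iso (F i) (G i)" if "i \<in> I" for i
    unfolding G_def by (rule inj_imp_image_ring_iso[OF injh[OF that]])
  have fldG: "field (G i)" if "i \<in> I" for i
    unfolding G_def by (rule field.inj_imp_image_ring_is_field[OF fld[OF that] injh[OF that]])
  have ringG: "cring (G i)" if "i \<in> I" for i
    using fldG[OF that] by (simp add: field_def domain_def)
  have finG: "finite (carrier (G i))" if "i \<in> I" for i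
    using fin[OF that] by (simp add: G_def image_ring_carrier)
  define N where "N i = matrix_ring (k i) (G i)" for i
  define H where "H i = (\<lambda>A. \<lambda>p\<in>{..<k i} \<times> {..<k i}. h i (A p))" for i
  have H: "H i \<in> ring_iso (M i) (N i)" if "i \<in> I" for i
    unfolding M_def N_def H_def by (rule matrix_ring_iso[OF ring[OF that] ringG[OF that] hiso[OF that]])
  have MN: "M i \<simeq> N i" if "i \<in> I" for i using H[OF that] by (auto simp: is_ring_iso_def)
  have NM: "N i \<simeq> M i" if i: "i \<in> I" for i
  proof -
    interpret F: cring "F i" using ring[OF i] .
    have "inv_into (carrier (F i)) (h i) \<in> ring_iso (G i) (F i)"
      by (rule ring_iso_set_sym[OF F.ring_axioms hiso[OF i]])
    from matrix_ring_iso[OF ringG[OF i] ring[OF i] this, of "k i"]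
    show ?thesis by (auto simp: M_def N_def is_ring_iso_def)
  qed
  have iso_iff: "N i \<simeq> N j \<longleftrightarrow> M i \<simeq> M j" if "i \<in> I" "j \<in> I" for i j
    using that MN NM ring_iso_trans by meson
  have bijH: "bij_betw (H i) (carrier (M i)) (carrier (N i))" if "i \<in> I" for i
    using H[OF that] by (simp add: ring_iso_def)
  define \<psi> where "\<psi> x = (\<lambda>a\<in>u ` I. H (v a) (\<phi> x (v a)))" for x
  let ?N = "\<lambda>a. N (v a)"
  have Hin: "H i (\<phi> x i) \<in> carrier (N i)" if "i \<in> I" for i x
    using bijH[OF that] \<phi>_in[of x] that by (auto simp: bij_betw_def)
  have inj: "inj \<psi>"
  proof (rule injI)
    fix x y assume eq: "\<psi> x = \<psi> y"
    have "\<phi> x i = \<phi> y i" if i: "i \<in> I" for i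
    proof -
      have "H i (\<phi> x i) = H i (\<phi> y i)" using fun_cong[OF eq, of "u i"] i vu[OF i] by (simp add: \<psi>_def)
      moreover have "\<phi> x i \<in> carrier (M i)" "\<phi> y i \<in> carrier (M i)" using \<phi>_in i by auto
      ultimately show ?thesis using bijH[OF i] by (auto simp: bij_betw_def dest: inj_onD)
    qed
    moreover have "\<phi> x \<in> extensional I" "\<phi> y \<in> extensional I" using \<phi>_in by (auto simp: PiE_iff)
    ultimately have "\<phi> x = \<phi> y" by (blast intro: extensionalityI)
    then show "x = y" using bij by (auto simp: bij_betw_def dest: injD)
  qed
  have surj: "\<exists>x. \<psi> x = w" if w: "w \<in> (\<Pi>\<^sub>E a\<in>u ` I. carrier (N (v a)))" for w
  proof -
    let ?z = "\<lambda>i\<in>I. inv_into (carrier (M i)) (H i) (w (u i))"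
    have wi: "w (u i) \<in> H i ` carrier (M i)" if "i \<in> I" for i
    proof -
      have "w (u i) \<in> carrier (N (v (u i)))" using w that by blast
      then show ?thesis using vu[OF that] bijH[OF that] by (simp add: bij_betw_def)
    qed
    have "?z \<in> (\<Pi>\<^sub>E i\<in>I. carrier (M i))" using inv_into_into[OF wi] by auto
    then have "?z \<in> range \<phi>" using bij by (simp add: bij_betw_def)
    then obtain x where x: "?z = \<phi> x" by (rule rangeE)
    have "\<psi> x a = w a" if a: "a \<in> u ` I" for a
      using a uv[OF a] f_inv_into_f[OF wi[OF uv(2)[OF a]]] by (simp add: \<psi>_def x[symmetric])
    then have "\<psi> x = w" using w by (intro extensionalityI[of _ "u ` I"]) (auto simp: \<psi>_def PiE_iff)
    then show ?thesis by blast
  qed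
  have \<psi>_in: "\<psi> x \<in> (\<Pi>\<^sub>E a\<in>u ` I. carrier (N (v a)))" for x
    using Hin uv by (auto simp: \<psi>_def vu)
  have bij': "bij_betw \<psi> UNIV (\<Pi>\<^sub>E a\<in>u ` I. carrier (N (v a)))"
    unfolding bij_betw_def using inj surj \<psi>_in by blast
  have "continuous_map euclidean (discrete_topology (carrier (N (v a)))) (\<lambda>x. H (v a) (\<phi> x (v a)))"
    if a: "a \<in> u ` I" for a
  proof -
    have "continuous_map (discrete_topology (carrier (M (v a)))) (discrete_topology (carrier (N (v a)))) (H (v a))"
      using bijH[OF uv(2)[OF a]] by (auto simp: bij_betw_def)
    from continuous_map_compose[OF homeomorphic_imp_continuous_map[OF hm] continuous_map_compose[OF
        continuous_map_discrete_product_coordinate[where A = M, OF uv(2)[OF a]] this]]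
    show ?thesis by (simp add: o_def)
  qed
  then have cont: "continuous_map euclidean (discrete_product_topology (u ` I) ?N) \<psi>"
    unfolding discrete_product_topology_def
    by (auto simp: continuous_map_componentwise \<psi>_def)
  have finM: "finite (carrier (M i))" if "i \<in> I" for i
    using fin[OF that] by (auto simp: M_def matrix_ring_def intro!: finite_PiE)
  have "compact_space (euclidean :: 'a topology)"
    using homeomorphic_compact_space[OF homeomorphic_map_imp_homeomorphic_space[OF hm]]
      compact_space_discrete_product[where I = I and A = M, OF finM] by blast
  then have hm': "homeomorphic_map euclidean (discrete_product_topology (u ` I) ?N) \<psi>"
    using cont bij' Hausdorff_space_discrete_product
    by (intro continuous_imp_homeomorphic_map) (auto simp: bij_betw_def)
  have "\<psi> (x + y) = \<psi> x \<oplus>\<^bsub>product_ring (u ` I) ?N\<^esub> \<psi> y"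
    "\<psi> (x * y) = \<psi> x \<otimes>\<^bsub>product_ring (u ` I) ?N\<^esub> \<psi> y" for x y
  proof -
    have "H i (\<phi> (x + y) i) = H i (\<phi> x i) \<oplus>\<^bsub>N i\<^esub> H i (\<phi> y i)"
      "H i (\<phi> (x * y) i) = H i (\<phi> x i) \<otimes>\<^bsub>N i\<^esub> H i (\<phi> y i)" if i: "i \<in> I" for i
    proof -
      have "\<phi> x i \<in> carrier (M i)" "\<phi> y i \<in> carrier (M i)" using \<phi>_in i by auto
      then show "H i (\<phi> (x + y) i) = H i (\<phi> x i) \<oplus>\<^bsub>N i\<^esub> H i (\<phi> y i)"
        "H i (\<phi> (x * y) i) = H i (\<phi> x i) \<otimes>\<^bsub>N i\<^esub> H i (\<phi> y i)"
        using ring_iso_memE(2,3)[OF H[OF i]] by (simp_all add: addp[OF i] multp[OF i])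
    qed
    then show "\<psi> (x + y) = \<psi> x \<oplus>\<^bsub>product_ring (u ` I) ?N\<^esub> \<psi> y"
      "\<psi> (x * y) = \<psi> x \<otimes>\<^bsub>product_ring (u ` I) ?N\<^esub> \<psi> y"
      by (auto simp: product_ring_def \<psi>_def fun_eq_iff vu)
  qed
  then have iso': "topological_ring_iso \<psi> (product_ring (u ` I) ?N) (discrete_product_topology (u ` I) ?N)"
    using bij' hm' by (simp add: topological_ring_iso_def product_ring_def)
  have "u ` I // {(a, b). a \<in> u ` I \<and> b \<in> u ` I \<and> ?N a \<simeq> ?N b}
      \<subseteq> (`) u ` (I // {(i, j). i \<in> I \<and> j \<in> I \<and> M i \<simeq> M j})"
  proof
    fix C assume "C \<in> u ` I // {(a, b). a \<in> u ` I \<and> b \<in> u ` I \<and> ?N a \<simeq> ?N b}"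
    then obtain i where i: "i \<in> I" "C = {(a, b). a \<in> u ` I \<and> b \<in> u ` I \<and> ?N a \<simeq> ?N b} `` {u i}"
      by (auto simp: quotient_def)
    have "C = u ` ({(i, j). i \<in> I \<and> j \<in> I \<and> M i \<simeq> M j} `` {i})"
      using i(1) by (auto simp: i(2) vu iso_iff)
    then show "C \<in> (`) u ` (I // {(i, j). i \<in> I \<and> j \<in> I \<and> M i \<simeq> M j})"
      using i(1) by (auto simp: quotient_def)
  qed
  then have "finite (u ` I // {(a, b). a \<in> u ` I \<and> b \<in> u ` I \<and> ?N a \<simeq> ?N b})"
    by (rule finite_subset) (use fq in simp)
  then have "finite_type_matrix_product (u ` I) (\<lambda>a. G (v a)) (\<lambda>a. k (v a)) \<psi>"
    unfolding finite_type_matrix_product_def Let_def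
    using iso' fldG finG k uv(2) by (auto simp: N_def vu)
  then show ?thesis by blast
qed

end

(*
  In a semisimple, weakly locally finite ring every nonzero left ideal contains a nonzero idempotent:
  a non-quasi-regular element y x generates a finite subring, so one of its powers is idempotent, and
  this power is not 0. If the ring is moreover profinite, then by compactness and Zorn's lemma every
  nonzero idempotent e lies above a primitive one. For e primitive, R e is a minimal left ideal; it
  is finite because some open ideal meets it trivially, and e R e is a finite division ring, hence a
  field by Wedderburn's little theorem. Multiplying on the left is then a matrix representation of R
  on R e with respect to a dual basis, and choosing one e per isomorphism class of minimal left
  ideals gives a map from R to a product of matrix rings. It is injective because idempotents abound, and
  surjective by explicit formulas on finitely many factors and by compactness on all of them.
  Surjectivity also yields single elements whose components are nilpotent shifts (or
  generators of the multiplicative groups of the fields); as each has only finitely many powers, the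
  matrix sizes and the fields are bounded.

  Conversely, in a product with finitely many types of factors, the elements whose i-th component
  depends only on the type of the i-th factor and on the i-th component of x form a finite subring
  containing x.
*)

theory Submission
  imports Defs "HOL-Computational_Algebra.Computational_Algebra"
begin

text \<open>The ring need not have a unit, so there are no complements \<open>1 - e\<close> and no
  identity matrix to start from. The identity on a minimal left ideal is instead produced inside the
  ring, as a sum of products \<open>v a * w a\<close> of a dual basis; these sums do the work of the
  central idempotents of the factors. Weak local finiteness enters the forward direction through the
  finiteness of the set of powers of each element: it turns a failure of quasi-regularity into an
  idempotent, and it gives the bounds, which cannot come from profiniteness and semisimplicity
  alone, since a product of matrix rings of unbounded size has both properties. When compactness
  produces an idempotent as a limit, the danger is that it shrinks to 0; keeping all candidates
  outside a fixed open ideal prevents this. Wedderburn's theorem is proved by Witt's class equation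
  argument.\<close>

section \<open>Finite division rings are fields\<close>

lemma map_poly_of_int_mult:
  "map_poly of_int (p * q) = (map_poly of_int p * map_poly of_int q :: complex poly)"
  by (intro poly_eqI) (simp add: coeff_map_poly coeff_mult)

lemma poly_map_poly_of_int:
  "poly (map_poly of_int p) (of_int x) = (of_int (poly p x) :: complex)"
  by (induction p) (auto simp: map_poly_pCons)

lemma map_poly_of_int_X_pow_minus_one:
  "map_poly of_int (Polynomial.monom 1 n - 1 :: int poly) = (Polynomial.monom 1 n - 1 :: complex poly)"
  by (intro poly_eqI) (simp add: coeff_map_poly)

lemma prod_mset_exists_root:
  fixes A :: "int poly multiset" and z :: complex
  assumes "poly (map_poly of_int (prod_mset A)) z = 0"
  shows "\<exists>p\<in>#A. poly (map_poly of_int p) z = 0"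
  using assms
  by (induction A) (auto simp: map_poly_of_int_mult map_poly_1')

text \<open>Factor \<open>p\<close> into primes over the integers: the product vanishes at
  \<open>z\<close>, so one factor does. The factorization gives \<open>p\<close> only up to
  associates, whence the detour through divisibility.\<close>

lemma prime_factor_with_root:
  fixes p :: "int poly" and z :: complex
  assumes "p \<noteq> 0" "poly (map_poly of_int p) z = 0"
  obtains g where "prime_elem g" "g dvd p" "poly (map_poly of_int g) z = 0"
proof -
  obtain A where A: "\<And>x. x \<in># A \<Longrightarrow> Factorial_Ring.prime x" "normalize (prod_mset A) = normalize p"
    using prime_factorization_exists'[OF assms(1)] by blast
  then have "p dvd prod_mset A" "prod_mset A dvd p"
    by (metis associated_iff_dvd)+
  then obtain c where "prod_mset A = p * c" by (auto elim: dvdE)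
  then have "poly (map_poly of_int (prod_mset A)) z = 0"
    using assms(2) by (simp only: map_poly_of_int_mult poly_mult) simp
  then obtain g where g: "g \<in># A" "poly (map_poly of_int g) z = 0"
    using prod_mset_exists_root by blast
  have "g dvd p" using g(1) \<open>prod_mset A dvd p\<close> dvd_prod_mset dvd_trans by blast
  then show thesis using that g A(1)[OF g(1)] by blast
qed

text \<open>A root of unity other than 1 has real part below 1, so already the real part of
  \<open>q - z\<close> exceeds \<open>q - 1\<close>.\<close>

lemma norm_of_nat_minus_root_of_unity:
  assumes "z ^ n = 1" "z \<noteq> (1::complex)" "n > 0" "q > 1"
  shows "norm (of_nat q - z) > real q - 1"
proof -
  have nz: "norm z = 1" using assms by (metis norm_power norm_one norm_ge_zero power_eq_1_iff neq0_conv)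
  have "Re z < 1"
  proof (rule ccontr)
    assume "\<not> Re z < 1"
    moreover have "(Re z)\<^sup>2 + (Im z)\<^sup>2 = 1" using nz by (metis cmod_power2 one_power2)
    moreover have "Re z \<le> 1" using nz complex_Re_le_cmod[of z] by simp
    ultimately have "z = 1" by (auto simp: complex_eq_iff)
    then show False using assms(2) by simp
  qed
  then have "real q - 1 < Re (of_nat q - z)" by simp
  also have "\<dots> \<le> norm (of_nat q - z)" by (rule complex_Re_le_cmod)
  finally show ?thesis .
qed

text \<open>
  The polynomial \<open>G\<close> found below is, up to sign, the cyclotomic polynomial of order \<open>n\<close>, but only
  its being a prime factor of \<open>X ^ n - 1\<close> that vanishes at a primitive root of unity matters.
\<close>

lemma cyclotomic_witness:
  fixes q n :: nat
  assumes q: "q > 1" and n: "n > 1"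
  obtains g :: int where "g dvd int q ^ n - 1" "\<not> g dvd int q - 1"
    "\<And>d. d dvd n \<Longrightarrow> 0 < d \<Longrightarrow> d < n \<Longrightarrow> \<exists>c. int q ^ n - 1 = (int q ^ d - 1) * (g * c)"
proof -
  let ?X = "\<lambda>n. Polynomial.monom 1 n - 1 :: int poly"
  let ?h = "map_poly of_int :: int poly \<Rightarrow> complex poly"
  \<comment> \<open>A primitive \<open>n\<close>-th root of unity. It is no root of
    \<open>X ^ d - 1\<close> for \<open>0 < d < n\<close>, which keeps \<open>G\<close> from
    dividing that polynomial and pushes it into the cofactor.\<close>
  define z where "z = cis (2 * pi / real n)"
  have zn: "z ^ n = 1" unfolding z_def using n by (subst Complex.DeMoivre) simp
  have zd: "z ^ d \<noteq> 1" if "0 < d" "d < n" for d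
  proof
    assume "z ^ d = 1"
    then have "cis (2 * pi * (real d / real n)) = 1" unfolding z_def by (subst (asm) Complex.DeMoivre) (simp add: mult_ac)
    then have "cos (2 * pi * (real d / real n)) = 1" by (metis cis.sel(1) one_complex.sel(1))
    then obtain m :: int where "2 * pi * (real d / real n) = of_int m * 2 * pi"
      using cos_one_2pi_int by metis
    then have "2 * pi * (real d / real n) = 2 * pi * of_int m" by (simp only: mult_ac)
    then have "real d / real n = of_int m" by (simp only: mult_cancel_left) simp
    moreover have "0 < real d / real n" "real d / real n < 1" using that n by auto
    ultimately show False by auto
  qed
  have nz: "?X n \<noteq> 0"
  proof
    assume "?X n = 0"
    then have "poly (?X n) 0 = 0" by (simp only: poly_0)
    then show False using n by (simp add: poly_monom power_0_left)
  qed
  have "poly (?h (?X n)) z = 0"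
    using zn by (simp add: map_poly_of_int_X_pow_minus_one poly_monom)
  then obtain G where G: "prime_elem G" "G dvd ?X n" "poly (?h G) z = 0"
    using prime_factor_with_root[OF nz] by blast
  have "\<exists>H. ?X n = ?X d * (G * H)" if d: "d dvd n" "0 < d" "d < n" for d
  proof -
    obtain m where m: "n = d * m" using d by auto
    have "?X n = Polynomial.monom 1 d ^ m - 1" by (simp add: m monom_power)
    also have "\<dots> = ?X d * (\<Sum>i<m. Polynomial.monom 1 d ^ i)" by (rule power_diff_1_eq)
    finally obtain H where H: "?X n = ?X d * H" by blast
    have "\<not> G dvd ?X d"
    proof
      assume "G dvd ?X d"
      then obtain c where c: "?X d = G * c" by blast
      have "poly (?h (?X d)) z = 0"
        by (simp only: c map_poly_of_int_mult poly_mult G(3)) simp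
      then show False using zd d by (simp add: map_poly_of_int_X_pow_minus_one poly_monom)
    qed
    then have "G dvd H" using G(1,2) H prime_elem_dvd_mult_iff by metis
    then show ?thesis using H by (auto elim!: dvdE)
  qed
  note GH = this
  define g where "g = poly G (int q)"
  have roots: "a ^ n = 1 \<and> a \<noteq> 1" if a: "poly (?h G) a = 0" for a
  proof
    obtain c where c: "?X n = G * c" using G(2) by blast
    have "poly (?h (?X n)) a = 0" by (simp only: c map_poly_of_int_mult poly_mult a) simp
    then show "a ^ n = 1" by (simp add: map_poly_of_int_X_pow_minus_one poly_monom)
    \<comment> \<open>1 is a simple root of \<open>X ^ n - 1\<close>, the derivative there being
      \<open>n\<close>. The factor \<open>X - 1\<close> accounts for it, so \<open>G\<close> does
      not vanish at 1.\<close>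
    obtain H where H: "?X n = ?X 1 * (G * H)" using GH[of 1] n by auto
    have "pderiv (?h (?X n)) = pderiv (?h (?X 1)) * ?h (G * H) + ?h (?X 1) * pderiv (?h (G * H))"
      by (simp only: H map_poly_of_int_mult pderiv_mult) (simp add: algebra_simps)
    then have "poly (pderiv (?h (?X n))) 1 = poly (?h G) 1 * poly (pderiv (?h (?X 1)) * ?h H) 1"
      by (simp add: map_poly_of_int_X_pow_minus_one map_poly_of_int_mult poly_monom)
    moreover have "poly (pderiv (?h (?X n))) 1 \<noteq> 0"
      using n by (simp add: map_poly_of_int_X_pow_minus_one pderiv_diff pderiv_monom poly_monom)
    ultimately show "a \<noteq> 1" using a by auto
  qed
  have hG0: "?h G \<noteq> 0" using G(1) by (auto simp: prime_elem_def map_poly_eq_0_iff)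
  obtain A where A: "?h G = Polynomial.smult (Polynomial.lead_coeff (?h G)) (\<Prod>x\<in>#A. [:- x, 1:])"
    using alg_closed_imp_factorization[OF hG0] by blast
  have inA: "poly (?h G) a = 0" if "a \<in># A" for a
  proof -
    have "poly (\<Prod>x\<in>#A. [:- x, 1:]) a = 0"
      using that by (induction A) auto
    then show ?thesis by (subst A) simp
  qed
  \<comment> \<open>Each \<open>q - a\<close> has norm above \<open>q - 1 >= 1\<close>, hence so has
    every nonempty product. The induction runs over sub-multisets of \<open>A\<close>, so that each
    element met is still a root of \<open>G\<close>.\<close>
  have lb: "norm (poly (\<Prod>x\<in>#B. [:- x, 1:]) (of_nat q)) \<ge> 1 \<and>
      (B \<noteq> {#} \<longrightarrow> norm (poly (\<Prod>x\<in>#B. [:- x, 1:]) (of_nat q)) > real q - 1)" if "B \<subseteq># A" for B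
    using that
  proof (induction B)
    case (add b B)
    let ?N = "norm (poly (\<Prod>x\<in>#B. [:- x, 1:]) (of_nat q))"
    have "b \<in># A" using add.prems by (meson mset_subset_eq_insertD)
    then have b: "norm (of_nat q - b) > real q - 1"
      using roots[OF inA] n q norm_of_nat_minus_root_of_unity by auto
    have N: "?N \<ge> 1" using add by (meson mset_subset_eq_insertD subset_mset.less_imp_le)
    have "norm (of_nat q - b) \<le> norm (of_nat q - b) * ?N"
      using mult_left_mono[OF N norm_ge_zero[of "of_nat q - b"]] by simp
    moreover have "poly (\<Prod>x\<in>#add_mset b B. [:- x, 1:]) (of_nat q) =
        (of_nat q - b) * poly (\<Prod>x\<in>#B. [:- x, 1:]) (of_nat q)"
      by (simp add: algebra_simps)
    ultimately show ?case using b q by (simp only: norm_mult) linarith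
  qed simp
  have "A \<noteq> {#}"
  proof
    assume "A = {#}"
    then have "poly (?h G) z = Polynomial.lead_coeff (?h G)" by (subst A) simp
    then show False using G(3) hG0 by simp
  qed
  then have big: "norm (poly (\<Prod>x\<in>#A. [:- x, 1:]) (of_nat q)) > real q - 1" using lb[of A] by simp
  have "Polynomial.lead_coeff (?h G) = of_int (Polynomial.lead_coeff G)"
    by (simp add: coeff_map_poly degree_map_poly)
  moreover have "Polynomial.lead_coeff G \<noteq> 0" using G(1) by (auto simp: prime_elem_def)
  moreover from this have "\<bar>Polynomial.lead_coeff G\<bar> \<ge> 1" by linarith
  then have "\<bar>real_of_int (Polynomial.lead_coeff G)\<bar> \<ge> 1" by linarith
  ultimately have lc: "norm (Polynomial.lead_coeff (?h G)) \<ge> 1" by (simp add: norm_of_int)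
  have "of_int g = poly (?h G) (of_nat q)"
    using poly_map_poly_of_int[of G "int q"] by (simp add: g_def)
  also have "\<dots> = Polynomial.lead_coeff (?h G) * poly (\<Prod>x\<in>#A. [:- x, 1:]) (of_nat q)"
    by (subst A) simp
  finally have "norm (of_int g :: complex) = norm (Polynomial.lead_coeff (?h G)) * norm (poly (\<Prod>x\<in>#A. [:- x, 1:]) (of_nat q))"
    by (simp add: norm_mult)
  also have "\<dots> \<ge> 1 * norm (poly (\<Prod>x\<in>#A. [:- x, 1:]) (of_nat q))"
    using lc by (intro mult_right_mono) auto
  finally have "real_of_int \<bar>g\<bar> > real q - 1" using big by (simp add: norm_of_int)
  then have gbig: "\<bar>g\<bar> > int q - 1" by linarith
  show thesis
  proof
    show "g dvd int q ^ n - 1"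
    proof -
      obtain c where c: "?X n = G * c" using G(2) by blast
      then have "poly (?X n) (int q) = g * poly c (int q)" by (simp only: c g_def poly_mult)
      then show ?thesis by (simp add: poly_monom)
    qed
    show "\<not> g dvd int q - 1"
      using gbig q zdvd_imp_le[of "\<bar>g\<bar>" "int q - 1"] by auto
    show "\<exists>c. int q ^ n - 1 = (int q ^ d - 1) * (g * c)" if d: "d dvd n" "0 < d" "d < n" for d
    proof -
      obtain H where H: "?X n = ?X d * (G * H)" using GH[OF d] by blast
      then have "poly (?X n) (int q) = poly (?X d) (int q) * (g * poly H (int q))"
        by (simp only: H g_def poly_mult)
      then show ?thesis by (auto simp: poly_monom)
    qed
  qed
qed

section \<open>Centralizers and the class equation of a finite division ring\<close>

context ring
begin

definition centralizer :: "'a set \<Rightarrow> 'a set" where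
  "centralizer S = {y \<in> carrier R. \<forall>x\<in>S. x \<otimes> y = y \<otimes> x}"

text \<open>A vector space over a possibly noncommutative \<open>K\<close>; when \<open>K\<close> is
  a subring, negatives arise as multiples by minus one.\<close>

definition left_subspace :: "'a set \<Rightarrow> 'a set \<Rightarrow> bool" where
  "left_subspace K W \<longleftrightarrow> W \<subseteq> carrier R \<and> \<zero> \<in> W \<and>
     (\<forall>x\<in>W. \<forall>y\<in>W. x \<oplus> y \<in> W) \<and> (\<forall>k\<in>K. \<forall>x\<in>W. k \<otimes> x \<in> W)"

text \<open>No basis is built. A subspace \<open>V\<close> of \<open>W\<close> that is largest among
  those whose size is a power of \<open>card K\<close> must be \<open>W\<close>: a vector
  \<open>v\<close> outside it would give the subspace \<open>V + K v\<close>, of size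
  \<open>card V * card K\<close>.\<close>

lemma card_left_subspace:
  assumes fin: "finite (carrier R)" and K: "subring K R"
    and inv: "\<And>k. k \<in> K \<Longrightarrow> k \<noteq> \<zero> \<Longrightarrow> \<exists>l\<in>K. l \<otimes> k = \<one>"
    and W: "left_subspace K W"
  shows "\<exists>m. card W = card K ^ m"
proof -
  interpret K: subring K R using K .
  have Kc: "k \<in> carrier R" if "k \<in> K" for k using K.subset that by blast
  define P where "P = {V. V \<subseteq> W \<and> left_subspace K V \<and> (\<exists>m. card V = card K ^ m)}"
  have finW: "finite W" and finK: "finite K"
    using W fin K.subset by (auto simp: left_subspace_def intro: finite_subset)
  have "{\<zero>} \<in> P"
    using W Kc by (auto simp: P_def left_subspace_def intro: exI[of _ 0])
  moreover have "finite P" by (rule finite_subset[of _ "Pow W"]) (use finW in \<open>auto simp: P_def\<close>)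
  ultimately obtain V where V: "V \<in> P" and max: "\<And>V'. V' \<in> P \<Longrightarrow> card V' \<le> card V"
    using Max_in[of "card ` P"] Max_ge[of "card ` P"] by (metis (no_types, lifting) empty_iff finite_imageI image_iff)
  have Vs: "V \<subseteq> W" "left_subspace K V" using V by (auto simp: P_def)
  obtain m where m: "card V = card K ^ m" using V by (auto simp: P_def)
  have Vc: "x \<in> carrier R" if "x \<in> V" for x using Vs that by (auto simp: left_subspace_def)
  have Va: "x \<oplus> y \<in> V" if "x \<in> V" "y \<in> V" for x y using Vs that by (auto simp: left_subspace_def)
  have Vk: "k \<otimes> x \<in> V" if "k \<in> K" "x \<in> V" for k x using Vs that by (auto simp: left_subspace_def)
  have Vm: "x \<ominus> y \<in> V" if "x \<in> V" "y \<in> V" for x y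
  proof -
    have "(\<ominus> \<one>) \<otimes> y \<in> V" using Vk[OF subringE(5)[OF K subringE(3)[OF K]]] that by simp
    then have "\<ominus> y \<in> V" using Vc[OF that(2)] by (simp add: l_minus)
    then show ?thesis using Va that by (simp add: a_minus_def)
  qed
  have "V = W"
  proof (rule ccontr)
    assume "V \<noteq> W"
    then obtain v where v: "v \<in> W" "v \<notin> V" using Vs by blast
    have vc: "v \<in> carrier R" using v W by (auto simp: left_subspace_def)
    let ?f = "\<lambda>(w, k). w \<oplus> k \<otimes> v"
    have "inj_on ?f (V \<times> K)"
    proof (rule inj_onI, clarify)
      fix w k w' k' assume *: "w \<in> V" "k \<in> K" "w' \<in> V" "k' \<in> K" "w \<oplus> k \<otimes> v = w' \<oplus> k' \<otimes> v"
      have c: "w \<in> carrier R" "w' \<in> carrier R" "k \<in> carrier R" "k' \<in> carrier R"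
        using * Vc Kc by auto
      have eq: "(k \<ominus> k') \<otimes> v = w' \<ominus> w"
      proof -
        have "(k \<ominus> k') \<otimes> v = (w \<oplus> k \<otimes> v) \<ominus> (w \<oplus> k' \<otimes> v)"
          using c vc by algebra
        also have "\<dots> = w' \<ominus> w" unfolding *(5) using c vc by algebra
        finally show ?thesis .
      qed
      \<comment> \<open>Otherwise \<open>k - k'\<close> has a left inverse in \<open>K\<close>, and
        scaling the equation by it would put \<open>v\<close> into \<open>V\<close>.\<close>
      have "k = k'"
      proof (rule ccontr)
        assume "k \<noteq> k'"
        then have "k \<ominus> k' \<noteq> \<zero>" using c by (simp add: r_right_minus_eq)
        moreover have kk: "k \<ominus> k' \<in> K"
          using * subringE(5,7)[OF K] by (simp add: a_minus_def)
        ultimately obtain l where l: "l \<in> K" "l \<otimes> (k \<ominus> k') = \<one>" using inv by blast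
        have "l \<otimes> ((k \<ominus> k') \<otimes> v) = v" using l Kc[OF l(1)] Kc[OF kk] vc
          by (simp add: m_assoc[symmetric])
        moreover have "l \<otimes> ((k \<ominus> k') \<otimes> v) \<in> V" using Vk Vm * l by (simp add: eq)
        ultimately show False using v by simp
      qed
      moreover from this have "w = w'" using * c vc by simp
      ultimately show "w = w' \<and> k = k'" by simp
    qed
    then have card: "card (?f ` (V \<times> K)) = card K ^ Suc m"
      by (simp add: card_image card_cartesian_product m)
    have "left_subspace K (?f ` (V \<times> K))"
      unfolding left_subspace_def
    proof (intro conjI ballI)
      show "?f ` (V \<times> K) \<subseteq> carrier R" using Vc Kc vc by auto
      show "\<zero> \<in> ?f ` (V \<times> K)"
        using Vs vc subringE(2)[OF K]
        by (intro image_eqI[of _ _ "(\<zero>, \<zero>)"]) (auto simp: left_subspace_def)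
    next
      fix x y assume "x \<in> ?f ` (V \<times> K)" "y \<in> ?f ` (V \<times> K)"
      then obtain w k w' k' where *: "w \<in> V" "k \<in> K" "w' \<in> V" "k' \<in> K"
        "x = w \<oplus> k \<otimes> v" "y = w' \<oplus> k' \<otimes> v" by auto
      have c: "w \<in> carrier R" "w' \<in> carrier R" "k \<in> carrier R" "k' \<in> carrier R"
        using * Vc Kc by auto
      have "x \<oplus> y = ?f (w \<oplus> w', k \<oplus> k')" unfolding *(5,6) prod.case using c vc by algebra
      then show "x \<oplus> y \<in> ?f ` (V \<times> K)"
        by (rule image_eqI) (use *(1-4) Va subringE(7)[OF K] in blast)
    next
      fix k' x assume "k' \<in> K" "x \<in> ?f ` (V \<times> K)"
      then obtain w k where *: "w \<in> V" "k \<in> K" "k' \<in> K" "x = w \<oplus> k \<otimes> v" by auto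
      have "k' \<otimes> x = ?f (k' \<otimes> w, k' \<otimes> k)"
        using * vc Vc Kc by (simp add: r_distr m_assoc)
      then show "k' \<otimes> x \<in> ?f ` (V \<times> K)" 
        by (rule image_eqI) (use *(1-3) Vk subringE(6)[OF K] in blast)
    qed
    moreover have "?f ` (V \<times> K) \<subseteq> W"
    proof clarify
      fix w k assume "w \<in> V" "k \<in> K"
      then have "w \<in> W" "k \<otimes> v \<in> W" using Vs v W unfolding left_subspace_def by blast+
      then show "w \<oplus> k \<otimes> v \<in> W" using W unfolding left_subspace_def by blast
    qed
    ultimately have "?f ` (V \<times> K) \<in> P" using card unfolding P_def by blast
    then have "card (?f ` (V \<times> K)) \<le> card V" by (rule max)
    moreover have "card K > 1 \<or> \<one> = \<zero>"
    proof -
      have "card {\<zero>, \<one>} \<le> card K" using finK subringE(2,3)[OF K] by (intro card_mono) auto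
      then show ?thesis by (cases "\<one> = \<zero>") auto
    qed
    moreover have "\<one> \<noteq> \<zero>"
    proof
      assume "\<one> = \<zero>"
      then have "v = \<zero>" using l_one[OF vc] vc by simp
      then show False using v Vs by (auto simp: left_subspace_def)
    qed
    ultimately show False using card m by simp
  qed
  then show ?thesis using m by blast
qed

lemma centralizer_subring:
  assumes "S \<subseteq> carrier R"
  shows "subring (centralizer S) R"
proof (rule subringI)
  have S: "s \<in> carrier R" if "s \<in> S" for s using assms that by blast
  show "centralizer S \<subseteq> carrier R" by (auto simp: centralizer_def)
  show "\<one> \<in> centralizer S" using S by (auto simp: centralizer_def)
  fix x y assume xy: "x \<in> centralizer S" "y \<in> centralizer S"
  show "x \<oplus> y \<in> centralizer S" using xy S by (auto simp: centralizer_def l_distr r_distr)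
  have "s \<otimes> (x \<otimes> y) = x \<otimes> y \<otimes> s" if s: "s \<in> S" for s
  proof -
    have c: "x \<in> carrier R" "y \<in> carrier R" "s \<in> carrier R" and e: "s \<otimes> x = x \<otimes> s" "s \<otimes> y = y \<otimes> s"
      using xy s S by (auto simp: centralizer_def)
    have "s \<otimes> (x \<otimes> y) = (s \<otimes> x) \<otimes> y" using c by (simp add: m_assoc)
    also have "\<dots> = x \<otimes> (s \<otimes> y)" using c by (simp add: e(1) m_assoc)
    also have "\<dots> = x \<otimes> y \<otimes> s" using c by (simp add: e(2) m_assoc)
    finally show ?thesis .
  qed
  then show "x \<otimes> y \<in> centralizer S" using xy by (simp add: centralizer_def)
next
  fix x assume "x \<in> centralizer S"
  then show "\<ominus> x \<in> centralizer S" using assms by (auto simp: centralizer_def l_minus r_minus)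
qed

lemma centralizer_inv_closed:
  assumes S: "S \<subseteq> carrier R" and x: "x \<in> centralizer S" "x \<in> Units R"
  shows "inv x \<in> centralizer S"
proof -
  have "s \<otimes> inv x = inv x \<otimes> s" if s: "s \<in> S" for s
  proof -
    have c: "x \<in> carrier R" "inv x \<in> carrier R" "s \<in> carrier R" and e: "s \<otimes> x = x \<otimes> s"
      using x s S by (auto simp: centralizer_def)
    have "s \<otimes> inv x = (inv x \<otimes> x) \<otimes> (s \<otimes> inv x)" using c x by simp
    also have "\<dots> = inv x \<otimes> (x \<otimes> s) \<otimes> inv x" using c by (simp add: m_assoc)
    also have "\<dots> = inv x \<otimes> s \<otimes> (x \<otimes> inv x)" using c by (simp add: e[symmetric] m_assoc)
    also have "\<dots> = inv x \<otimes> s" using c x by simp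
    finally show ?thesis .
  qed
  then show ?thesis using x by (simp add: centralizer_def)
qed

text \<open>With a center of size \<open>q\<close>, the class equation of the unit group reads
  \<open>q^n - 1 = (q - 1) + sum of (q^n - 1) / (q^d - 1)\<close>, over noncentral classes. The
  \<open>g\<close> of \<open>cyclotomic_witness\<close> divides every term except
  \<open>q - 1\<close>.\<close>

theorem finite_division_ring_is_field:
  assumes fin: "finite (carrier R)" and units: "Units R = carrier R - {\<zero>}"
  shows "field R"
proof -
  let ?C = "\<lambda>x. centralizer {x}" and ?Z = "centralizer (carrier R)"
  have one0: "\<one> \<noteq> \<zero>" using units by blast
  have inv: "\<exists>l\<in>centralizer S. l \<otimes> k = \<one>" if "S \<subseteq> carrier R" "k \<in> centralizer S" "k \<noteq> \<zero>" for S k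
    using that units centralizer_inv_closed[of S k] by (intro bexI[of _ "inv k"]) (auto simp: centralizer_def)
  have sub: "subring ?Z R" by (simp add: centralizer_subring)
  have finC: "finite (centralizer S)" for S by (rule finite_subset[OF _ fin]) (auto simp: centralizer_def)
  define q where "q = card ?Z"
  have mem01: "\<zero> \<in> centralizer S" "\<one> \<in> centralizer S" if "S \<subseteq> carrier R" for S
    using subringE(2,3)[OF centralizer_subring[OF that]] by auto
  have q: "q > 1"
  proof -
    have "card {\<zero>, \<one>} \<le> q" unfolding q_def using mem01 finC by (intro card_mono) auto
    then show ?thesis using one0 by simp
  qed
  have subsp: "left_subspace K W" if "K \<subseteq> W" "subring W R" for K W
  proof -
    show ?thesis using that subringE[OF that(2)] by (auto simp: left_subspace_def)
  qed
  have Zc: "?Z \<subseteq> centralizer S" if "S \<subseteq> carrier R" for S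
    using that by (auto simp: centralizer_def)
  obtain n where n: "card (carrier R) = q ^ n"
    using card_left_subspace[OF fin sub inv subsp[OF _ carrier_is_subring]] q_def
    by (auto simp: centralizer_def)
  have comm: "field R" if "?Z = carrier R"
  proof -
    have "x \<otimes> y = y \<otimes> x" if "x \<in> carrier R" "y \<in> carrier R" for x y
      using \<open>?Z = carrier R\<close> that unfolding centralizer_def by blast
    then interpret cring R by (unfold_locales) auto
    show ?thesis using units by (rule cring_fieldI)
  qed
  show ?thesis
  proof (rule ccontr)
    assume nf: "\<not> field R"
    then have Zne: "?Z \<noteq> carrier R" using comm by blast
    have Zlt: "card ?Z < card (carrier R)"
      using Zne fin by (intro psubset_card_mono) (auto simp: centralizer_def)
    then have "q ^ 1 < q ^ n" by (simp add: n q_def)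
    then have n1: "n > 1" using q power_strict_increasing_iff by blast
    obtain g :: int where g: "g dvd int q ^ n - 1" "\<not> g dvd int q - 1"
      "\<And>d. d dvd n \<Longrightarrow> 0 < d \<Longrightarrow> d < n \<Longrightarrow> \<exists>c. int q ^ n - 1 = (int q ^ d - 1) * (g * c)"
      using cyclotomic_witness[OF q n1] by blast
    define G where "G = units_of R"
    interpret G: group G unfolding G_def by (rule units_group)
    have Gc: "carrier G = carrier R - {\<zero>}" by (simp add: G_def units_of_carrier units)
    have Gm: "x \<otimes>\<^bsub>G\<^esub> y = x \<otimes> y" for x y by (simp add: G_def units_of_mult)
    define \<phi> where "\<phi> = (\<lambda>g. (\<lambda>h\<in>carrier G. g \<otimes>\<^bsub>G\<^esub> h \<otimes>\<^bsub>G\<^esub> (inv\<^bsub>G\<^esub> g)))"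
    interpret A: group_action G "carrier G" \<phi>
      unfolding \<phi>_def by (rule G.action_by_conjugation)
    have stab: "stabilizer G \<phi> x = ?C x - {\<zero>}" if x: "x \<in> carrier G" for x
    proof -
      have "\<phi> y x = x \<longleftrightarrow> x \<otimes> y = y \<otimes> x" if y: "y \<in> carrier G" for y
      proof -
        have "\<phi> y x = x \<longleftrightarrow> y \<otimes>\<^bsub>G\<^esub> x \<otimes>\<^bsub>G\<^esub> (inv\<^bsub>G\<^esub> y) = x" using x by (simp add: \<phi>_def)
        also have "\<dots> \<longleftrightarrow> y \<otimes>\<^bsub>G\<^esub> x = x \<otimes>\<^bsub>G\<^esub> y"
          using x y by (metis G.inv_solve_right G.m_closed)
        finally show ?thesis by (auto simp: Gm)
      qed
      then show ?thesis using x by (auto simp: stabilizer_def centralizer_def Gc)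
    qed
    define A where "A = carrier R - ?Z"
    have orb: "g dvd int (card (orbit G \<phi> x))" if x: "x \<in> A" for x
    proof -
      have xc: "x \<in> carrier R" and xG: "x \<in> carrier G"
        using x mem01(1)[of "carrier R"] by (auto simp: A_def Gc)
      have subC: "subring (?C x) R" using xc by (intro centralizer_subring) auto
      obtain d where d: "card (?C x) = q ^ d"
        using card_left_subspace[OF fin sub inv subsp[OF Zc subC]] xc q_def by auto
      \<comment> \<open>The whole ring is also a left vector space over the centralizer of
        \<open>x\<close>; this forces \<open>d\<close> to divide \<open>n\<close>.\<close>
      obtain m where m: "card (carrier R) = card (?C x) ^ m"
        using card_left_subspace[OF fin subC inv subsp[OF _ carrier_is_subring]] xc
        by (auto simp: centralizer_def)
      have "q ^ n = q ^ (d * m)" using n m d by (simp add: power_mult)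
      then have nd: "n = d * m" using q power_inject_exp by blast
      have "?C x \<noteq> carrier R"
      proof
        assume C: "?C x = carrier R"
        have "y \<otimes> x = x \<otimes> y" if "y \<in> carrier R" for y
          using that unfolding C[symmetric] by (simp add: centralizer_def)
        then show False using x by (simp add: A_def centralizer_def)
      qed
      then have "card (?C x) < card (carrier R)"
        using fin by (intro psubset_card_mono) (auto simp: centralizer_def)
      then have "d < n" using d n q power_strict_increasing_iff by metis
      moreover have "d > 0" using nd n1 by (cases d) auto
      ultimately obtain c where c: "int q ^ n - 1 = (int q ^ d - 1) * (g * c)"
        using g(3)[of d] nd by auto
      have "card (orbit G \<phi> x) * card (stabilizer G \<phi> x) = order G"
        by (rule A.orbit_stabilizer_theorem[OF xG])
      moreover have "order G = q ^ n - 1"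
        using fin n by (simp add: order_def Gc)
      moreover have "card (stabilizer G \<phi> x) = q ^ d - 1"
        using stab[OF xG] mem01(1)[of "{x}"] xc finC d by simp
      ultimately have "card (orbit G \<phi> x) * (q ^ d - 1) = q ^ n - 1" by simp
      then have "int (card (orbit G \<phi> x) * (q ^ d - 1)) = int (q ^ n - 1)" by simp
      then have "int (card (orbit G \<phi> x)) * (int q ^ d - 1) = int q ^ n - 1"
        using q by (simp add: of_nat_diff)
      then have "(int q ^ d - 1) * int (card (orbit G \<phi> x)) = (int q ^ d - 1) * (g * c)"
        using c by (simp add: mult.commute)
      moreover have "int q ^ d > 1" using q \<open>d > 0\<close> by (intro one_less_power) auto
      ultimately show ?thesis by simp
    qed
    define E where "E = {(x, y). x \<in> A \<and> y \<in> A \<and> y \<in> orbit G \<phi> x}"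
    have AG: "A \<subseteq> carrier G" using mem01(1)[of "carrier R"] by (auto simp: A_def Gc)
    \<comment> \<open>Conjugation fixes central elements, so a class that starts outside the center
      stays outside.\<close>
    have orbA: "orbit G \<phi> x \<subseteq> A" if x: "x \<in> A" for x
    proof
      fix y assume y: "y \<in> orbit G \<phi> x"
      have xG: "x \<in> carrier G" using AG x by blast
      obtain v where "v \<in> carrier G" "\<phi> v x = y" using y unfolding orbit_def by blast
      then have yG: "y \<in> carrier G" using A.element_image xG by blast
      have "x \<in> orbit G \<phi> y" using A.orbit_sym[OF xG yG y] .
      then obtain u where u: "u \<in> carrier G" "x = \<phi> u y" by (auto simp: orbit_def)
      show "y \<in> A"
      proof (rule ccontr)
        assume "y \<notin> A"
        then have "y \<in> ?Z" using yG by (auto simp: A_def Gc)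
        then have "u \<otimes>\<^bsub>G\<^esub> y = y \<otimes>\<^bsub>G\<^esub> u" using u by (simp add: Gm Gc centralizer_def)
        then have "x = y" using u yG by (simp add: \<phi>_def G.m_assoc)
        then show False using x \<open>y \<notin> A\<close> by simp
      qed
    qed
    have "g dvd int (card A)"
    proof -
      have eqv: "equiv A E"
      proof (rule equivI)
        show "E \<subseteq> A \<times> A" by (auto simp: E_def)
        show "refl_on A E" using AG A.orbit_refl by (auto simp: E_def refl_on_def)
        show "sym E"
        proof (rule symI)
          fix x y assume "(x, y) \<in> E"
          then show "(y, x) \<in> E" using AG A.orbit_sym[of x y] by (auto simp: E_def)
        qed
        show "trans E"
        proof (rule transI)
          fix x y z assume "(x, y) \<in> E" "(y, z) \<in> E"
          then show "(x, z) \<in> E" using AG A.orbit_trans[of x y z] by (auto simp: E_def)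
        qed
      qed
      have "nat \<bar>g\<bar> dvd card A"
      proof (rule equiv_imp_dvd_card[OF _ eqv])
        show "finite A" using fin by (simp add: A_def)
        fix B assume "B \<in> A // E"
        then obtain x where x: "x \<in> A" "B = E `` {x}" by (auto simp: quotient_def)
        then have "B = orbit G \<phi> x" using orbA by (auto simp: E_def)
        then show "nat \<bar>g\<bar> dvd card B" using orb[OF x(1)] by (simp add: nat_abs_dvd_iff)
      qed
      then show ?thesis by (simp add: nat_abs_dvd_iff)
    qed
    moreover have "int (card A) = (int q ^ n - 1) - (int q - 1)"
    proof -
      have "card A = card (carrier R) - card ?Z"
        unfolding A_def using finC by (intro card_Diff_subset) (auto simp: centralizer_def)
      then show ?thesis using Zlt by (simp add: n q_def of_nat_diff)
    qed
    ultimately have "g dvd (int q ^ n - 1) - (int q - 1)" by simp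
    then have "g dvd int q - 1" using g(1) by (metis dvd_diff_right_iff)
    then show False using g(2) by simp
  qed
qed

end

section \<open>Primitive idempotents in compact rings\<close>

text \<open>The exponent is shifted, because the ring need not have a unit: \<open>npow x n\<close> is \<open>x\<close> to the \<open>n + 1\<close>.\<close>

definition npow :: "'a::ring \<Rightarrow> nat \<Rightarrow> 'a" where
  "npow x n = ((*) x ^^ n) x"

lemma npow_0 [simp]: "npow x 0 = x"
  and npow_Suc: "npow x (Suc n) = x * npow x n"
  by (simp_all add: npow_def)

lemma npow_mult: "npow x m * npow x n = npow x (Suc (m + n))"
  by (induction m) (simp_all add: npow_Suc mult.assoc)

text \<open>The powers are eventually periodic. For an exponent that is a multiple of the period and
  lies beyond the preperiod, squaring shifts by whole periods.\<close>

lemma npow_idempotent: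
  assumes "finite (range (npow x))"
  shows "\<exists>n. npow x n * npow x n = npow x n"
proof -
  have "\<not> inj (npow x)" using assms finite_imageD infinite_UNIV_nat by blast
  then obtain i j where ij: "i < j" "npow x i = npow x j"
    by (metis injI linorder_neqE_nat)
  define p where "p = j - i"
  have p: "p > 0" "npow x (i + p) = npow x i" using ij by (simp_all add: p_def)
  have per: "npow x (m + p) = npow x m" if "m \<ge> i" for m
    using that
  proof (induction m rule: dec_induct)
    case (step m) then show ?case by (simp add: npow_Suc)
  qed (use p in simp)
  have per': "npow x (m + t * p) = npow x m" if "m \<ge> i" for m t
    by (induction t) (use that per[of "m + _ * p"] in \<open>simp_all add: add.commute add.left_commute\<close>)
  \<comment> \<open>\<open>npow x n\<close> has the true exponent
    \<open>n + 1 = (i + 1) * p\<close>; the factor \<open>i + 1\<close> pushes \<open>n\<close> past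
    the start \<open>i\<close> of the periodic part.\<close>
  define n where "n = (i + 1) * p - 1"
  have "(i + 1) * p \<ge> (i + 1) * 1" using p by (intro mult_le_mono) auto
  then have n: "n \<ge> i" "Suc (n + n) = n + (i + 1) * p" by (auto simp: n_def)
  have "npow x n * npow x n = npow x n" using per'[OF n(1)] n(2) by (metis npow_mult)
  then show ?thesis by blast
qed

text \<open>The \<open>z\<close> are truncations of the geometric series for
  \<open>(1 + w)^(-1) - 1\<close>; the error is a power of \<open>w\<close> up to sign. So an
  element without a left quasi-inverse has no vanishing power.\<close>

lemma quasi_inverse_up_to_npow:
  "\<exists>z. w + z + z * w \<in> {npow w n, - npow w n}"
proof (induction n)
  case 0 show ?case by (intro exI[of _ 0]) simp
next
  case (Suc n)
  then obtain z where z: "w + z + z * w \<in> {npow w n, - npow w n}" by blast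
  let ?z = "- w - z * w"
  have "npow w n * w = npow w (Suc n)" using npow_mult[of w n 0] by simp
  moreover have "w + ?z + ?z * w = - ((w + z + z * w) * w)" by (simp add: algebra_simps)
  ultimately have "w + ?z + ?z * w \<in> {npow w (Suc n), - npow w (Suc n)}" using z by auto
  then show ?case by blast
qed

lemma npow_in_subring: "is_subring S \<Longrightarrow> x \<in> S \<Longrightarrow> npow x n \<in> S"
  by (induction n) (auto simp: npow_Suc is_subring_def)

lemma finite_range_npow:
  assumes "weakly_locally_finite TYPE('a::ring)"
  shows "finite (range (npow (x :: 'a)))"
proof (rule finite_subset)
  show "range (npow x) \<subseteq> \<Inter>{S. is_subring S \<and> x \<in> S}" using npow_in_subring by blast
  show "finite (\<Inter>{S. is_subring S \<and> x \<in> S})" using assms unfolding weakly_locally_finite_def by blast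
qed

lemma idempotent_multiple:
  fixes x :: "'a::ring"
  assumes ss: "semisimple TYPE('a)" and wlf: "weakly_locally_finite TYPE('a)" and x: "x \<noteq> 0"
  shows "\<exists>y. y * x \<noteq> 0 \<and> (y * x) * (y * x) = y * x"
proof -
  have "x \<notin> jacobson_radical" using ss x unfolding semisimple_def by blast
  then obtain y where y: "\<And>z. y * x + z + z * y * x \<noteq> 0" by (auto simp: jacobson_radical_def)
  define w where "w = y * x"
  obtain n where n: "npow w n * npow w n = npow w n"
    using npow_idempotent[OF finite_range_npow[OF wlf]] by blast
  have "npow w n \<noteq> 0"
    using quasi_inverse_up_to_npow[of w n] y by (auto simp: w_def mult.assoc)
  moreover have "\<exists>r. npow w n = r * x"
  proof (cases n)
    case 0 then show ?thesis by (auto simp: w_def)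
  next
    case (Suc m)
    have "npow w n = npow w m * w" using npow_mult[of w m 0] by (simp add: Suc)
    then show ?thesis by (auto simp: w_def mult.assoc[symmetric])
  qed
  ultimately show ?thesis using n by metis
qed

section \<open>Open ideals\<close>

definition open_ideal :: "'a::topological_ring set \<Rightarrow> bool" where
  "open_ideal U \<longleftrightarrow> open U \<and> 0 \<in> U \<and> (\<forall>x\<in>U. \<forall>y\<in>U. x - y \<in> U) \<and> (\<forall>x\<in>U. \<forall>y. y * x \<in> U \<and> x * y \<in> U)"

lemma open_idealD:
  assumes "open_ideal U"
  shows "open U" "0 \<in> U" "\<And>x y. x \<in> U \<Longrightarrow> y \<in> U \<Longrightarrow> x - y \<in> U"
    "\<And>x y. x \<in> U \<Longrightarrow> y * x \<in> U" "\<And>x y. x \<in> U \<Longrightarrow> x * y \<in> U"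
    "\<And>x y. x \<in> U \<Longrightarrow> y \<in> U \<Longrightarrow> x + y \<in> U"
proof -
  show *: "open U" "0 \<in> U" "\<And>x y. x \<in> U \<Longrightarrow> y \<in> U \<Longrightarrow> x - y \<in> U"
    "\<And>x y. x \<in> U \<Longrightarrow> y * x \<in> U" "\<And>x y. x \<in> U \<Longrightarrow> x * y \<in> U"
    using assms by (auto simp: open_ideal_def)
  show "x + y \<in> U" if "x \<in> U" "y \<in> U" for x y
    using *(3)[OF that(1) *(3)[OF *(2) that(2)]] by simp
qed

lemma open_ideal_finite_index:
  fixes U :: "'a::topological_ring set"
  assumes compact: "compact (UNIV :: 'a set)" and U: "open_ideal U"
  shows "\<exists>T. finite T \<and> (\<forall>y. \<exists>x\<in>T. y - x \<in> U)"
proof -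
  have "open {y. y - x \<in> U}" for x
  proof -
    have "open ((\<lambda>y. y - x) -` U)"
      by (intro continuous_open_vimage open_idealD(1)[OF U] continuous_intros)
    then show ?thesis by (simp add: vimage_def)
  qed
  moreover have "UNIV \<subseteq> (\<Union>x\<in>UNIV. {y. y - x \<in> U})"
  proof
    show "y \<in> (\<Union>x\<in>UNIV. {y. y - x \<in> U})" for y
      by (rule UN_I[of y]) (simp_all add: open_idealD(2)[OF U])
  qed
  ultimately obtain T where "finite T" "UNIV \<subseteq> (\<Union>x\<in>T. {y. y - x \<in> U})"
    using compactE_image[OF compact, of UNIV "\<lambda>x. {y. y - x \<in> U}"] by (metis subset_UNIV)
  then show ?thesis by blast
qed

section \<open>Primitive idempotents and their minimal left ideals\<close>

definition primitive_idempotent :: "'a::ring \<Rightarrow> bool" where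
  "primitive_idempotent e \<longleftrightarrow> e \<noteq> 0 \<and> e * e = e \<and>
     (\<forall>f. f * f = f \<and> e * f = f \<and> f * e = f \<longrightarrow> f = 0 \<or> f = e)"

lemma primitive_idempotentD:
  assumes "primitive_idempotent e"
  shows "e \<noteq> 0" "e * e = e" "\<And>f. f * f = f \<Longrightarrow> e * f = f \<Longrightarrow> f * e = f \<Longrightarrow> f \<noteq> 0 \<Longrightarrow> f = e"
  using assms by (auto simp: primitive_idempotent_def)

text \<open>Right multiplication by \<open>e * r * f\<close> maps \<open>R e\<close> to
  \<open>R f\<close>. For the primitive idempotents considered below, a nonzero map of this kind is
  an isomorphism, so \<open>linked\<close> compares minimal left ideals.\<close>

definition linked :: "'a::ring \<Rightarrow> 'a \<Rightarrow> bool" where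
  "linked e f \<longleftrightarrow> (\<exists>r. e * r * f \<noteq> 0)"

text \<open>The \<open>v a\<close> are a basis of \<open>R e\<close> over the corner
  \<open>e R e\<close> acting from the right. The \<open>w a\<close> are the coordinate functionals,
  realized as left multiplications by elements of \<open>e R\<close>, and
  \<open>sum v a * w a\<close> is the identity on \<open>R e\<close>.\<close>

definition dual_basis :: "'a::ring \<Rightarrow> nat \<Rightarrow> (nat \<Rightarrow> 'a) \<Rightarrow> (nat \<Rightarrow> 'a) \<Rightarrow> bool" where
  "dual_basis e k v w \<longleftrightarrow>
     (\<forall>a<k. v a * e = v a \<and> e * w a = w a) \<and>
     (\<forall>a<k. \<forall>b<k. w a * v b = (if a = b then e else 0)) \<and>
     (\<forall>x. x * e = x \<longrightarrow> (\<Sum>a<k. v a * w a) * x = x)"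

lemma dual_basisD:
  assumes "dual_basis e k v w"
  shows "\<And>a. a < k \<Longrightarrow> v a * e = v a" "\<And>a. a < k \<Longrightarrow> e * w a = w a"
    "\<And>a b. a < k \<Longrightarrow> b < k \<Longrightarrow> w a * v b = (if a = b then e else 0)"
    "\<And>x. x * e = x \<Longrightarrow> (\<Sum>a<k. v a * w a) * x = x"
  using assms by (auto simp: dual_basis_def)

text \<open>What the decomposition draws from a semisimple, weakly locally finite profinite ring;
  the parameter \<open>ty\<close> names the type.\<close>

locale idempotent_rich =
  fixes ty :: "'a::topological_ring itself"
  assumes compact_UNIV: "compact (UNIV :: 'a set)"
    and separated: "x \<noteq> 0 \<Longrightarrow> \<exists>U. open_ideal U \<and> (x :: 'a) \<notin> U"
    and idempotent_left_multiple: "x \<noteq> 0 \<Longrightarrow> \<exists>y::'a. y * x \<noteq> 0 \<and> (y * x) * (y * x) = y * x"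
begin

text \<open>\<open>P a u\<close> says that \<open>u\<close> lies below \<open>a\<close>, so an upper
  bound for \<open>P\<close> is a lower bound of idempotents. Chains have one because the conditions
  are closed and \<open>A\<close> is compact; removing the open set \<open>U\<close> keeps
  \<open>A\<close> closed and excludes 0.\<close>

lemma primitive_idempotent_below:
  fixes e :: 'a
  assumes U: "open_ideal U" and e: "e * e = e" "e \<notin> U"
  shows "\<exists>f. primitive_idempotent f \<and> e * f = f \<and> f * e = f \<and> f \<notin> U"
proof -
  note U = open_idealD[OF U]
  define A where "A = {f. f * f = f \<and> e * f = f \<and> f * e = f \<and> f \<notin> U}"
  define P where "P a u \<longleftrightarrow> u * a = u \<and> a * u = u" for a u :: 'a
  have Ptr: "P a v" if "P a u" "P u v" for a u v
    using that unfolding P_def by (metis mult.assoc)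
  have cl: "closed {f. f * f = f \<and> e * f = f \<and> f * e = f}"
    by (intro closed_Collect_conj closed_Collect_eq continuous_intros)
  have "A = {f. f * f = f \<and> e * f = f \<and> f * e = f} \<inter> - U" by (auto simp: A_def)
  then have "closed A" using cl U(1) by auto
  then have cA: "compact A" using compact_UNIV closed_Int_compact[of A UNIV] by simp
  have "\<exists>m\<in>A. \<forall>a\<in>A. P m a \<longrightarrow> a = m"
  proof (rule predicate_Zorn)
    show "partial_order_on A (relation_of P A)"
    proof (rule partial_order_on_relation_ofI)
      show "P a a" if "a \<in> A" for a using that by (simp add: P_def A_def)
      show "P a c" if "P a b" "P b c" for a b c using Ptr that .
      show "a = b" if "P a b" "P b a" for a b using that unfolding P_def by metis
    qed
    fix C assume C: "C \<in> Chains (relation_of P A)"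
    have lin: "P a b \<or> P b a" if "a \<in> C" "b \<in> C" for a b
      using C that by (auto simp: Chains_def relation_of_def)
    have CA: "C \<subseteq> A" using C by (auto simp: Chains_def relation_of_def)
    have "A \<inter> (\<Inter>c\<in>C. {u. P c u}) \<noteq> {}"
    proof (rule compact_imp_fip_image[OF cA])
      show "closed {u. P c u}" for c
        unfolding P_def by (intro closed_Collect_conj closed_Collect_eq continuous_intros)
      fix B assume B: "finite B" "B \<subseteq> C"
      show "A \<inter> (\<Inter>c\<in>B. {u. P c u}) \<noteq> {}"
      proof (cases "B = {}")
        case True then show ?thesis using e by (auto simp: A_def)
      next
        case False
        have "\<exists>m\<in>B. \<forall>c\<in>B. P c m"
          using B(1) False B(2)
        proof (induction B rule: finite_ne_induct)
          case (singleton x) then show ?case using CA by (auto simp: P_def A_def)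
        next
          case (insert x B)
          then obtain m where m: "m \<in> B" "\<forall>c\<in>B. P c m" by auto
          have "P x x" using insert.prems CA by (auto simp: P_def A_def)
          moreover have "P x m \<or> P m x" using lin insert.prems m by blast
          ultimately show ?case using m Ptr by (metis insert_iff)
        qed
        then show ?thesis using B CA by blast
      qed
    qed
    then show "\<exists>u\<in>A. \<forall>a\<in>C. P a u" by blast
  qed
  then obtain f where fA: "f \<in> A" and min: "\<And>a. a \<in> A \<Longrightarrow> P f a \<Longrightarrow> a = f" by blast
  have f: "f * f = f" "e * f = f" "f * e = f" "f \<notin> U" using fA by (auto simp: A_def)
  have low: "g = f" if "g * g = g" "f * g = g" "g * f = g" "g \<notin> U" for g
  proof (rule min)
    have "e * g = g" "g * e = g" using f that by (metis mult.assoc)+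
    then show "g \<in> A" using that by (simp add: A_def)
  qed (use that in \<open>simp add: P_def\<close>)
  have "g = 0 \<or> g = f" if g: "g * g = g" "f * g = g" "g * f = g" for g
  proof (cases "g \<in> U")
    case True
    \<comment> \<open>\<open>f\<close> is minimal only among idempotents outside \<open>U\<close>.
      If \<open>g\<close> lies in \<open>U\<close>, its complement \<open>f - g\<close> does not,
      and minimality is applied to that one.\<close>
    then have "f - g \<notin> U" using f(4) U(6)[of "f - g" g] by auto
    then have "f - g = f" using low[of "f - g"] g f by (simp add: algebra_simps)
    then show ?thesis by simp
  qed (use low g in blast)
  moreover have "f \<noteq> 0" using f U by auto
  ultimately have "primitive_idempotent f" using f by (auto simp: primitive_idempotent_def)
  then show ?thesis using f by blast
qed

text \<open>This is the minimality of \<open>R e\<close>. A nonzero idempotent multiple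
  \<open>g\<close> of \<open>x\<close> gives the idempotent \<open>e * g\<close> of the corner; it
  is nonzero because \<open>g * (e * g) = g\<close>, hence it is \<open>e\<close>.\<close>

lemma primitive_generates:
  fixes e x :: 'a
  assumes e: "primitive_idempotent e" and x: "x * e = x" "x \<noteq> 0"
  shows "\<exists>r. r * x = e"
proof -
  note e = primitive_idempotentD[OF e]
  obtain y where y: "y * x \<noteq> 0" "(y * x) * (y * x) = y * x"
    using idempotent_left_multiple[OF x(2)] by blast
  define g where "g = y * x"
  have g: "g * e = g" "g * g = g" "g \<noteq> 0" using x y by (simp_all add: g_def mult.assoc)
  have "e * g = e"
  proof (rule e(3))
    show "e * g * (e * g) = e * g" using g by (metis mult.assoc)
    show "e * (e * g) = e * g" using e by (metis mult.assoc)
    show "e * g * e = e * g" using g by (metis mult.assoc)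
    show "e * g \<noteq> 0" using g by (metis mult.assoc mult_zero_right)
  qed
  then have "(e * y) * x = e" by (simp add: g_def mult.assoc)
  then show ?thesis by blast
qed

lemma corner_inverse:
  fixes e d :: 'a
  assumes e: "primitive_idempotent e" and d: "e * d = d" "d * e = d" "d \<noteq> 0"
  shows "\<exists>c. e * c = c \<and> c * e = c \<and> c * d = e"
proof -
  note ee = primitive_idempotentD(2)[OF e]
  obtain r where "r * d = e" using primitive_generates[OF e d(2,3)] by blast
  then have "(e * r * e) * d = e" using d(1) ee by (simp add: mult.assoc)
  then show ?thesis using ee by (intro exI[of _ "e * r * e"]) (metis mult.assoc)
qed

text \<open>Distinct elements of \<open>R e\<close> stay distinct modulo an open ideal without
  \<open>e\<close>, since a nonzero difference in the ideal would generate \<open>e\<close>. Such an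
  ideal has finite index.\<close>

lemma finite_primitive_left_ideal:
  fixes e :: 'a
  assumes e: "primitive_idempotent e"
  shows "finite {x. x * e = x}"
proof -
  obtain U where U: "open_ideal U" "e \<notin> U"
    using separated primitive_idempotentD(1)[OF e] by blast
  note Ui = open_idealD[OF U(1)]
  obtain T where T: "finite T" "\<forall>y. \<exists>x\<in>T. y - x \<in> U" using open_ideal_finite_index[OF compact_UNIV U(1)] by blast
  then obtain c where c: "\<And>y. c y \<in> T" "\<And>y. y - c y \<in> U" by metis
  have "inj_on c {x. x * e = x}"
  proof (rule inj_onI, clarify)
    fix x y assume *: "x * e = x" "y * e = y" "c x = c y"
    then have "(x - c x) - (y - c y) \<in> U" using Ui(3) c by blast
    then have xy: "x - y \<in> U" using * by simp
    show "x = y"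
    proof (rule ccontr)
      assume "x \<noteq> y"
      moreover have "(x - y) * e = x - y" using * by (simp add: algebra_simps)
      ultimately obtain r where "r * (x - y) = e" using primitive_generates[OF e, of "x - y"] by auto
      then show False using Ui(4)[OF xy] U(2) by metis
    qed
  qed
  then show ?thesis using T(1) c(1) by (meson finite_subset image_subsetI inj_on_finite)
qed

text \<open>A biorthogonal family of maximal length. Its length is bounded because the
  \<open>v a\<close> are distinct elements of the finite \<open>R e\<close>, and a family that fails
  to span can be prolonged.\<close>

lemma dual_basis_exists:
  fixes e :: 'a
  assumes e: "primitive_idempotent e"
  shows "\<exists>k v w. k \<ge> 1 \<and> dual_basis e k v w"
proof -
  note ee = primitive_idempotentD[OF e]
  define P where "P k \<longleftrightarrow> (\<exists>v w. (\<forall>a<k. v a * e = v a \<and> e * w a = w a) \<and>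
     (\<forall>a<k. \<forall>b<k. w a * v b = (if a = b then e else 0)))" for k :: nat
  have "P 0" by (simp add: P_def)
  have bd: "k \<le> card {x. x * e = x}" if Pk: "P k" for k
  proof -
    obtain v w where v: "\<forall>a<k. v a * e = v a \<and> e * w a = w a" and wv: "\<forall>a<k. \<forall>b<k. w a * v b = (if a = b then e else 0)"
      using Pk unfolding P_def by metis
    have "inj_on v {..<k}"
    proof (rule inj_onI, rule ccontr)
      fix a b assume ab: "a \<in> {..<k}" "b \<in> {..<k}" "v a = v b" "a \<noteq> b"
      from ab(1,2,4) have "w a * v a = e" "w a * v b = 0" using wv by auto
      then show False using ab ee(1) by simp
    qed
    then have "card (v ` {..<k}) = k" by (simp add: card_image)
    moreover have "card (v ` {..<k}) \<le> card {x. x * e = x}"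
      using v by (intro card_mono finite_primitive_left_ideal[OF e]) auto
    ultimately show ?thesis by simp
  qed
  obtain k where Pk: "P k" and kmax: "\<And>m. P m \<Longrightarrow> m \<le> k"
    using GreatestI_nat[where P = P, OF \<open>P 0\<close> bd] Greatest_le_nat[where P = P, OF _ bd] by blast
  obtain v w where ve: "\<And>a. a < k \<Longrightarrow> v a * e = v a" and ew: "\<And>a. a < k \<Longrightarrow> e * w a = w a"
    and wv: "\<And>a b. a < k \<Longrightarrow> b < k \<Longrightarrow> w a * v b = (if a = b then e else 0)"
    using Pk unfolding P_def by metis
  have full: "(\<Sum>a<k. v a * w a) * x = x" if x: "x * e = x" for x
  proof (rule ccontr)
    assume ne: "(\<Sum>a<k. v a * w a) * x \<noteq> x"
    \<comment> \<open>The part of \<open>x\<close> that the family misses; every \<open>w b\<close>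
      kills it, so it can serve as the next basis vector.\<close>
    define y where "y = x - (\<Sum>a<k. v a * w a) * x"
    have y: "y \<noteq> 0" "y * e = y" using ne x by (auto simp: y_def left_diff_distrib mult.assoc)
    have wsum: "w b * (\<Sum>a<k. v a * w a) = w b" if "b < k" for b
    proof -
      have "w b * (\<Sum>a<k. v a * w a) = (\<Sum>a<k. if a = b then w b else 0)"
        unfolding sum_distrib_left
        by (rule sum.cong) (use that wv ew in \<open>auto simp: mult.assoc[symmetric]\<close>)
      then show ?thesis using that by simp
    qed
    have sumv: "(\<Sum>a<k. v a * w a) * v b = v b" if "b < k" for b
    proof -
      have "(\<Sum>a<k. v a * w a) * v b = (\<Sum>a<k. if a = b then v b else 0)"
        unfolding sum_distrib_right
        by (rule sum.cong) (use that wv ve in \<open>auto simp: mult.assoc\<close>)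
      then show ?thesis using that by simp
    qed
    have wy: "w b * y = 0" if "b < k" for b
      using wsum[OF that] by (simp add: y_def right_diff_distrib mult.assoc[symmetric])
    obtain r where r: "r * y = e" using primitive_generates[OF e y(2,1)] by blast
    \<comment> \<open>Gram-Schmidt for functionals: \<open>e * r\<close> is corrected so that
      \<open>u\<close> kills every \<open>v b\<close> and still satisfies
      \<open>u * y = e\<close>.\<close>
    define u where "u = e * r - e * r * (\<Sum>a<k. v a * w a)"
    have eu: "e * u = u" using ee(2) by (simp add: u_def right_diff_distrib mult.assoc[symmetric])
    have uv: "u * v b = 0" if "b < k" for b
      using sumv[OF that] by (simp add: u_def left_diff_distrib mult.assoc)
    have "(\<Sum>a<k. v a * w a) * y = 0"
      unfolding sum_distrib_right using wy by (intro sum.neutral) (auto simp: mult.assoc)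
    then have uy: "u * y = e" using r ee(2) by (simp add: u_def left_diff_distrib mult.assoc)
    have "P (Suc k)"
      unfolding P_def
      by (rule exI[of _ "v(k := y)"], rule exI[of _ "w(k := u)"])
        (use ve ew wv wy uv uy y eu in \<open>auto simp: less_Suc_eq\<close>)
    then show False using kmax[of "Suc k"] by simp
  qed
  have "k \<noteq> 0"
  proof
    assume "k = 0"
    then show False using full[OF ee(2)] ee(1) by simp
  qed
  then show ?thesis using ve ew wv full unfolding dual_basis_def
    by (intro exI[of _ k] exI[of _ v] exI[of _ w]) auto
qed

section \<open>Classes of minimal left ideals and elements prescribed on them\<close>

lemma linked_refl: "primitive_idempotent e \<Longrightarrow> linked e (e::'a)"
  by (auto simp: linked_def primitive_idempotent_def intro!: exI[of _ e])

text \<open>The nonzero element \<open>e * r * f\<close> of the minimal left ideal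
  \<open>R f\<close> generates \<open>f\<close>, so \<open>f\<close> factors through
  \<open>e\<close>.\<close>

lemma linked_factor:
  fixes e f :: 'a
  assumes f: "primitive_idempotent f" and "linked e f"
  shows "\<exists>s r. f = s * e * r * f"
proof -
  obtain r where r: "e * r * f \<noteq> 0" using assms by (auto simp: linked_def)
  have "e * r * f * f = e * r * f" using primitive_idempotentD(2)[OF f] by (simp add: mult.assoc)
  then obtain s where "s * (e * r * f) = f" using primitive_generates[OF f _ r] by blast
  then show ?thesis by (metis mult.assoc)
qed

lemma linked_sym:
  fixes e f :: 'a
  assumes f: "primitive_idempotent f" and "linked e f"
  shows "linked f e"
proof -
  obtain s r where sr: "f = s * e * r * f" using linked_factor[OF assms] by blast
  have "f * s * e * (r * f) = f"
    using sr primitive_idempotentD(2)[OF f] by (metis mult.assoc)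
  then have "f * s * e \<noteq> 0" using primitive_idempotentD(1)[OF f] by auto
  then show ?thesis by (auto simp: linked_def)
qed

lemma linked_trans:
  fixes e f g :: 'a
  assumes f: "primitive_idempotent f" and "linked e f" "linked f g"
  shows "linked e g"
proof -
  obtain s r where sr: "f = s * e * r * f" using linked_factor[OF assms(1,2)] by blast
  obtain t where t: "f * t * g \<noteq> 0" using assms by (auto simp: linked_def)
  have "f * t * g = s * (e * (r * f * t) * g)" by (subst sr) (simp add: mult.assoc)
  then have "e * (r * f * t) * g \<noteq> 0" using t by auto
  then show ?thesis by (auto simp: linked_def)
qed

lemma primitive_representatives:
  obtains I :: "'a set" where "\<And>i. i \<in> I \<Longrightarrow> primitive_idempotent i"
    "\<And>i j. i \<in> I \<Longrightarrow> j \<in> I \<Longrightarrow> linked i j \<Longrightarrow> i = j"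
    "\<And>f. primitive_idempotent f \<Longrightarrow> \<exists>i\<in>I. linked i f"
proof -
  define rep where "rep e = (SOME f :: 'a. primitive_idempotent f \<and> linked e f)" for e :: 'a
  have rep: "primitive_idempotent (rep e)" "linked e (rep e)" if "primitive_idempotent e" for e
    using someI[of "\<lambda>f. primitive_idempotent f \<and> linked e f" e] linked_refl that by (auto simp: rep_def)
  \<comment> \<open>For linked idempotents the two defining predicates coincide, so the choice
    operator returns the same representative.\<close>
  have rep_eq: "rep e = rep f" if "primitive_idempotent e" "primitive_idempotent f" "linked e f" for e f
  proof -
    have "(primitive_idempotent g \<and> linked e g) = (primitive_idempotent g \<and> linked f g)" for g
      using linked_trans linked_sym that by blast
    then show ?thesis by (simp add: rep_def)
  qed
  show thesis
  proof (rule that[of "rep ` Collect primitive_idempotent"])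
    fix i j assume "i \<in> rep ` Collect primitive_idempotent" "j \<in> rep ` Collect primitive_idempotent" "linked i j"
    then obtain e f where ef: "primitive_idempotent e" "i = rep e" "primitive_idempotent f" "j = rep f" by auto
    have "linked e j" using linked_trans[OF _ rep(2)[OF ef(1)]] rep(1)[OF ef(1)] ef(2) \<open>linked i j\<close> by blast
    moreover have "linked j f" using linked_sym[OF rep(1)[OF ef(3)] rep(2)[OF ef(3)]] ef(4) by simp
    ultimately have "linked e f" using linked_trans rep(1) ef by blast
    then show "i = j" using rep_eq ef by blast
  qed (use rep linked_sym in \<open>auto\<close>)
qed

text \<open>A primitive \<open>f\<close> below an idempotent multiple \<open>y * x\<close> satisfies
  \<open>x * f ~= 0\<close>; factoring \<open>f\<close> through its representative \<open>i\<close>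
  moves the witness into \<open>R i\<close>.\<close>

lemma faithful_on_representatives:
  fixes x :: 'a
  assumes "\<And>f. primitive_idempotent f \<Longrightarrow> \<exists>i\<in>I. linked i f"
    and prim: "\<And>i. i \<in> I \<Longrightarrow> primitive_idempotent i" and x: "x \<noteq> 0"
  shows "\<exists>i\<in>I. \<exists>y. y * i = y \<and> x * y \<noteq> 0"
proof -
  obtain y where y: "y * x \<noteq> 0" "(y * x) * (y * x) = y * x" using idempotent_left_multiple[OF x] by blast
  obtain U where U: "open_ideal U" "y * x \<notin> U" using separated[OF y(1)] by blast
  obtain f where f: "primitive_idempotent f" "(y * x) * f = f"
    using primitive_idempotent_below[OF U(1) y(2) U(2)] by blast
  have xf: "x * f \<noteq> 0" using f primitive_idempotentD(1)[OF f(1)] by (metis mult.assoc mult_zero_right)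
  obtain i where i: "i \<in> I" "linked i f" using assms(1)[OF f(1)] by blast
  obtain s r where "f = s * i * r * f" using linked_factor[OF f(1) i(2)] by blast
  then have "x * f = x * (s * i) * (r * f)" by (metis mult.assoc)
  then have "x * (s * i) \<noteq> 0" using xf by auto
  moreover have "s * i * i = s * i" using primitive_idempotentD(2)[OF prim[OF i(1)]] by (simp add: mult.assoc)
  ultimately show ?thesis using i(1) by blast
qed

text \<open>A Chinese remainder theorem: \<open>g\<close> prescribes how \<open>x\<close> acts on
  each \<open>R i\<close>. Finitely many prescriptions are met by a sum of \<open>g i * c i\<close>,
  all of them by compactness.\<close>

lemma glue:
  fixes I :: "'a set" and g :: "'a \<Rightarrow> 'a"
  assumes prim: "\<And>i. i \<in> I \<Longrightarrow> primitive_idempotent i"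
    and sep: "\<And>i j. i \<in> I \<Longrightarrow> j \<in> I \<Longrightarrow> linked i j \<Longrightarrow> i = j"
  shows "\<exists>x. \<forall>i\<in>I. \<forall>y. y * i = y \<longrightarrow> x * y = g i * y"
proof -
  have "\<forall>i\<in>I. \<exists>k v w. dual_basis i k v w" using dual_basis_exists prim by blast
  then obtain k v w where dual: "\<And>i. i \<in> I \<Longrightarrow> dual_basis i (k i) (v i) (w i)" by metis
  define c where "c i = (\<Sum>a<k i. v i a * w i a)" for i
  \<comment> \<open>\<open>c i\<close> is the identity on \<open>R i\<close> and 0 on the other
    \<open>R j\<close>: there \<open>w i a * y\<close> lies in \<open>i R j\<close>, which vanishes
    for unlinked idempotents.\<close>
  have cy: "c i * y = (if i = j then y else 0)" if "i \<in> I" "j \<in> I" "y * j = y" for i j y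
  proof (cases "i = j")
    case True
    then show ?thesis using dual_basisD(4)[OF dual] that by (simp add: c_def)
  next
    case False
    have "v i a * w i a * y = 0" if "a < k i" for a
    proof -
      have "\<not> linked i j" using sep that False \<open>i \<in> I\<close> \<open>j \<in> I\<close> by blast
      then have "i * (w i a * y) * j = 0" by (simp add: linked_def)
      moreover have "i * (w i a * y) * j = w i a * y"
        using dual_basisD(2)[OF dual[OF \<open>i \<in> I\<close>] that] \<open>y * j = y\<close> by (metis mult.assoc)
      ultimately show ?thesis by (simp add: mult.assoc)
    qed
    then show ?thesis using False by (simp add: c_def sum_distrib_right)
  qed
  have "UNIV \<inter> (\<Inter>i\<in>I. {x. \<forall>y. y * i = y \<longrightarrow> x * y = g i * y}) \<noteq> {}"
  proof (rule compact_imp_fip_image[OF compact_UNIV])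
    fix i assume "i \<in> I"
    have "{x. \<forall>y. y * i = y \<longrightarrow> x * y = g i * y} = (\<Inter>y\<in>{y. y * i = y}. {x. x * y = g i * y})" by auto
    moreover have "closed \<dots>"
      by (intro closed_INT ballI closed_Collect_eq continuous_intros)
    ultimately show "closed {x. \<forall>y. y * i = y \<longrightarrow> x * y = g i * y}" by simp
  next
    fix J assume J: "finite J" "J \<subseteq> I"
    have "(\<Sum>i\<in>J. g i * c i) * y = g j * y" if "j \<in> J" "y * j = y" for j y
    proof -
      have "(\<Sum>i\<in>J. g i * c i) * y = (\<Sum>i\<in>J. if i = j then g j * y else 0)"
        unfolding sum_distrib_right
      proof (rule sum.cong)
        fix i assume "i \<in> J"
        then have "c i * y = (if i = j then y else 0)" using cy[of i j y] that J by blast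
        then show "g i * c i * y = (if i = j then g j * y else 0)" by (simp add: mult.assoc)
      qed simp
      then show ?thesis using that J by simp
    qed
    then show "UNIV \<inter> (\<Inter>i\<in>J. {x. \<forall>y. y * i = y \<longrightarrow> x * y = g i * y}) \<noteq> {}" by blast
  qed
  then show ?thesis by blast
qed

end

section \<open>The matrix decomposition\<close>

definition corner_ring :: "'a::ring \<Rightarrow> 'a ring" where
  "corner_ring e = \<lparr>carrier = {x. e * x = x \<and> x * e = x}, monoid.mult = (*), one = e,
     ring.zero = 0, ring.add = (+)\<rparr>"

lemma corner_ring_simps [simp]:
  "x \<in> carrier (corner_ring e) \<longleftrightarrow> e * x = x \<and> x * e = x"
  "x \<otimes>\<^bsub>corner_ring e\<^esub> y = x * y" "\<one>\<^bsub>corner_ring e\<^esub> = e"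
  "\<zero>\<^bsub>corner_ring e\<^esub> = 0" "x \<oplus>\<^bsub>corner_ring e\<^esub> y = x + y"
  by (simp_all add: corner_ring_def)

lemma ring_corner_ring:
  fixes e :: "'a::ring"
  assumes "e * e = e"
  shows "ring (corner_ring e)"
proof (rule ringI)
  show "abelian_group (corner_ring e)"
  proof (rule abelian_groupI)
    fix x assume "x \<in> carrier (corner_ring e)"
    then show "\<exists>y\<in>carrier (corner_ring e). y \<oplus>\<^bsub>corner_ring e\<^esub> x = \<zero>\<^bsub>corner_ring e\<^esub>"
      by (intro bexI[of _ "- x"]) auto
  qed (auto simp: algebra_simps)
  show "Group.monoid (corner_ring e)"
  proof (rule monoidI)
    fix x y assume "x \<in> carrier (corner_ring e)" "y \<in> carrier (corner_ring e)"
    then show "x \<otimes>\<^bsub>corner_ring e\<^esub> y \<in> carrier (corner_ring e)"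
      by (simp add: mult.assoc) (metis mult.assoc)
  qed (use assms in \<open>auto simp: mult.assoc\<close>)
qed (auto simp: algebra_simps)

text \<open>Links the record-based sums in matrix products with the type-class sums of the dual
  basis calculus.\<close>

lemma finsum_corner_ring:
  fixes e :: "'a::ring"
  assumes "e * e = e" "f \<in> A \<rightarrow> carrier (corner_ring e)"
  shows "finsum (corner_ring e) f A = sum f A"
proof -
  interpret ring "corner_ring e" using ring_corner_ring[OF assms(1)] .
  show ?thesis using assms(2)
  proof (induction A rule: infinite_finite_induct)
    case (infinite A) then show ?case by (simp add: finsum_infinite)
  next
    case (insert a A)
    then have "f \<in> A \<rightarrow> carrier (corner_ring e)" "f a \<in> carrier (corner_ring e)" by (blast, blast)
    then show ?case using insert by (simp add: finsum_insert del: corner_ring_simps(1))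
  qed simp
qed

text \<open>Numbering the elements turns the operations into tables on an initial segment of the
  naturals. Size at most \<open>N\<close> leaves finitely many tables, and for equal tables the
  numberings compose to an isomorphism.\<close>

lemma finitely_many_ring_tables:
  fixes F :: "'i \<Rightarrow> ('b, 'm) ring_scheme"
  assumes ring: "\<And>i. i \<in> I \<Longrightarrow> ring (F i)" and fin: "\<And>i. i \<in> I \<Longrightarrow> finite (carrier (F i))"
    and card: "\<And>i. i \<in> I \<Longrightarrow> card (carrier (F i)) \<le> N"
  shows "\<exists>t :: 'i \<Rightarrow> nat \<times> nat \<times> (nat \<times> nat \<times> nat) set \<times> (nat \<times> nat \<times> nat) set.
    finite (t ` I) \<and> (\<forall>i\<in>I. \<forall>j\<in>I. t i = t j \<longrightarrow> (\<exists>h. h \<in> ring_iso (F i) (F j)))"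
proof -
  define h where "h i = to_nat_on (carrier (F i))" for i
  have bij: "bij_betw (h i) (carrier (F i)) {..<card (carrier (F i))}" if "i \<in> I" for i
    unfolding h_def by (rule to_nat_on_finite[OF fin[OF that]])
  \<comment> \<open>The number of the unit is part of the code because \<open>ring_iso\<close>
    preserves the unit.\<close>
  define t where "t i = (card (carrier (F i)), h i \<one>\<^bsub>F i\<^esub>,
    (\<lambda>(x, y). (h i x, h i y, h i (x \<otimes>\<^bsub>F i\<^esub> y))) ` (carrier (F i) \<times> carrier (F i)),
    (\<lambda>(x, y). (h i x, h i y, h i (x \<oplus>\<^bsub>F i\<^esub> y))) ` (carrier (F i) \<times> carrier (F i)))" for i
  have hN: "h i x < N" if "i \<in> I" "x \<in> carrier (F i)" for i x
    using bij_betwE[OF bij[OF that(1)]] card[OF that(1)] that(2) by fastforce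
  have "finite (t ` I)"
  proof (rule finite_subset)
    show "t ` I \<subseteq> {..N} \<times> {..N} \<times> Pow ({..N} \<times> {..N} \<times> {..N}) \<times> Pow ({..N} \<times> {..N} \<times> {..N})"
    proof (rule image_subsetI)
      fix i assume i: "i \<in> I"
      interpret ring "F i" using ring[OF i] .
      show "t i \<in> {..N} \<times> {..N} \<times> Pow ({..N} \<times> {..N} \<times> {..N}) \<times> Pow ({..N} \<times> {..N} \<times> {..N})"
        using card[OF i] less_imp_le[OF hN[OF i]] by (auto simp: t_def)
    qed
  qed simp
  moreover have "\<exists>f. f \<in> ring_iso (F i) (F j)" if i: "i \<in> I" and j: "j \<in> I" and t: "t i = t j" for i j
  proof -
    interpret i: ring "F i" using ring[OF i] .
    interpret j: ring "F j" using ring[OF j] .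
    define g where "g = inv_into (carrier (F j)) (h j)"
    have gh: "g (h j x) = x" if "x \<in> carrier (F j)" for x
      unfolding g_def using bij[OF j] that by (simp add: bij_betw_def)
    have bg: "bij_betw g {..<card (carrier (F j))} (carrier (F j))"
      unfolding g_def by (rule bij_betw_inv_into[OF bij[OF j]])
    have cc: "card (carrier (F i)) = card (carrier (F j))" using t by (simp add: t_def)
    have b: "bij_betw (g \<circ> h i) (carrier (F i)) (carrier (F j))"
      using bij_betw_trans[OF bij[OF i]] bg by (simp add: cc)
    have "g \<circ> h i \<in> ring_iso (F i) (F j)"
    proof (rule ring_iso_memI)
      fix x y assume x: "x \<in> carrier (F i)" and y: "y \<in> carrier (F i)"
      show "(g \<circ> h i) x \<in> carrier (F j)" using b x by (auto simp: bij_betw_def)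
      have "(h i x, h i y, h i (x \<otimes>\<^bsub>F i\<^esub> y)) \<in> fst (snd (snd (t i)))"
        using x y by (force simp: t_def)
      then obtain x' y' where "x' \<in> carrier (F j)" "y' \<in> carrier (F j)"
        "h i x = h j x'" "h i y = h j y'" "h i (x \<otimes>\<^bsub>F i\<^esub> y) = h j (x' \<otimes>\<^bsub>F j\<^esub> y')"
        unfolding t by (auto simp: t_def)
      then show "(g \<circ> h i) (x \<otimes>\<^bsub>F i\<^esub> y) = (g \<circ> h i) x \<otimes>\<^bsub>F j\<^esub> (g \<circ> h i) y" by (simp add: gh)
      have "(h i x, h i y, h i (x \<oplus>\<^bsub>F i\<^esub> y)) \<in> snd (snd (snd (t i)))"
        using x y by (force simp: t_def)
      then obtain x' y' where "x' \<in> carrier (F j)" "y' \<in> carrier (F j)"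
        "h i x = h j x'" "h i y = h j y'" "h i (x \<oplus>\<^bsub>F i\<^esub> y) = h j (x' \<oplus>\<^bsub>F j\<^esub> y')"
        unfolding t by (auto simp: t_def)
      then show "(g \<circ> h i) (x \<oplus>\<^bsub>F i\<^esub> y) = (g \<circ> h i) x \<oplus>\<^bsub>F j\<^esub> (g \<circ> h i) y" by (simp add: gh)
    next
      show "(g \<circ> h i) \<one>\<^bsub>F i\<^esub> = \<one>\<^bsub>F j\<^esub>" using t gh[of "\<one>\<^bsub>F j\<^esub>"] by (simp add: t_def)
    qed (rule b)
    then show ?thesis by blast
  qed
  ultimately show ?thesis by (intro exI[of _ t]) blast
qed

lemma finite_matrix_ring_types:
  fixes F :: "'i \<Rightarrow> 'b ring"
  assumes fld: "\<And>i. i \<in> I \<Longrightarrow> field (F i)" and fin: "\<And>i. i \<in> I \<Longrightarrow> finite (carrier (F i))"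
    and card: "\<And>i. i \<in> I \<Longrightarrow> card (carrier (F i)) \<le> N" and k: "\<And>i. i \<in> I \<Longrightarrow> k i \<le> K"
  shows "finite (I // {(i, j). i \<in> I \<and> j \<in> I \<and> matrix_ring (k i) (F i) \<simeq> matrix_ring (k j) (F j)})"
    (is "finite (I // ?r)")
proof -
  have cr: "cring (F i)" if "i \<in> I" for i using fld[OF that] by (simp add: field_def domain_def)
  then have "ring (F i)" if "i \<in> I" for i using that by (simp add: cring_def)
  then obtain t :: "'i \<Rightarrow> nat \<times> nat \<times> (nat \<times> nat \<times> nat) set \<times> (nat \<times> nat \<times> nat) set"
    where t: "finite (t ` I)" "\<forall>i\<in>I. \<forall>j\<in>I. t i = t j \<longrightarrow> (\<exists>h. h \<in> ring_iso (F i) (F j))"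
    using finitely_many_ring_tables[of I F N] fin card by blast
  have iso: "matrix_ring (k i) (F i) \<simeq> matrix_ring (k j) (F j)"
    if "i \<in> I" "j \<in> I" "(k i, t i) = (k j, t j)" for i j
    using t(2) that matrix_ring_iso[OF cr cr, of i j _ "k i"] unfolding is_ring_iso_def by fastforce
  \<comment> \<open>The class of \<open>i\<close> depends only on its matrix size and its table, so
    \<open>cls\<close> reaches every class from finitely many codes.\<close>
  define cls where "cls s = ?r `` {SOME i. i \<in> I \<and> (k i, t i) = s}" for s
  have "?r `` {i} = cls (k i, t i)" if i: "i \<in> I" for i
  proof -
    let ?j = "SOME j. j \<in> I \<and> (k j, t j) = (k i, t i)"
    have j: "?j \<in> I" "(k ?j, t ?j) = (k i, t i)"
      using someI[of "\<lambda>j. j \<in> I \<and> (k j, t j) = (k i, t i)" i] i by auto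
    have "matrix_ring (k i) (F i) \<simeq> matrix_ring (k ?j) (F ?j)"
      "matrix_ring (k ?j) (F ?j) \<simeq> matrix_ring (k i) (F i)"
      using iso[OF i j(1)] iso[OF j(1) i] j(2) by auto
    then have "matrix_ring (k i) (F i) \<simeq> matrix_ring (k l) (F l) \<longleftrightarrow>
        matrix_ring (k ?j) (F ?j) \<simeq> matrix_ring (k l) (F l)" for l
      using ring_iso_trans by blast
    then show ?thesis using i j(1) by (auto simp: cls_def)
  qed
  then have "I // ?r \<subseteq> cls ` ({..K} \<times> t ` I)"
    using k by (fastforce simp: quotient_def)
  then show ?thesis by (rule finite_subset) (use t(1) in simp)
qed

section \<open>Corner fields and the matrix representation\<close>

context idempotent_rich
begin

lemma corner_subset_left_ideal: "carrier (corner_ring e) \<subseteq> {x::'a. x * e = x}"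
  by auto

lemma finite_corner_ring: "primitive_idempotent (e::'a) \<Longrightarrow> finite (carrier (corner_ring e))"
  using finite_subset[OF corner_subset_left_ideal finite_primitive_left_ideal] .

lemma field_corner_ring:
  fixes e :: 'a
  assumes e: "primitive_idempotent e"
  shows "field (corner_ring e)"
proof -
  note ee = primitive_idempotentD[OF e]
  interpret ring "corner_ring e" using ring_corner_ring[OF ee(2)] .
  have "Units (corner_ring e) = carrier (corner_ring e) - {\<zero>\<^bsub>corner_ring e\<^esub>}"
  proof (intro equalityI subsetI)
    fix d assume "d \<in> Units (corner_ring e)"
    then show "d \<in> carrier (corner_ring e) - {\<zero>\<^bsub>corner_ring e\<^esub>}" using ee(1) by (auto simp: Units_def)
  next
    fix d assume "d \<in> carrier (corner_ring e) - {\<zero>\<^bsub>corner_ring e\<^esub>}"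
    then have d: "e * d = d" "d * e = d" "d \<noteq> 0" by auto
    \<comment> \<open>Left inverses are enough: \<open>c\<close> has a left inverse \<open>b\<close>
      in turn, and \<open>b = b * (c * d) = (b * c) * d = d\<close>.\<close>
    obtain c where c: "e * c = c" "c * e = c" "c * d = e" using corner_inverse[OF e d] by blast
    have "c \<noteq> 0" using c ee(1) by auto
    then obtain b where b: "b * e = b" "b * c = e" using corner_inverse[OF e c(1,2)] by blast
    have "b = d" using b c(3) d(1) by (metis mult.assoc)
    then show "d \<in> Units (corner_ring e)" using b c d by (auto simp: Units_def)
  qed
  then show ?thesis by (rule finite_division_ring_is_field[OF finite_corner_ring[OF e]])
qed

text \<open>A nonzero \<open>x\<close> has an inverse in the corner, which would bring
  \<open>e\<close> into \<open>U\<close>. This makes matrix entries locally constant.\<close>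

lemma open_ideal_Int_corner_ring:
  fixes e x :: 'a
  assumes e: "primitive_idempotent e" and U: "open_ideal U" "e \<notin> U" and x: "x \<in> U" "e * x = x" "x * e = x"
  shows "x = 0"
  using corner_inverse[OF e x(2,3)] open_idealD(4)[OF U(1) x(1)] U(2) by metis

text \<open>
  The left ideal \<open>Re\<close> is a vector space over the corner ring \<open>eRe\<close>; with respect to a dual basis, left
  multiplication by \<open>x\<close> has the matrix with entries \<open>w a * x * v b\<close>.
\<close>

lemma matrix_decomposition:
  fixes I :: "'a set" and k :: "'a \<Rightarrow> nat" and v w :: "'a \<Rightarrow> nat \<Rightarrow> 'a"
  assumes prim: "\<And>i. i \<in> I \<Longrightarrow> primitive_idempotent i"
    and sep: "\<And>i j. i \<in> I \<Longrightarrow> j \<in> I \<Longrightarrow> linked i j \<Longrightarrow> i = j"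
    and all: "\<And>f. primitive_idempotent f \<Longrightarrow> \<exists>i\<in>I. linked i f"
    and dual: "\<And>i. i \<in> I \<Longrightarrow> dual_basis i (k i) (v i) (w i)"
  defines "M \<equiv> \<lambda>i. matrix_ring (k i) (corner_ring i)"
    and "\<phi> \<equiv> \<lambda>x. \<lambda>i\<in>I. \<lambda>(a, b)\<in>{..<k i} \<times> {..<k i}. w i a * (x * v i b)"
  shows "topological_ring_iso \<phi> (product_ring I M) (discrete_product_topology I M)"
proof -
  note dd = dual_basisD[OF dual]
  have ii: "i * i = i" if "i \<in> I" for i using primitive_idempotentD(2)[OF prim[OF that]] .
  have ent: "w i a * (x * v i b) \<in> carrier (corner_ring i)" if "i \<in> I" "a < k i" "b < k i" for i a b x
    using dd(1)[OF that(1,3)] dd(2)[OF that(1,2)] by (simp add: mult.assoc) (simp add: mult.assoc[symmetric])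
  have \<phi>_ent: "\<phi> x i (a, b) = w i a * (x * v i b)" if "i \<in> I" "a < k i" "b < k i" for x i a b
    using that by (simp add: \<phi>_def)
  have carM: "carrier (M i) = {..<k i} \<times> {..<k i} \<rightarrow>\<^sub>E carrier (corner_ring i)" for i
    by (simp add: M_def matrix_ring_def)
  have \<phi>M: "\<phi> x i \<in> carrier (M i)" if "i \<in> I" for x i
    using ent that by (auto simp: carM \<phi>_def)
  have \<phi>_in: "\<phi> x \<in> carrier (product_ring I M)" for x
    using \<phi>M by (auto simp: product_ring_def \<phi>_def)
  have exp: "(\<Sum>a<k i. v i a * (w i a * y)) = y" if "i \<in> I" "y * i = y" for i y
    using dd(4)[OF that] by (simp add: sum_distrib_right mult.assoc)
  have addp: "\<phi> (x + y) = \<phi> x \<oplus>\<^bsub>product_ring I M\<^esub> \<phi> y" for x y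
    by (auto simp: product_ring_def \<phi>_def M_def matrix_ring_def fun_eq_iff algebra_simps)
  have multp: "\<phi> (x * y) = \<phi> x \<otimes>\<^bsub>product_ring I M\<^esub> \<phi> y" for x y
  proof -
    have "\<phi> (x * y) i = \<phi> x i \<otimes>\<^bsub>M i\<^esub> \<phi> y i" if i: "i \<in> I" for i
    proof (rule extensionalityI[of _ "{..<k i} \<times> {..<k i}"])
      interpret ring "corner_ring i" using ring_corner_ring[OF ii[OF i]] .
      fix p assume "p \<in> {..<k i} \<times> {..<k i}"
      then obtain a b where p: "p = (a, b)" and ab: "a < k i" "b < k i" by blast
      have "(\<Oplus>\<^bsub>corner_ring i\<^esub>l\<in>{..<k i}. \<phi> x i (a, l) \<otimes>\<^bsub>corner_ring i\<^esub> \<phi> y i (l, b)) =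
          (\<Sum>l<k i. \<phi> x i (a, l) \<otimes>\<^bsub>corner_ring i\<^esub> \<phi> y i (l, b))"
        using ent[OF i] ab by (intro finsum_corner_ring[OF ii[OF i]] Pi_I m_closed) (auto simp: \<phi>_ent[OF i])
      \<comment> \<open>The sum over \<open>l\<close> is the identity of \<open>R i\<close>, written
        out between \<open>x\<close> and \<open>y\<close>.\<close>
      also have "\<dots> = (\<Sum>l<k i. w i a * x * (v i l * (w i l * (y * v i b))))"
        using ab by (intro sum.cong) (auto simp: \<phi>_ent[OF i] mult.assoc)
      also have "\<dots> = w i a * (x * y * v i b)"
        using exp[OF i, of "y * v i b"] dd(1)[OF i ab(2)] by (simp add: sum_distrib_left[symmetric] mult.assoc)
      finally show "\<phi> (x * y) i p = (\<phi> x i \<otimes>\<^bsub>M i\<^esub> \<phi> y i) p"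
        using ab by (simp add: p \<phi>_ent[OF i] M_def matrix_ring_def)
    qed (simp_all add: \<phi>_def i M_def matrix_ring_def)
    then show ?thesis
      by (intro extensionalityI[of _ I]) (simp_all add: product_ring_def, simp add: \<phi>_def)
  qed
  have inj: "inj \<phi>"
  proof (rule injI, rule ccontr)
    fix x y assume eq: "\<phi> x = \<phi> y" and "x \<noteq> y"
    then obtain i z where iz: "i \<in> I" "z * i = z" "(x - y) * z \<noteq> 0"
      using faithful_on_representatives[OF all prim, of "x - y"] by auto
    have "(x - y) * v i b = 0" if b: "b < k i" for b
    proof -
      have "w i a * (x * v i b) = w i a * (y * v i b)" if "a < k i" for a
        using \<phi>_ent[OF iz(1) that b] eq by metis
      then have "v i a * (w i a * ((x - y) * v i b)) = 0" if "a < k i" for a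
        using that by (simp add: algebra_simps)
      then have "(\<Sum>a<k i. v i a * (w i a * ((x - y) * v i b))) = 0" by (intro sum.neutral) auto
      then show ?thesis using exp[OF iz(1), of "(x - y) * v i b"] dd(1)[OF iz(1) b] by (simp add: mult.assoc)
    qed
    then have "(\<Sum>b<k i. (x - y) * (v i b * (w i b * z))) = 0"
      by (intro sum.neutral) (auto simp: mult.assoc[symmetric])
    then have "(x - y) * z = 0" using exp[OF iz(1,2)] by (simp add: sum_distrib_left[symmetric])
    then show False using iz(3) by simp
  qed
  have surj: "\<exists>x. \<phi> x = A" if A: "A \<in> carrier (product_ring I M)" for A
  proof -
    have Ac: "A i (a, b) \<in> carrier (corner_ring i)" if "i \<in> I" "a < k i" "b < k i" for i a b
    proof -
      have "A i \<in> carrier (M i)" using A that by (auto simp: product_ring_def)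
      then show ?thesis using that unfolding carM by (intro PiE_mem[of "A i"]) auto
    qed
    \<comment> \<open>On \<open>R i\<close> the sum of \<open>v i a * A i (a, b) * w i b\<close>
      acts with the matrix \<open>A i\<close>; \<open>glue\<close> realizes all these actions by one
      element.\<close>
    obtain x where x: "\<forall>i\<in>I. \<forall>y. y * i = y \<longrightarrow>
        x * y = (\<Sum>a<k i. \<Sum>b<k i. v i a * A i (a, b) * w i b) * y"
      using glue[OF prim sep, of I "\<lambda>i. \<Sum>a<k i. \<Sum>b<k i. v i a * A i (a, b) * w i b"] by blast
    have "w i c * (x * v i d) = A i (c, d)" if i: "i \<in> I" and cd: "c < k i" "d < k i" for i c d
    proof -
      have "x * v i d = (\<Sum>a<k i. \<Sum>b<k i. v i a * A i (a, b) * w i b) * v i d"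
        using x i dd(1)[OF i cd(2)] by blast
      also have "\<dots> = (\<Sum>a<k i. \<Sum>b<k i. if b = d then v i a * A i (a, d) else 0)"
        unfolding sum_distrib_right
        by (intro sum.cong refl) (use dd(3)[OF i] Ac[OF i] cd in \<open>auto simp: mult.assoc\<close>)
      also have "\<dots> = (\<Sum>a<k i. v i a * A i (a, d))" using cd by simp
      finally have "w i c * (x * v i d) = (\<Sum>a<k i. w i c * v i a * A i (a, d))"
        by (simp add: sum_distrib_left mult.assoc)
      also have "\<dots> = (\<Sum>a<k i. if a = c then A i (c, d) else 0)"
        by (intro sum.cong refl) (use dd(3)[OF i] Ac[OF i] cd in auto)
      finally show ?thesis using cd by simp
    qed
    note ent_A = this
    have "\<phi> x i = A i" if i: "i \<in> I" for i
    proof (rule extensionalityI[of _ "{..<k i} \<times> {..<k i}"])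
      show "\<phi> x i \<in> extensional ({..<k i} \<times> {..<k i})" using i by (simp add: \<phi>_def)
      have "A i \<in> carrier (M i)" using A i by (auto simp: product_ring_def)
      then show "A i \<in> extensional ({..<k i} \<times> {..<k i})" by (simp add: carM PiE_iff)
      show "\<phi> x i p = A i p" if "p \<in> {..<k i} \<times> {..<k i}" for p
        using that ent_A[OF i] \<phi>_ent[OF i] by (cases p) auto
    qed
    then have "\<phi> x = A"
      using A by (intro extensionalityI[of _ I]) (auto simp: \<phi>_def product_ring_def PiE_iff)
    then show ?thesis by blast
  qed
  have bij: "bij_betw \<phi> UNIV (carrier (product_ring I M))"
    unfolding bij_betw_def using inj surj \<phi>_in by blast
  have "continuous_map euclidean (discrete_topology (carrier (M i))) (\<lambda>x. \<phi> x i)" if i: "i \<in> I" for i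
    unfolding continuous_map
  proof (intro conjI allI impI)
    \<comment> \<open>Changing \<open>x\<close> by an element of \<open>U\<close> keeps the matrix:
      the entries of the difference lie both in the corner of \<open>i\<close> and in
      \<open>U\<close>.\<close>
    obtain U where U: "open_ideal U" "i \<notin> U"
      using separated primitive_idempotentD(1)[OF prim[OF i]] by blast
    note Ui = open_idealD[OF U(1)]
    have eq: "\<phi> x i = \<phi> y i" if xy: "x - y \<in> U" for x y
    proof (rule extensionalityI[of _ "{..<k i} \<times> {..<k i}"])
      fix p assume "p \<in> {..<k i} \<times> {..<k i}"
      then obtain a b where p: "p = (a, b)" "a < k i" "b < k i" by blast
      have "w i a * ((x - y) * v i b) \<in> U" using Ui(4)[OF Ui(5)[OF xy]] .
      then have "w i a * ((x - y) * v i b) = 0"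
        using open_ideal_Int_corner_ring[OF prim[OF i] U] ent[OF i p(2,3)] by simp
      then show "\<phi> x i p = \<phi> y i p" using p \<phi>_ent[OF i] by (simp add: algebra_simps)
    qed (simp_all add: \<phi>_def i)
    fix W assume "openin (discrete_topology (carrier (M i))) W"
    have "open {x. \<phi> x i \<in> W}"
    proof (subst open_subopen, rule ballI)
      fix x assume x: "x \<in> {x. \<phi> x i \<in> W}"
      have "open ((\<lambda>y. y - x) -` U)" by (intro continuous_open_vimage Ui(1) continuous_intros)
      moreover have "x \<in> (\<lambda>y. y - x) -` U" using Ui(2) by simp
      moreover have "(\<lambda>y. y - x) -` U \<subseteq> {x. \<phi> x i \<in> W}" using eq x by fastforce
      ultimately show "\<exists>T. open T \<and> x \<in> T \<and> T \<subseteq> {x. \<phi> x i \<in> W}" by blast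
    qed
    then show "openin euclidean {x \<in> topspace euclidean. \<phi> x i \<in> W}" by simp
  qed (use \<phi>M i in auto)
  then have "continuous_map euclidean (discrete_product_topology I M) \<phi>"
    unfolding discrete_product_topology_def by (auto simp: continuous_map_componentwise \<phi>_def)
  then have "homeomorphic_map euclidean (discrete_product_topology I M) \<phi>"
  proof (rule continuous_imp_homeomorphic_map)
    show "compact_space (euclidean :: 'a topology)" using compact_UNIV by (simp add: compact_space_def)
    show "Hausdorff_space (discrete_product_topology I M)" by (rule Hausdorff_space_discrete_product)
  qed (use bij in \<open>auto simp: bij_betw_def product_ring_def\<close>)
  then show ?thesis using bij addp multp by (simp add: topological_ring_iso_def)
qed

end

section \<open>An intrinsic description of profinite rings\<close>

lemma open_ideal_kernel:
  fixes h :: "'a::topological_ring \<Rightarrow> 'b"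
  assumes cont: "continuous_map euclidean (discrete_topology C) h"
    and add: "\<And>x y. h (x + y) = p (h x) (h y)" and mult: "\<And>x y. h (x * y) = m (h x) (h y)"
  shows "open_ideal {x. h x = h 0}"
proof -
  have C: "h x \<in> C" for x using cont by (auto simp: continuous_map_def)
  have "openin euclidean {x \<in> topspace euclidean. h x \<in> {h 0}}"
    by (rule openin_continuous_map_preimage[OF cont]) (use C in auto)
  then have "open {x. h x = h 0}" by simp
  moreover have "h (x - y) = h 0" if "h x = h 0" "h y = h 0" for x y
  proof -
    \<comment> \<open>As \<open>h x = h y\<close>, additivity alone identifies the values at
      \<open>x - y\<close> and at \<open>y - y\<close>; nothing is subtracted in the target.\<close>
    have "h (x + - y) = h (y + - y)" using that by (simp only: add)
    then show ?thesis by simp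
  qed
  moreover have "h (y * x) = h 0" "h (x * y) = h 0" if "h x = h 0" for x y
    using mult[of y x] mult[of y 0] mult[of x y] mult[of 0 y] that by simp_all
  ultimately show ?thesis by (simp add: open_ideal_def)
qed

text \<open>Replaces inverse systems by open ideals: kernels of coordinate maps are open ideals, and
  conversely all open ideals form a directed family of finite index by compactness.\<close>

lemma profinite_ring_iff:
  "profinite_ring TYPE('a::topological_ring) \<longleftrightarrow>
     compact (UNIV :: 'a set) \<and> (\<forall>x::'a. x \<noteq> 0 \<longrightarrow> (\<exists>U. open_ideal U \<and> x \<notin> U))"
proof (intro iffI conjI allI impI)
  assume "profinite_ring TYPE('a)"
  then obtain D :: "'a set set" and r and A :: "'a set \<Rightarrow> nat ring" and f and \<phi> :: "'a \<Rightarrow> 'a set \<Rightarrow> nat"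
    where sys: "inverse_system D r A f" and fin: "\<And>i. i \<in> D \<Longrightarrow> finite (carrier (A i))"
    and iso: "topological_ring_iso \<phi> (inverse_limit D r A f) (inverse_limit_topology D r A f)"
    unfolding profinite_ring_def by blast
  have hm: "homeomorphic_map euclidean (inverse_limit_topology D r A f) \<phi>"
    and bij: "bij_betw \<phi> UNIV (carrier (inverse_limit D r A f))"
    using iso by (auto simp: topological_ring_iso_def)
  have "compact_space (euclidean :: 'a topology)"
    using homeomorphic_compact_space[OF homeomorphic_map_imp_homeomorphic_space[OF hm]]
      compact_space_inverse_limit[OF sys fin] by blast
  then show "compact (UNIV :: 'a set)" by (simp add: compact_space_def)
  fix x :: 'a assume "x \<noteq> 0"
  then have "\<phi> x \<noteq> \<phi> 0" using bij by (auto simp: bij_betw_def dest: injD)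
  moreover have "\<phi> y \<in> extensional D" for y
    using bij by (auto simp: bij_betw_def inverse_limit_def PiE_iff)
  ultimately obtain i where i: "i \<in> D" "\<phi> x i \<noteq> \<phi> 0 i" using extensionalityI by metis
  have "continuous_map euclidean (discrete_product_topology D A) \<phi>"
    using homeomorphic_imp_continuous_map[OF hm]
    by (auto simp: inverse_limit_topology_def continuous_map_in_subtopology)
  from continuous_map_compose[OF this continuous_map_discrete_product_coordinate[where A = A, OF i(1)]]
  have "continuous_map euclidean (discrete_topology (carrier (A i))) (\<lambda>x. \<phi> x i)" by (simp add: o_def)
  then have "open_ideal {y. \<phi> y i = \<phi> 0 i}"
    by (rule open_ideal_kernel[where p = "ring.add (A i)" and m = "monoid.mult (A i)"])
      (use iso i(1) in \<open>simp_all add: topological_ring_iso_def inverse_limit_def product_ring_def\<close>)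
  then show "\<exists>U. open_ideal U \<and> x \<notin> U" using i(2) by blast
next
  assume *: "compact (UNIV :: 'a set) \<and> (\<forall>x::'a. x \<noteq> 0 \<longrightarrow> (\<exists>U. open_ideal U \<and> x \<notin> U))"
  then have cpt: "compact (UNIV :: 'a set)" ..
  show "profinite_ring TYPE('a)"
  proof (rule profinite_ring_open_idealsI[where \<U> = "Collect open_ideal"])
    show "Collect open_ideal \<noteq> ({} :: 'a set set)" by (auto simp: open_ideal_def intro!: exI[of _ UNIV])
    show "\<Inter>(Collect open_ideal) = {0 :: 'a}" using * open_idealD(2) by blast
    fix U V :: "'a set" assume U: "U \<in> Collect open_ideal" and V: "V \<in> Collect open_ideal"
    then show "\<exists>W\<in>Collect open_ideal. W \<subseteq> U \<inter> V"
      by (intro bexI[of _ "U \<inter> V"]) (auto simp: open_ideal_def)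
  next
    fix U :: "'a set" assume "U \<in> Collect open_ideal"
    then have U: "open_ideal U" by simp
    note Ui = open_idealD[OF U]
    obtain B where B: "finite B" "\<forall>y. \<exists>x\<in>B. y - x \<in> U" using open_ideal_finite_index[OF cpt U] by blast
    have "{y. y - x \<in> U} \<in> (\<lambda>x. {y. y - x \<in> U}) ` B" for x
    proof -
      obtain c where c: "c \<in> B" "x - c \<in> U" using B by blast
      have "y - x \<in> U \<longleftrightarrow> y - c \<in> U" for y
        using Ui(6)[OF _ c(2), of "y - x"] Ui(3)[OF _ c(2), of "y - c"] by auto
      then show ?thesis using c(1) by blast
    qed
    then show "finite (range (\<lambda>x. {y. y - x \<in> U}))"
      by (intro finite_subset[OF _ finite_imageI[OF B(1)]]) blast
    show "open U" "0 \<in> U" by (fact Ui(1,2))+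
    show "x - y \<in> U" if "x \<in> U" "y \<in> U" for x y using Ui(3)[OF that] .
    show "y * x \<in> U" "x * y \<in> U" if "x \<in> U" for x y using Ui(4,5)[OF that] by blast+
  qed (rule cpt)
qed

section \<open>Bounds on matrix sizes and fields\<close>

context idempotent_rich
begin

lemma bounded_dual_bases:
  fixes I :: "'a set" and k :: "'a \<Rightarrow> nat" and v w :: "'a \<Rightarrow> nat \<Rightarrow> 'a"
  assumes prim: "\<And>i. i \<in> I \<Longrightarrow> primitive_idempotent i"
    and sep: "\<And>i j. i \<in> I \<Longrightarrow> j \<in> I \<Longrightarrow> linked i j \<Longrightarrow> i = j"
    and dual: "\<And>i. i \<in> I \<Longrightarrow> dual_basis i (k i) (v i) (w i)"
    and fin: "\<And>x::'a. finite (range (npow x))"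
  shows "\<exists>N. \<forall>i\<in>I. k i \<le> N"
proof -
  note dd = dual_basisD[OF dual]
  \<comment> \<open>The nilpotent shift \<open>v a \<mapsto> v (a + 1)\<close> on all components at once: for every \<open>i\<close>, its first \<open>k i - 1\<close> powers are distinct.\<close>
  obtain x where x: "\<forall>i\<in>I. \<forall>y. y * i = y \<longrightarrow> x * y = (\<Sum>a<k i - 1. v i (Suc a) * w i a) * y"
    using glue[OF prim sep, of I "\<lambda>i. \<Sum>a<k i - 1. v i (Suc a) * w i a"] by blast
  have "k i \<le> card (range (npow x)) + 1" if i: "i \<in> I" for i
  proof -
    have shift: "x * v i a = v i (Suc a)" if a: "Suc a < k i" for a
    proof -
      have "x * v i a = (\<Sum>b<k i - 1. v i (Suc b) * w i b) * v i a" using x i dd(1)[OF i] a by simp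
      also have "\<dots> = (\<Sum>b<k i - 1. if b = a then v i (Suc a) else 0)"
        unfolding sum_distrib_right
        by (intro sum.cong refl) (use a dd(3)[OF i] dd(1)[OF i a] in \<open>auto simp: mult.assoc\<close>)
      finally show ?thesis using a by (simp add: less_diff_conv)
    qed
    \<comment> \<open>The exponent is \<open>n + 1\<close>, so the first basis vector is carried to
      the one with index \<open>n + 1\<close>.\<close>
    have pw: "npow x n * v i 0 = v i (Suc n)" if "Suc n < k i" for n
      using that by (induction n) (simp_all add: npow_Suc shift mult.assoc)
    have "inj_on (npow x) {..<k i - 1}"
    proof (rule inj_onI, rule ccontr)
      fix m n assume mn: "m \<in> {..<k i - 1}" "n \<in> {..<k i - 1}" "npow x m = npow x n" "m \<noteq> n"
      then have "v i (Suc m) = v i (Suc n)" using pw[of m] pw[of n] by simp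
      moreover have "w i (Suc m) * v i (Suc m) = i" "w i (Suc m) * v i (Suc n) = 0"
        using dd(3)[OF i, of "Suc m" "Suc m"] dd(3)[OF i, of "Suc m" "Suc n"] mn(1,2,4) by auto
      ultimately show False using primitive_idempotentD(1)[OF prim[OF i]] by simp
    qed
    then have "card (npow x ` {..<k i - 1}) = k i - 1" by (simp add: card_image)
    moreover have "card (npow x ` {..<k i - 1}) \<le> card (range (npow x))" by (intro card_mono fin) auto
    ultimately show ?thesis by simp
  qed
  then show ?thesis by blast
qed

lemma bounded_corner_rings:
  fixes I :: "'a set"
  assumes prim: "\<And>i. i \<in> I \<Longrightarrow> primitive_idempotent i"
    and sep: "\<And>i j. i \<in> I \<Longrightarrow> j \<in> I \<Longrightarrow> linked i j \<Longrightarrow> i = j"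
    and fin: "\<And>x::'a. finite (range (npow x))"
  shows "\<exists>N. \<forall>i\<in>I. card (carrier (corner_ring i)) \<le> N"
proof -
  have "\<forall>i\<in>I. \<exists>g. g \<in> carrier (corner_ring i) \<and>
      carrier (corner_ring i) - {0} = {g [^]\<^bsub>corner_ring i\<^esub> n |n::nat. True}"
  proof
    fix i assume i: "i \<in> I"
    interpret field "corner_ring i" using field_corner_ring[OF prim[OF i]] .
    from finite_field_mult_group_has_gen[OF finite_corner_ring[OF prim[OF i]]]
    obtain a where "a \<in> carrier (Multiplicative_Group.mult_of (corner_ring i))"
      "carrier (Multiplicative_Group.mult_of (corner_ring i)) = {a [^]\<^bsub>corner_ring i\<^esub> n |n::nat. n \<in> UNIV}"
      by (rule bexE)
    then show "\<exists>g. g \<in> carrier (corner_ring i) \<and>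
        carrier (corner_ring i) - {0} = {g [^]\<^bsub>corner_ring i\<^esub> n |n::nat. True}"
      by (intro exI[of _ a]) (simp add: Multiplicative_Group.carrier_mult_of del: corner_ring_simps(1))
  qed
  from bchoice[OF this] obtain g where gI: "\<forall>i\<in>I. g i \<in> carrier (corner_ring i) \<and>
      carrier (corner_ring i) - {0} = {g i [^]\<^bsub>corner_ring i\<^esub> n |n::nat. True}"
    by (rule exE)
  note g = conjunct1[OF bspec[OF gI]] conjunct2[OF bspec[OF gI]]
  obtain x where x: "\<And>i y. i \<in> I \<Longrightarrow> y * i = y \<Longrightarrow> x * y = g i * y"
    using glue[OF prim sep, of I g] by blast
  have "card (carrier (corner_ring i)) \<le> card (range (npow x)) + 2" if i: "i \<in> I" for i
  proof -
    note ii = primitive_idempotentD(2)[OF prim[OF i]]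
    interpret field "corner_ring i" using field_corner_ring[OF prim[OF i]] .
    have pc: "g i [^]\<^bsub>corner_ring i\<^esub> n * i = g i [^]\<^bsub>corner_ring i\<^esub> n" for n :: nat
      using nat_pow_closed[OF g(1)[OF i], of n] by simp
    have pw: "npow x n * i = g i [^]\<^bsub>corner_ring i\<^esub> Suc n" for n
    proof (induction n)
      case 0
      have "x * i = g i * i" using x[OF i ii] .
      then show ?case using g(1)[OF i] by simp
    next
      case (Suc n)
      have "npow x (Suc n) * i = x * (g i [^]\<^bsub>corner_ring i\<^esub> Suc n)"
        by (simp only: npow_Suc mult.assoc Suc)
      also have "\<dots> = g i * (g i [^]\<^bsub>corner_ring i\<^esub> Suc n)" using x[OF i pc] .
      also have "\<dots> = g i [^]\<^bsub>corner_ring i\<^esub> Suc (Suc n)"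
        using nat_pow_Suc2[OF g(1)[OF i], of "Suc n"] by simp
      finally show ?case .
    qed
    \<comment> \<open>\<open>npow\<close> starts at exponent 1, so 0 and the zeroth power
      \<open>i\<close> of the generator are listed separately; hence the 2 in the bound.\<close>
    have "carrier (corner_ring i) \<subseteq> {0, i} \<union> (\<lambda>t. t * i) ` range (npow x)"
    proof
      fix d assume d: "d \<in> carrier (corner_ring i)"
      show "d \<in> {0, i} \<union> (\<lambda>t. t * i) ` range (npow x)"
      proof (cases "d = 0")
        case False
        then have "d \<in> carrier (corner_ring i) - {0}" using d by blast
        then obtain n :: nat where n: "d = g i [^]\<^bsub>corner_ring i\<^esub> n"
          unfolding g(2)[OF i] by blast
        show ?thesis
        proof (cases n)
          case 0 then show ?thesis using n nat_pow_0[of "g i"] by simp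
        next
          case (Suc m)
          then have "d = npow x m * i" using n pw[of m] by simp
          then show ?thesis by blast
        qed
      qed simp
    qed
    moreover have "finite ({0, i} \<union> (\<lambda>t. t * i) ` range (npow x))" using fin by simp
    ultimately have "card (carrier (corner_ring i)) \<le> card ({0, i} \<union> (\<lambda>t. t * i) ` range (npow x))"
      by (rule card_mono[rotated])
    also have "\<dots> \<le> card {0, i} + card ((\<lambda>t. t * i) ` range (npow x))" by (rule card_Un_le)
    also have "\<dots> \<le> 2 + card (range (npow x))"
      using card_image_le[OF fin] by (intro add_mono) (auto simp: card_insert_if)
    finally show ?thesis by simp
  qed
  then show ?thesis by blast
qed

end

lemma matrix_product_if_profinite:
  assumes ss: "semisimple TYPE('a::topological_ring)" and wlf: "weakly_locally_finite TYPE('a)"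
    and prof: "profinite_ring TYPE('a)"
  shows "\<exists>(I :: 'a set) (F :: 'a \<Rightarrow> 'a ring) k \<phi>. finite_type_matrix_product I F k (\<phi> :: 'a \<Rightarrow> _)"
proof -
  interpret idempotent_rich "TYPE('a)"
    using prof[unfolded profinite_ring_iff] idempotent_multiple[OF ss wlf] by unfold_locales auto
  obtain I :: "'a set" where prim: "\<And>i. i \<in> I \<Longrightarrow> primitive_idempotent i"
    and sep: "\<And>i j. i \<in> I \<Longrightarrow> j \<in> I \<Longrightarrow> linked i j \<Longrightarrow> i = j"
    and all: "\<And>f. primitive_idempotent f \<Longrightarrow> \<exists>i\<in>I. linked i f"
    using primitive_representatives by blast
  have "\<forall>i\<in>I. \<exists>k v w. k \<ge> 1 \<and> dual_basis i k v w" using dual_basis_exists prim by blast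
  then obtain k v w where k: "\<And>i. i \<in> I \<Longrightarrow> k i \<ge> 1"
    and dual: "\<And>i. i \<in> I \<Longrightarrow> dual_basis i (k i) (v i) (w i)" by metis
  have "\<exists>K. \<forall>i\<in>I. k i \<le> K"
    by (rule bounded_dual_bases[OF prim sep dual finite_range_npow[OF wlf]])
  then obtain K where K: "\<And>i. i \<in> I \<Longrightarrow> k i \<le> K" by blast
  have "\<exists>N. \<forall>i\<in>I. card (carrier (corner_ring i)) \<le> N"
    by (rule bounded_corner_rings[OF prim sep finite_range_npow[OF wlf]])
  then obtain N where N: "\<And>i. i \<in> I \<Longrightarrow> card (carrier (corner_ring i)) \<le> N" by blast
  note fld = field_corner_ring[OF prim] and fin = finite_corner_ring[OF prim]
  have "finite_type_matrix_product I corner_ring k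
      (\<lambda>x. \<lambda>i\<in>I. \<lambda>(a, b)\<in>{..<k i} \<times> {..<k i}. w i a * (x * v i b))"
    unfolding finite_type_matrix_product_def Let_def
    using matrix_decomposition[OF prim sep all dual] finite_matrix_ring_types[OF fld fin N K] fld fin k
    by (intro conjI ballI)
  then show ?thesis by (intro exI)
qed

section \<open>Products of matrix rings\<close>

lemma semisimple_if_idempotent_multiples:
  assumes "\<And>x :: 'a::ring. x \<noteq> 0 \<Longrightarrow> \<exists>y. y * x \<noteq> 0 \<and> (y * x) * (y * x) = y * x"
  shows "semisimple TYPE('a)"
proof -
  have "x = 0" if x: "x \<in> jacobson_radical" for x :: 'a
  proof (rule ccontr)
    assume "x \<noteq> 0"
    then obtain y where y: "y * x \<noteq> 0" "(y * x) * (y * x) = y * x" using assms by blast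
    define w where "w = y * x"
    have w: "w \<noteq> 0" "w * w = w" using y by (auto simp: w_def)
    \<comment> \<open>The radical condition at \<open>- y\<close>: multiplying
      \<open>- w + z - z * w = 0\<close> by the idempotent \<open>w\<close> on the right cancels
      \<open>z\<close> and leaves \<open>w = 0\<close>.\<close>
    have "\<exists>z. - y * x + z + z * (- y) * x = 0" using x unfolding jacobson_radical_def by blast
    then obtain z where "- y * x + z + z * (- y) * x = 0" by blast
    then have "- w + z - z * w = 0" by (simp add: w_def mult.assoc)
    then have "(- w + z - z * w) * w = 0" by simp
    then show False using w by (simp add: algebra_simps)
  qed
  moreover have "0 \<in> (jacobson_radical :: 'a set)" by (auto simp: jacobson_radical_def intro: exI[of _ 0])
  ultimately show ?thesis by (auto simp: semisimple_def)
qed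

text \<open>Translation by a member is injective on the finite set, hence onto; this supplies zero
  and negatives.\<close>

lemma is_subring_if_finite_closed:
  fixes S :: "'a::ring set"
  assumes fin: "finite S" and ne: "x \<in> S"
    and add: "\<And>x y. x \<in> S \<Longrightarrow> y \<in> S \<Longrightarrow> x + y \<in> S" and mult: "\<And>x y. x \<in> S \<Longrightarrow> y \<in> S \<Longrightarrow> x * y \<in> S"
  shows "is_subring S"
proof -
  have surj: "\<exists>z\<in>S. y + z = u" if y: "y \<in> S" and u: "u \<in> S" for y u
  proof -
    have "(+) y ` S = S"
      by (rule endo_inj_surj[OF fin]) (use add y in \<open>auto simp: inj_on_def\<close>)
    then show ?thesis using u by (metis imageE)
  qed
  have z: "0 \<in> S" using surj[OF ne ne] by auto
  moreover have "- y \<in> S" if y: "y \<in> S" for y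
  proof -
    obtain u where "u \<in> S" "y + u = 0" using surj[OF y z] by blast
    then show ?thesis by (metis minus_unique)
  qed
  ultimately show ?thesis using add mult by (simp add: is_subring_def)
qed

lemma (in abelian_monoid) finsum_single:
  assumes "finite A" "s \<in> A" "f s \<in> carrier G" "\<And>l. l \<in> A \<Longrightarrow> l \<noteq> s \<Longrightarrow> f l = \<zero>"
  shows "finsum G f A = f s"
proof -
  have fc: "f \<in> A \<rightarrow> carrier G" using assms(3,4) by (metis Pi_I zero_closed)
  have "finsum G f A = finsum G (\<lambda>l. if s = l then f l else \<zero>) A"
    by (rule finsum_cong') (use assms in auto)
  also have "\<dots> = f s" using assms(1,2) fc by (intro finsum_singleton) auto
  finally show ?thesis .
qed

section \<open>Products of matrix rings with finitely many types of factors\<close>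

locale matrix_product =
  fixes I :: "'i set" and F :: "'i \<Rightarrow> 'f ring" and k :: "'i \<Rightarrow> nat"
    and \<phi> :: "'a::topological_ring \<Rightarrow> 'i \<Rightarrow> nat \<times> nat \<Rightarrow> 'f"
  assumes prod: "finite_type_matrix_product I F k \<phi>"
begin

definition M :: "'i \<Rightarrow> (nat \<times> nat \<Rightarrow> 'f) ring" where
  "M i = matrix_ring (k i) (F i)"

lemma field_F: "i \<in> I \<Longrightarrow> field (F i)" and finite_F: "i \<in> I \<Longrightarrow> finite (carrier (F i))"
  and finite_types: "finite (I // {(i, j). i \<in> I \<and> j \<in> I \<and> M i \<simeq> M j})"
  and iso: "topological_ring_iso \<phi> (product_ring I M) (discrete_product_topology I M)"
proof -
  have M: "M = (\<lambda>i. matrix_ring (k i) (F i))" by (simp add: fun_eq_iff M_def)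
  show "i \<in> I \<Longrightarrow> field (F i)" "i \<in> I \<Longrightarrow> finite (carrier (F i))"
    "finite (I // {(i, j). i \<in> I \<and> j \<in> I \<and> M i \<simeq> M j})"
    "topological_ring_iso \<phi> (product_ring I M) (discrete_product_topology I M)"
    using prod unfolding finite_type_matrix_product_def Let_def M by auto
qed

lemma carrier_M: "carrier (M i) = {..<k i} \<times> {..<k i} \<rightarrow>\<^sub>E carrier (F i)"
  by (simp add: M_def matrix_ring_def)

lemma bij: "bij_betw \<phi> UNIV (\<Pi>\<^sub>E i\<in>I. carrier (M i))"
  and homeomorphic: "homeomorphic_map euclidean (discrete_product_topology I M) \<phi>"
  using iso by (auto simp: topological_ring_iso_def product_ring_def)

lemma \<phi>_add: "i \<in> I \<Longrightarrow> \<phi> (x + y) i = \<phi> x i \<oplus>\<^bsub>M i\<^esub> \<phi> y i"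
  and \<phi>_mult: "i \<in> I \<Longrightarrow> \<phi> (x * y) i = \<phi> x i \<otimes>\<^bsub>M i\<^esub> \<phi> y i"
  using iso by (simp_all add: topological_ring_iso_def product_ring_def)

lemma \<phi>_in: "\<phi> x \<in> (\<Pi>\<^sub>E i\<in>I. carrier (M i))"
  using bij by (auto simp: bij_betw_def)

lemma \<phi>_eqI: "x = y" if "\<And>i. i \<in> I \<Longrightarrow> \<phi> x i = \<phi> y i"
proof -
  have "\<phi> x = \<phi> y" using \<phi>_in[of x] \<phi>_in[of y] that by (intro extensionalityI[of _ I]) (auto simp: PiE_iff)
  then show ?thesis using bij by (auto simp: bij_betw_def dest: injD)
qed

lemma \<phi>_surj: "A \<in> (\<Pi>\<^sub>E i\<in>I. carrier (M i)) \<Longrightarrow> \<exists>x. \<phi> x = A"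
  using bij unfolding bij_betw_def by (metis rangeE)

lemma \<phi>_M: "i \<in> I \<Longrightarrow> \<phi> x i \<in> carrier (M i)"
  using \<phi>_in[of x] by auto

lemma entry: "i \<in> I \<Longrightarrow> a < k i \<Longrightarrow> b < k i \<Longrightarrow> \<phi> x i (a, b) \<in> carrier (F i)"
  using \<phi>_M[of i x] by (auto simp: carrier_M)

lemma matrix_eqI:
  assumes "i \<in> I" "\<And>a b. a < k i \<Longrightarrow> b < k i \<Longrightarrow> \<phi> x i (a, b) = \<phi> y i (a, b)"
  shows "\<phi> x i = \<phi> y i"
  using \<phi>_M[OF assms(1), of x] \<phi>_M[OF assms(1), of y] assms(2)
  by (intro extensionalityI[of _ "{..<k i} \<times> {..<k i}"]) (auto simp: carrier_M PiE_iff)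

lemma entry_mult:
  assumes "i \<in> I" "a < k i" "b < k i"
  shows "\<phi> (x * y) i (a, b) = (\<Oplus>\<^bsub>F i\<^esub>l\<in>{..<k i}. \<phi> x i (a, l) \<otimes>\<^bsub>F i\<^esub> \<phi> y i (l, b))"
  using assms by (simp add: \<phi>_mult) (simp add: M_def matrix_ring_def)

lemma entry_0:
  assumes "i \<in> I" "a < k i" "b < k i"
  shows "\<phi> 0 i (a, b) = \<zero>\<^bsub>F i\<^esub>"
proof -
  interpret field "F i" using field_F[OF assms(1)] .
  have "\<phi> (0 + 0) i (a, b) = \<phi> 0 i (a, b) \<oplus>\<^bsub>F i\<^esub> \<phi> 0 i (a, b)"
    using assms by (simp only: \<phi>_add) (simp add: M_def matrix_ring_def)
  then show ?thesis using entry[OF assms, of 0] by (simp add: add.l_cancel_one)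
qed

lemma M_closed:
  assumes "i \<in> I" "A \<in> carrier (M i)" "B \<in> carrier (M i)"
  shows "A \<oplus>\<^bsub>M i\<^esub> B \<in> carrier (M i)" "A \<otimes>\<^bsub>M i\<^esub> B \<in> carrier (M i)"
proof -
  interpret field "F i" using field_F[OF assms(1)] .
  have A: "A (a, b) \<in> carrier (F i)" "B (a, b) \<in> carrier (F i)" if "a < k i" "b < k i" for a b
    using assms(2,3) that by (auto simp: carrier_M)
  show "A \<oplus>\<^bsub>M i\<^esub> B \<in> carrier (M i)"
    unfolding carrier_M using A by (auto simp: M_def matrix_ring_def)
  show "A \<otimes>\<^bsub>M i\<^esub> B \<in> carrier (M i)"
    unfolding carrier_M using A by (auto simp: M_def matrix_ring_def intro!: finsum_closed)
qed

lemma profinite: "profinite_ring TYPE('a)"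
  unfolding profinite_ring_iff
proof (intro conjI allI impI)
  have "finite (carrier (M i))" if "i \<in> I" for i
    using finite_F[OF that] by (auto simp: carrier_M intro!: finite_PiE)
  then have "compact_space (euclidean :: 'a topology)"
    using homeomorphic_compact_space[OF homeomorphic_map_imp_homeomorphic_space[OF homeomorphic]]
      compact_space_discrete_product[of I M] by blast
  then show "compact (UNIV :: 'a set)" by (simp add: compact_space_def)
  fix x :: 'a assume "x \<noteq> 0"
  then obtain i where i: "i \<in> I" "\<phi> x i \<noteq> \<phi> 0 i" using \<phi>_eqI by blast
  from continuous_map_compose[OF homeomorphic_imp_continuous_map[OF homeomorphic]
      continuous_map_discrete_product_coordinate[where A = M, OF i(1)]]
  have "continuous_map euclidean (discrete_topology (carrier (M i))) (\<lambda>x. \<phi> x i)" by (simp add: o_def)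
  then have "open_ideal {y. \<phi> y i = \<phi> 0 i}"
    by (rule open_ideal_kernel[OF _ \<phi>_add[OF i(1)] \<phi>_mult[OF i(1)]])
  then show "\<exists>U. open_ideal U \<and> x \<notin> U" using i(2) by blast
qed

text \<open>
  If \<open>c\<close> is a nonzero entry of \<open>x\<close> in position \<open>(a, b)\<close> of the factor \<open>i\<close>, then multiplying from the
  left by the matrix with the only entry \<open>inv c\<close> in position \<open>(b, a)\<close> yields an idempotent
  concentrated in row \<open>b\<close>.
\<close>

lemma semisimple: "semisimple TYPE('a)"
proof (rule semisimple_if_idempotent_multiples)
  fix x :: 'a assume "x \<noteq> 0"
  then obtain i where i: "i \<in> I" "\<phi> x i \<noteq> \<phi> 0 i" using \<phi>_eqI by blast
  then obtain a b where ab: "a < k i" "b < k i" "\<phi> x i (a, b) \<noteq> \<phi> 0 i (a, b)" using matrix_eqI by blast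
  define c where "c = inv\<^bsub>F i\<^esub> \<phi> x i (a, b)"
  interpret Fi: field "F i" using field_F[OF i(1)] .
  have "\<phi> x i (a, b) \<in> Units (F i)"
    using entry[OF i(1) ab(1,2)] ab entry_0[OF i(1) ab(1,2)] Fi.field_Units by auto
  then have c: "c \<in> carrier (F i)" "c \<otimes>\<^bsub>F i\<^esub> \<phi> x i (a, b) = \<one>\<^bsub>F i\<^esub>" by (simp_all add: c_def)
  define A where "A = (\<lambda>j\<in>I. \<lambda>(p, q)\<in>{..<k j} \<times> {..<k j}. if j = i \<and> p = b \<and> q = a then c else \<zero>\<^bsub>F j\<^esub>)"
  have zc: "\<zero>\<^bsub>F j\<^esub> \<in> carrier (F j)" if "j \<in> I" for j
  proof -
    interpret field "F j" using field_F[OF that] .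
    show ?thesis by simp
  qed
  have "A \<in> (\<Pi>\<^sub>E i\<in>I. carrier (M i))" 
  proof (rule PiE_I)
    fix j assume j: "j \<in> I"
    show "A j \<in> carrier (M j)"
      unfolding carrier_M
    proof (rule PiE_I)
      show "A j t \<in> carrier (F j)" if "t \<in> {..<k j} \<times> {..<k j}" for t
        using that j c(1) zc[OF j] by (cases t) (simp add: A_def)
      show "A j t = undefined" if "t \<notin> {..<k j} \<times> {..<k j}" for t
        using that j by (simp add: A_def)
    qed
  qed (simp add: A_def)
  then obtain y where y: "\<phi> y = A" using \<phi>_surj by blast
  \<comment> \<open>Product formula for a \<open>u\<close> supported in row \<open>b\<close> of
    factor \<open>i\<close>, when only the index \<open>s\<close> contributes to the sum. It serves
    \<open>y * x\<close> with \<open>s = a\<close> and \<open>w * w\<close> with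
    \<open>s = b\<close>.\<close>
  have rows: "\<phi> (u * z) j (p, q) =
      (if j = i \<and> p = b then \<phi> u i (b, s) \<otimes>\<^bsub>F i\<^esub> \<phi> z i (s, q) else \<zero>\<^bsub>F j\<^esub>)"
    if s: "s < k i" and j: "j \<in> I" "p < k j" "q < k j"
      and s0: "\<And>l. l < k i \<Longrightarrow> l \<noteq> s \<Longrightarrow> j = i \<Longrightarrow> \<phi> u i (b, l) \<otimes>\<^bsub>F i\<^esub> \<phi> z i (l, q) = \<zero>\<^bsub>F i\<^esub>"
      and u0: "\<And>l. l < k j \<Longrightarrow> \<not> (j = i \<and> p = b) \<Longrightarrow> \<phi> u j (p, l) = \<zero>\<^bsub>F j\<^esub>"
    for u z j p q s
  proof (cases "j = i \<and> p = b")
    case True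
    have "\<phi> (u * z) i (b, q) = \<phi> u i (b, s) \<otimes>\<^bsub>F i\<^esub> \<phi> z i (s, q)"
      using True s j ab(2) s0 entry[OF i(1)]
      by (subst entry_mult[OF i(1)]) (auto intro!: Fi.finsum_single)
    then show ?thesis using True by simp
  next
    case False
    interpret Fj: field "F j" using field_F[OF j(1)] .
    have "\<phi> (u * z) j (p, q) = (\<Oplus>\<^bsub>F j\<^esub>l\<in>{..<k j}. \<zero>\<^bsub>F j\<^esub>)"
      unfolding entry_mult[OF j]
      by (rule Fj.finsum_cong') (use u0 False entry[OF j(1) _ j(3), of _ z] in auto)
    then show ?thesis by (simp only: False if_False Fj.finsum_zero)
  qed
  define w where "w = y * x"
  have w: "\<phi> w j (p, q) = (if j = i \<and> p = b then c \<otimes>\<^bsub>F i\<^esub> \<phi> x i (a, q) else \<zero>\<^bsub>F j\<^esub>)"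
    if j: "j \<in> I" and pq: "p < k j" "q < k j" for j p q
  proof -
    have ye: "\<phi> y j (p, l) = (if j = i \<and> p = b \<and> l = a then c else \<zero>\<^bsub>F j\<^esub>)"
      if "j \<in> I" "p < k j" "l < k j" for j p l
      using that by (simp add: y A_def)
    have "\<phi> w j (p, q) = (if j = i \<and> p = b then \<phi> y i (b, a) \<otimes>\<^bsub>F i\<^esub> \<phi> x i (a, q) else \<zero>\<^bsub>F j\<^esub>)"
      unfolding w_def
    proof (rule rows[OF ab(1) j pq])
      fix l assume l: "l < k i" "l \<noteq> a" and "j = i"
      then have "\<phi> y i (b, l) = \<zero>\<^bsub>F i\<^esub>" "\<phi> x i (l, q) \<in> carrier (F i)"
        using ye[OF i(1) ab(2) l(1)] entry[OF i(1) l(1)] pq by simp_all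
      then show "\<phi> y i (b, l) \<otimes>\<^bsub>F i\<^esub> \<phi> x i (l, q) = \<zero>\<^bsub>F i\<^esub>" by (simp only: Fi.l_null)
    next
      fix l assume "l < k j" "\<not> (j = i \<and> p = b)"
      then show "\<phi> y j (p, l) = \<zero>\<^bsub>F j\<^esub>" using ye[OF j pq(1), of l] by (auto split: if_splits)
    qed
    then show ?thesis using ye[OF i(1) ab(2) ab(1)] by simp
  qed
  \<comment> \<open>This diagonal entry makes \<open>w\<close> both idempotent and nonzero.\<close>
  have wbb: "\<phi> w i (b, b) = \<one>\<^bsub>F i\<^esub>" using w[OF i(1) ab(2) ab(2)] c by simp
  have "\<phi> (w * w) j = \<phi> w j" if j: "j \<in> I" for j
  proof (rule matrix_eqI[OF j])
    fix p q assume pq: "p < k j" "q < k j"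
    have "\<phi> (w * w) j (p, q) = (if j = i \<and> p = b then \<phi> w i (b, b) \<otimes>\<^bsub>F i\<^esub> \<phi> w i (b, q) else \<zero>\<^bsub>F j\<^esub>)"
    proof (rule rows[OF ab(2) j pq])
      fix l assume l: "l < k i" "l \<noteq> b" and "j = i"
      then have "\<phi> w i (l, q) = \<zero>\<^bsub>F i\<^esub>" "\<phi> w i (b, l) \<in> carrier (F i)"
        using w[OF i(1) l(1), of q] entry[OF i(1) ab(2) l(1), of w] pq by simp_all
      then show "\<phi> w i (b, l) \<otimes>\<^bsub>F i\<^esub> \<phi> w i (l, q) = \<zero>\<^bsub>F i\<^esub>" by (simp only: Fi.r_null)
    next
      fix l assume "l < k j" "\<not> (j = i \<and> p = b)"
      then show "\<phi> w j (p, l) = \<zero>\<^bsub>F j\<^esub>" using w[OF j pq(1), of l] by (auto split: if_splits)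
    qed
    then show "\<phi> (w * w) j (p, q) = \<phi> w j (p, q)"
      using w[OF j pq] entry[OF i(1) ab(2), of q w] pq wbb by auto
  qed
  then have "w * w = w" by (rule \<phi>_eqI)
  moreover have "w \<noteq> 0" using wbb entry_0[OF i(1) ab(2) ab(2)] by auto
  ultimately show "\<exists>y. y * x \<noteq> 0 \<and> (y * x) * (y * x) = y * x" unfolding w_def by blast
qed

text \<open>Each type gets one model ring, and \<open>h j\<close> identifies it with the factor
  \<open>j\<close>. At two factors of the same type where \<open>x\<close> has the same preimage in
  the model, every element generated by \<open>x\<close> agrees too, and only finitely many such
  situations occur.\<close>

lemma weakly_locally_finite: "weakly_locally_finite TYPE('a)"
  unfolding weakly_locally_finite_def
proof
  fix x :: 'a
  define r where "r = {(i, j). i \<in> I \<and> j \<in> I \<and> M i \<simeq> M j}"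
  define cl where "cl j = r `` {j}" for j
  define s where "s C = (SOME i. i \<in> I \<and> cl i = C)" for C
  have clQ: "cl j \<in> I // r" if "j \<in> I" for j using that by (simp add: cl_def quotientI)
  have s: "s (cl j) \<in> I" "M (s (cl j)) \<simeq> M j" if j: "j \<in> I" for j
  proof -
    have *: "s (cl j) \<in> I \<and> cl (s (cl j)) = cl j"
      unfolding s_def by (rule someI[of _ j]) (use j in simp)
    have "id \<in> ring_iso (M j) (M j)" by (auto simp: ring_iso_def ring_hom_def)
    then have "j \<in> cl j" using j by (auto simp: cl_def r_def is_ring_iso_def)
    then have "j \<in> cl (s (cl j))" using * by simp
    then have "(s (cl j), j) \<in> r" unfolding cl_def[of "s (cl j)"] by blast
    then show "s (cl j) \<in> I" "M (s (cl j)) \<simeq> M j" unfolding r_def by blast+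
  qed
  have "\<forall>j\<in>I. \<exists>h. h \<in> ring_iso (M (s (cl j))) (M j)" 
    using s(2) unfolding is_ring_iso_def by (metis ex_in_conv)
  then obtain h where h: "\<And>j. j \<in> I \<Longrightarrow> h j \<in> ring_iso (M (s (cl j))) (M j)" by metis
  have "\<forall>j\<in>I. \<exists>a\<in>carrier (M (s (cl j))). h j a = \<phi> x j"
  proof
    fix j assume j: "j \<in> I"
    have "\<phi> x j \<in> h j ` carrier (M (s (cl j)))"
      using \<phi>_M[OF j] h[OF j] by (simp add: ring_iso_def bij_betw_def)
    then show "\<exists>a\<in>carrier (M (s (cl j))). h j a = \<phi> x j" by auto
  qed
  then obtain a where a: "\<And>j. j \<in> I \<Longrightarrow> a j \<in> carrier (M (s (cl j)))" "\<And>j. j \<in> I \<Longrightarrow> h j (a j) = \<phi> x j"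
    by metis
  \<comment> \<open>All pairs of a type and a matrix of its model; a member of \<open>G\<close> is
    then a rule that assigns a component to each pair, and there are finitely many rules.\<close>
  define T where "T = (SIGMA C:I // r. carrier (M (s C)))"
  define G where "G = (\<Pi>\<^sub>E t\<in>T. carrier (M (s (fst t))))"
  \<comment> \<open>the elements whose component at \<open>j\<close> depends only on the type of \<open>j\<close> and the component of \<open>x\<close> at \<open>j\<close>\<close>
  define S where "S = {y. \<exists>g\<in>G. \<forall>j\<in>I. \<phi> y j = h j (g (cl j, a j))}"
  have sI: "s C \<in> I" if C: "C \<in> I // r" for C
  proof -
    obtain j where "j \<in> I" "C = cl j" using C by (auto simp: quotient_def cl_def)
    then show ?thesis using s by simp
  qed
  have finM: "finite (carrier (M i))" if "i \<in> I" for i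
    using finite_F[OF that] by (auto simp: carrier_M intro!: finite_PiE)
  have "finite T" unfolding T_def using finite_types finM sI by (intro finite_SigmaI) (auto simp: r_def)
  then have finG: "finite G" unfolding G_def
    using finM sI by (intro finite_PiE) (auto simp: T_def)
  have tT: "(cl j, a j) \<in> T" if "j \<in> I" for j using clQ[OF that] a(1)[OF that] by (simp add: T_def)
  have gC: "g (cl j, a j) \<in> carrier (M (s (cl j)))" if "g \<in> G" "j \<in> I" for g j
    using that(1) tT[OF that(2)] unfolding G_def by (auto dest: PiE_mem)
  have "finite S"
  proof (rule finite_subset)
    \<comment> \<open>By injectivity of \<phi>, a rule determines its element.\<close>
    show "S \<subseteq> (\<lambda>g. THE y. \<forall>j\<in>I. \<phi> y j = h j (g (cl j, a j))) ` G"
    proof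
      fix y assume "y \<in> S"
      then obtain g where g: "g \<in> G" "\<forall>j\<in>I. \<phi> y j = h j (g (cl j, a j))" by (auto simp: S_def)
      have "(THE y. \<forall>j\<in>I. \<phi> y j = h j (g (cl j, a j))) = y"
        by (rule the_equality) (use g(2) \<phi>_eqI in auto)
      then show "y \<in> (\<lambda>g. THE y. \<forall>j\<in>I. \<phi> y j = h j (g (cl j, a j))) ` G" using g(1) by blast
    qed
  qed (use finG in simp)
  moreover have "x \<in> S"
  proof -
    have "(\<lambda>t\<in>T. snd t) \<in> G" by (auto simp: G_def T_def)
    then show ?thesis using tT a(2) unfolding S_def by (intro CollectI bexI[of _ "\<lambda>t\<in>T. snd t"]) auto
  qed
  moreover have "is_subring S"
  proof (rule is_subring_if_finite_closed[OF \<open>finite S\<close> \<open>x \<in> S\<close>])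
    fix y z assume "y \<in> S" "z \<in> S"
    then obtain g g' where g: "g \<in> G" "\<And>j. j \<in> I \<Longrightarrow> \<phi> y j = h j (g (cl j, a j))"
      "g' \<in> G" "\<And>j. j \<in> I \<Longrightarrow> \<phi> z j = h j (g' (cl j, a j))" by (auto simp: S_def)
    have Gop: "(\<lambda>t\<in>T. f t (g t) (g' t)) \<in> G"
      if f: "\<And>t A B. t \<in> T \<Longrightarrow> A \<in> carrier (M (s (fst t))) \<Longrightarrow> B \<in> carrier (M (s (fst t))) \<Longrightarrow>
        f t A B \<in> carrier (M (s (fst t)))" for f
      unfolding G_def
    proof (rule restrict_PiE_iff[THEN iffD2], rule ballI)
      fix t assume t: "t \<in> T"
      show "f t (g t) (g' t) \<in> carrier (M (s (fst t)))"
        using f[OF t PiE_mem[OF g(1)[unfolded G_def] t] PiE_mem[OF g(3)[unfolded G_def] t]] .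
    qed
    have Ts: "s (fst t) \<in> I" if "t \<in> T" for t using sI that by (auto simp: T_def)
    have "(\<lambda>t\<in>T. g t \<oplus>\<^bsub>M (s (fst t))\<^esub> g' t) \<in> G"
      by (rule Gop) (rule M_closed(1)[OF Ts])
    moreover have "\<phi> (y + z) j = h j ((\<lambda>t\<in>T. g t \<oplus>\<^bsub>M (s (fst t))\<^esub> g' t) (cl j, a j))" if "j \<in> I" for j
      using that tT[OF that] ring_iso_memE(3)[OF h[OF that] gC gC, of g g'] g by (simp add: \<phi>_add)
    ultimately show "y + z \<in> S" unfolding S_def by blast
    have "(\<lambda>t\<in>T. g t \<otimes>\<^bsub>M (s (fst t))\<^esub> g' t) \<in> G"
      by (rule Gop) (rule M_closed(2)[OF Ts])
    moreover have "\<phi> (y * z) j = h j ((\<lambda>t\<in>T. g t \<otimes>\<^bsub>M (s (fst t))\<^esub> g' t) (cl j, a j))" if "j \<in> I" for j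
      using that tT[OF that] ring_iso_memE(2)[OF h[OF that] gC gC, of g g'] g by (simp add: \<phi>_mult)
    ultimately show "y * z \<in> S" unfolding S_def by blast
  qed
  ultimately show "finite (\<Inter>{S. is_subring S \<and> x \<in> S})"
    by (intro finite_subset[OF Inter_lower]) auto
qed

end

theorem theorem1p3:
  shows "semisimple TYPE('a::topological_ring) \<and> weakly_locally_finite TYPE('a) \<and>
      profinite_ring TYPE('a) \<longleftrightarrow>
    (\<exists>(I :: 'a set) (F :: 'a \<Rightarrow> nat ring) (k :: 'a \<Rightarrow> nat) (\<phi> :: 'a \<Rightarrow> 'a \<Rightarrow> nat \<times> nat \<Rightarrow> nat).
      finite_type_matrix_product I F k \<phi>)"
proof
  assume "semisimple TYPE('a) \<and> weakly_locally_finite TYPE('a) \<and> profinite_ring TYPE('a)"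
  then obtain I :: "'a set" and F :: "'a \<Rightarrow> 'a ring" and k and \<phi> :: "'a \<Rightarrow> 'a \<Rightarrow> nat \<times> nat \<Rightarrow> 'a"
    where "finite_type_matrix_product I F k \<phi>"
    using matrix_product_if_profinite by blast
  then show "\<exists>(I :: 'a set) (F :: 'a \<Rightarrow> nat ring) k (\<phi> :: 'a \<Rightarrow> 'a \<Rightarrow> nat \<times> nat \<Rightarrow> nat).
      finite_type_matrix_product I F k \<phi>"
    \<comment> \<open>The fields found so far are corners, with elements in the ring itself; their
      elements are recoded as natural numbers.\<close>
    by (rule finite_type_matrix_product_canonical_types)
next
  assume "\<exists>(I :: 'a set) (F :: 'a \<Rightarrow> nat ring) k (\<phi> :: 'a \<Rightarrow> 'a \<Rightarrow> nat \<times> nat \<Rightarrow> nat).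
      finite_type_matrix_product I F k \<phi>"
  then obtain I :: "'a set" and F :: "'a \<Rightarrow> nat ring" and k and \<phi> :: "'a \<Rightarrow> 'a \<Rightarrow> nat \<times> nat \<Rightarrow> nat"
    where "finite_type_matrix_product I F k \<phi>" by blast
  then interpret matrix_product I F k \<phi> by unfold_locales
  show "semisimple TYPE('a) \<and> weakly_locally_finite TYPE('a) \<and> profinite_ring TYPE('a)"
    using semisimple weakly_locally_finite profinite by blast
qed

end
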